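(* Let $m,n\in\mathbb{N}$, let $K\subseteq\mathbb{R}^n$ be compact, and let $$T:\mathrm{Herm}_m[x_1,\dots,x_n]\to\mathrm{Herm}_m[x_1,\dots,x_n]$$ be linear with canonical representation $$T=\sum_{\alpha\in\mathbb{N}_0^n}\frac1{\alpha!}\,(Q_\alpha\times\partial^\alpha).$$ Then the following are equivalent: (i) $T$ is a $K$-positivity preserver, i.e., $T\,\mathrm{Pos}(K)\subseteq\mathrm{Pos}(K)$. (ii) For each $y\in K$, there exists a positive operator-valued measure $\nu_y$ on $K-y\subseteq\mathbb{R}^n$ such that $$Q_\beta(M)(y)=\int_{K-y}t^\beta\,\mathrm{d}\nu_y[M](t)$$ for all $\beta\in\mathbb{N}_0^n$ and all $M\in\mathrm{Herm}_m$. Moreover, in this case (i.e., for $\nu_y$, $y\in K$, as in (ii)), $$(T_yp)(x)=\int_{K-y}p(x+t)\,\mathrm{d}\nu_y(t)$$ for all $x\in K$ and $p\in\mathrm{Herm}_m[x_1,\dots,x_n]$.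
   Context: $\mathrm{Herm}_m\subseteq\mathbb{C}^{m\times m}$ is the real vector space of Hermitian $m\times m$ matrices, with inner product $\langle A,B\rangle:=\mathrm{tr}(AB)\in\mathbb{R}$; $\mathrm{Herm}_{m,+}$ is the subset of positive semi-definite matrices. $\mathrm{Herm}_m[x_1,\dots,x_n]$ is the real vector space of polynomials in $x_1,\dots,x_n$ with coefficients in $\mathrm{Herm}_m$. $\mathrm{Pos}(K):=\{P\in\mathrm{Herm}_m[x_1,\dots,x_n]\mid P(x)\succeq0\text{ for all }x\in K\}$. Linear means $\mathbb{R}$-linear; $\mathbb{N}_0=\{0,1,2,\dots\}$; $K-y:=\{k-y\mid k\in K\}$. Orthonormal basis of $\mathrm{Herm}_m$: with $E_{k,l}$ the matrix units, $H_{k,l}:=\frac{1}{\sqrt2}(E_{k,l}+E_{l,k})$ for $k<l$, $H_{k,k}:=E_{k,k}$, and $H_{k,l}:=\frac{i}{\sqrt2}(E_{k,l}-E_{l,k})$ (with $i$ the imaginary unit) for $k>l$, where $k,l=1,\dots,m$. Canonical representation: every linear $T:\mathrm{Herm}_m[x_1,\dots,x_n]\to\mathrm{Herm}_m[x_1,\dots,x_n]$ can be written uniquely as $T=\sum_{\alpha}\frac1{\alpha!}(Q_\alpha\times\partial^\alpha)$ with linear maps $Q_\alpha:\mathrm{Herm}_m\to\mathrm{Herm}_m[x_1,\dots,x_n]$, where $Q_\alpha\times\partial^\alpha$ is the linear map determined by $(Q_\alpha\times\partial^\alpha)(Mx^\beta):=Q_\alpha(M)\cdot\partial^\alpha x^\beta$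 for $M\in\mathrm{Herm}_m$, $\beta\in\mathbb{N}_0^n$. For $y\in\mathbb{R}^n$, $T_y:\mathrm{Herm}_m[x_1,\dots,x_n]\to\mathrm{Herm}_m[x_1,\dots,x_n]$ is the linear map with $T_y(Mx^\beta)=\sum_\alpha\frac1{\alpha!}Q_\alpha(M)(y)\cdot\partial^\alpha x^\beta$, where $Q_\alpha(M)(y)\in\mathrm{Herm}_m$ is the value of $Q_\alpha(M)$ at $y$. A matrix-valued measure on a measurable space is $\mu=(\mu_{i,j})_{i,j=1}^m$ with finite complex measures $\mu_{i,j}$ such that $\mu(S)\in\mathrm{Herm}_m$ for all measurable $S$; it is positive if $\mu(S)\in\mathrm{Herm}_{m,+}$ for all measurable $S$. Let $\mathcal{L}(\mathrm{Herm}_m,\mathrm{Herm}_m)$ be the space of $\mathbb{R}$-linear maps $\mathrm{Herm}_m\to\mathrm{Herm}_m$. A positive operator-valued measure on a closed set $K'\subseteq\mathbb{R}^n$ is a set function $\mu:\mathfrak{B}(K')\to\mathcal{L}(\mathrm{Herm}_m,\mathrm{Herm}_m)$ on the Borel $\sigma$-algebra such that $\mu[M]:=\mu(\cdot)(M):\mathfrak{B}(K')\to\mathrm{Herm}_m$ is a positive matrix-valued measure for every $M\in\mathrm{Herm}_{m,+}$ (then, by linearity, $\mu[M]$ is a matrix-valued measure for every $M\in\mathrm{Herm}_m$). For scalar $f$, $\int f\,\mathrm{d}\mu[M]\in\mathrm{Herm}_m$ is taken entrywise, and for $p\in\mathrm{Herm}_m[x_1,\dots,x_n]$, $$\int_{K'}p(x)\,\mathrm{d}\mu(x):=\sum_{i,j=1}^m\int_{K'}\langle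 p(x),H_{i,j}\rangle\,\mathrm{d}\mu[H_{i,j}](x)\in\mathrm{Herm}_m .$$ *)

theory Defs
  imports "HOL-Analysis.Analysis" "HOL-Library.Poly_Mapping"
begin

section \<open>Hermitian matrices\<close>

definition hermitian :: "complex^'m^'m \<Rightarrow> bool" where
  "hermitian A \<longleftrightarrow> (\<forall>i j. cnj (A $ i $ j) = A $ j $ i)"

typedef 'm herm = "{A :: complex^'m^'m. hermitian A}"
  morphisms herm_mat Abs_herm
  by (rule exI[of _ 0]) (simp add: hermitian_def)

setup_lifting type_definition_herm

instantiation herm :: (finite) real_vector
begin

lift_definition zero_herm :: "'a herm" is 0
  by (simp add: hermitian_def)

lift_definition plus_herm :: "'a herm \<Rightarrow> 'a herm \<Rightarrow> 'a herm" is "(+)"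
  by (simp add: hermitian_def)

lift_definition minus_herm :: "'a herm \<Rightarrow> 'a herm \<Rightarrow> 'a herm" is "(-)"
  by (simp add: hermitian_def)

lift_definition uminus_herm :: "'a herm \<Rightarrow> 'a herm" is uminus
  by (simp add: hermitian_def)

lift_definition scaleR_herm :: "real \<Rightarrow> 'a herm \<Rightarrow> 'a herm" is scaleR
  by (simp add: hermitian_def)

instance
  by standard (transfer; simp add: algebra_simps)+

end

lift_definition herm_psd :: "'m::finite herm \<Rightarrow> bool" is
  "\<lambda>A. \<forall>v :: complex^'m. 0 \<le> Re (\<Sum>i\<in>UNIV. \<Sum>j\<in>UNIV. cnj (v $ i) * A $ i $ j * v $ j)" .

text \<open>The trace of a product of two Hermitian matrices is real, so \<^const>\<open>Re\<close> loses nothing here.\<close>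

definition herm_inner :: "'m::finite herm \<Rightarrow> 'm herm \<Rightarrow> real" where
  "herm_inner A B = Re (trace (herm_mat A ** herm_mat B))"

lemma trace_herm_real: "Im (trace (herm_mat A ** herm_mat B)) = 0"
proof -
  have h: "cnj (herm_mat C $ i $ j) = herm_mat C $ j $ i" for C :: "'a herm" and i j
    using herm_mat[of C] by (auto simp: hermitian_def)
  have "cnj (trace (herm_mat A ** herm_mat B))
      = (\<Sum>i\<in>UNIV. \<Sum>k\<in>UNIV. herm_mat A $ k $ i * herm_mat B $ i $ k)"
    by (simp add: trace_def matrix_matrix_mult_def h)
  also have "\<dots> = trace (herm_mat A ** herm_mat B)"
    by (subst sum.swap) (simp add: trace_def matrix_matrix_mult_def)
  finally show ?thesis by (simp add: complex_eq_iff)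
qed

definition matrix_unit :: "'m::finite \<Rightarrow> 'm \<Rightarrow> complex^'m^'m" where
  "matrix_unit k l = (\<chi> i j. if i = k \<and> j = l then 1 else 0)"

text \<open>The index set \<open>{1, \<dots>, m}\<close> is a finite linearly ordered type; the order only selects which of
  the two off-diagonal families a pair of indices belongs to.\<close>

lift_definition herm_basis :: "'m::{finite,linorder} \<Rightarrow> 'm \<Rightarrow> 'm herm" is
  "\<lambda>k l. if k < l then (1 / sqrt 2) *\<^sub>R (matrix_unit k l + matrix_unit l k)
         else if k = l then matrix_unit k k
         else (\<chi> i j. (\<i> / complex_of_real (sqrt 2)) * (matrix_unit k l - matrix_unit l k) $ i $ j)"
  by (auto simp: hermitian_def matrix_unit_def)

section \<open>Polynomials\<close>

text \<open>A polynomial is the finitely supported family of its coefficients, indexed by the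
  multi-indices \<open>nat^'n\<close>.\<close>

type_synonym 'n multiindex = "nat^'n"
type_synonym 'n real_mpoly = "(nat^'n) \<Rightarrow>\<^sub>0 real"
type_synonym ('m, 'n) herm_mpoly = "(nat^'n) \<Rightarrow>\<^sub>0 'm herm"

instantiation poly_mapping :: (type, real_vector) real_vector
begin

lift_definition scaleR_poly_mapping :: "real \<Rightarrow> ('a \<Rightarrow>\<^sub>0 'b) \<Rightarrow> ('a \<Rightarrow>\<^sub>0 'b)" is
  "\<lambda>c f k. c *\<^sub>R f k"
  by (erule rev_finite_subset) auto

instance
  by standard (transfer; simp add: fun_eq_iff algebra_simps)+

end

definition monom_eval :: "'n::finite multiindex \<Rightarrow> real^'n \<Rightarrow> real" where
  "monom_eval \<alpha> x = (\<Prod>i\<in>UNIV. x $ i ^ (\<alpha> $ i))"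

definition mpoly_eval :: "(('n::finite) multiindex \<Rightarrow>\<^sub>0 'b::real_vector) \<Rightarrow> real^'n \<Rightarrow> 'b" where
  "mpoly_eval p x = (\<Sum>\<alpha>\<in>Poly_Mapping.keys p. monom_eval \<alpha> x *\<^sub>R Poly_Mapping.lookup p \<alpha>)"

definition mfact :: "'n::finite multiindex \<Rightarrow> real" where
  "mfact \<alpha> = (\<Prod>i\<in>UNIV. fact (\<alpha> $ i))"

text \<open>Formal partial derivatives, coefficientwise: \<open>\<partial>\<^sup>\<alpha> x\<^sup>\<beta> = \<beta>! / (\<beta> - \<alpha>)! x\<^sup>\<beta>\<^sup>-\<^sup>\<alpha>\<close> if \<open>\<alpha> \<le> \<beta>\<close>
  and \<open>0\<close> otherwise. The lemmas below show that these are composed of the first-order ones and that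
  the first-order ones are the analytic partial derivatives.\<close>

lift_definition mderiv :: "'n::finite multiindex \<Rightarrow> 'n real_mpoly \<Rightarrow> 'n real_mpoly" is
  "\<lambda>\<alpha> f \<gamma>. mfact (\<gamma> + \<alpha>) / mfact \<gamma> * f (\<gamma> + \<alpha>)"
proof -
  fix \<alpha> :: "'n multiindex" and f :: "'n multiindex \<Rightarrow> real"
  assume f: "finite {\<gamma>. f \<gamma> \<noteq> 0}"
  have "finite ((\<lambda>\<gamma>. \<gamma> + \<alpha>) -` {\<gamma>. f \<gamma> \<noteq> 0})"
    by (rule finite_vimageI[OF f]) (simp add: inj_on_def)
  then show "finite {\<gamma>. mfact (\<gamma> + \<alpha>) / mfact \<gamma> * f (\<gamma> + \<alpha>) \<noteq> 0}"
    by (rule rev_finite_subset) auto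
qed

lemma mfact_pos: "mfact \<alpha> > 0"
  by (simp add: mfact_def prod_pos)

lemma mfact_nonzero: "mfact \<alpha> \<noteq> 0"
  using mfact_pos[of \<alpha>] by simp

lemma mderiv_zero: "mderiv 0 p = p"
  by transfer (simp add: fun_eq_iff mfact_nonzero)

lemma mderiv_add: "mderiv (\<alpha> + \<beta>) p = mderiv \<alpha> (mderiv \<beta> p)"
  by transfer (simp add: fun_eq_iff mfact_nonzero add.assoc)

lemma mpoly_eval_superset:
  assumes "finite A" "Poly_Mapping.keys p \<subseteq> A"
  shows "mpoly_eval p x = (\<Sum>\<alpha>\<in>A. monom_eval \<alpha> x *\<^sub>R Poly_Mapping.lookup p \<alpha>)"
  unfolding mpoly_eval_def using assms
  by (intro sum.mono_neutral_left) (auto simp: in_keys_iff)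

lemma mpoly_eval_add: "mpoly_eval (p + q) x = mpoly_eval p x + mpoly_eval q x"
proof -
  let ?A = "Poly_Mapping.keys p \<union> Poly_Mapping.keys q"
  have "mpoly_eval r x = (\<Sum>\<alpha>\<in>?A. monom_eval \<alpha> x *\<^sub>R Poly_Mapping.lookup r \<alpha>)"
    if "r \<in> {p, q, p + q}" for r
    using that Poly_Mapping.keys_add[of p q] by (intro mpoly_eval_superset) auto
  then show ?thesis
    by (simp add: lookup_add scaleR_add_right sum.distrib)
qed

lemma mpoly_eval_single: "mpoly_eval (Poly_Mapping.single \<beta> c) x = monom_eval \<beta> x *\<^sub>R c"
  by (subst mpoly_eval_superset[of "{\<beta>}"]) auto

lemma mderiv_plus: "mderiv \<alpha> (p + q) = mderiv \<alpha> p + mderiv \<alpha> q"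
  by transfer (simp add: fun_eq_iff algebra_simps)

lemma mderiv_null: "mderiv \<alpha> 0 = 0"
  by transfer simp

lemma mfact_axis: "mfact (\<gamma> + axis i 1) = of_nat (\<gamma> $ i + 1) * mfact \<gamma>"
proof -
  have "mfact (\<gamma> + axis i 1) = fact (\<gamma> $ i + 1) * (\<Prod>j\<in>UNIV - {i}. fact (\<gamma> $ j))"
    unfolding mfact_def by (subst prod.remove[of _ i]) (auto simp: axis_def intro!: prod.cong)
  moreover have "mfact \<gamma> = fact (\<gamma> $ i) * (\<Prod>j\<in>UNIV - {i}. fact (\<gamma> $ j))"
    unfolding mfact_def by (subst prod.remove[of _ i]) auto
  ultimately show ?thesis by simp
qed

lemma mderiv_axis_single:
  "mderiv (axis i 1) (Poly_Mapping.single \<beta> c) =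
     Poly_Mapping.single (\<beta> - axis i 1) (of_nat (\<beta> $ i) * c)"
proof (rule poly_mapping_eqI)
  fix \<gamma>
  have l: "Poly_Mapping.lookup (mderiv (axis i 1) (Poly_Mapping.single \<beta> c)) \<gamma> =
      of_nat (\<gamma> $ i + 1) * (if \<beta> = \<gamma> + axis i 1 then c else 0)"
    using mfact_pos[of \<gamma>] unfolding mderiv.rep_eq mfact_axis
    by (auto simp: lookup_single when_def)
  have "\<gamma> + axis i 1 = \<beta>" if "\<beta> - axis i 1 = \<gamma>" "\<beta> $ i \<noteq> 0"
  proof (rule vec_eq_iff[THEN iffD2], rule allI)
    fix j
    show "(\<gamma> + axis i 1) $ j = \<beta> $ j"
      using that by (cases "j = i") (auto simp: axis_def)
  qed
  then have no: "\<not> (\<beta> - axis i 1 = \<gamma> \<and> \<beta> $ i \<noteq> 0)" if "\<beta> \<noteq> \<gamma> + axis i 1"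
    using that by metis
  show "Poly_Mapping.lookup (mderiv (axis i 1) (Poly_Mapping.single \<beta> c)) \<gamma> =
      Poly_Mapping.lookup (Poly_Mapping.single (\<beta> - axis i 1) (of_nat (\<beta> $ i) * c)) \<gamma>"
  proof (cases "\<beta> = \<gamma> + axis i 1")
    case True
    then have "\<beta> - axis i 1 = \<gamma>" "\<beta> $ i = \<gamma> $ i + 1"
      by (simp_all add: axis_def)
    then show ?thesis
      unfolding l using True by (simp add: lookup_single)
  next
    case False
    then show ?thesis
      using no[OF False] unfolding l lookup_single when_def by (cases "\<beta> $ i = 0") simp_all
  qed
qed

lemma mderiv_axis_has_derivative:
  "((\<lambda>s. mpoly_eval p (x + s *\<^sub>R axis i 1)) has_real_derivative
     mpoly_eval (mderiv (axis i 1) p) x) (at 0)"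
proof (induction p rule: Poly_Mapping.update_induct)
  case const
  show ?case by (simp add: mpoly_eval_def mderiv_null)
next
  case (update f \<beta> c)
  have split: "monom_eval \<gamma> y = y $ i ^ (\<gamma> $ i) * (\<Prod>j\<in>UNIV - {i}. y $ j ^ (\<gamma> $ j))" for \<gamma> y
    unfolding monom_eval_def by (subst prod.remove[of _ i]) auto
  have 1: "monom_eval \<beta> (x + s *\<^sub>R axis i 1) =
      (x $ i + s) ^ (\<beta> $ i) * (\<Prod>j\<in>UNIV - {i}. x $ j ^ (\<beta> $ j))" for s
    unfolding split by (auto simp: axis_def intro!: prod.cong)
  have 2: "monom_eval (\<beta> - axis i 1) x =
      x $ i ^ (\<beta> $ i - 1) * (\<Prod>j\<in>UNIV - {i}. x $ j ^ (\<beta> $ j))"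
    unfolding split by (auto simp: axis_def intro!: prod.cong)
  have 3: "((\<lambda>s. mpoly_eval (Poly_Mapping.single \<beta> c) (x + s *\<^sub>R axis i 1)) has_real_derivative
     mpoly_eval (mderiv (axis i 1) (Poly_Mapping.single \<beta> c)) x) (at 0)"
    unfolding mderiv_axis_single mpoly_eval_single 1 2
    by (auto intro!: derivative_eq_intros)
  have "Poly_Mapping.update \<beta> c f = f + Poly_Mapping.single \<beta> c"
    using update(1) by (intro poly_mapping_eqI)
      (auto simp: lookup_update lookup_add lookup_single in_keys_iff)
  then show ?case
    using DERIV_add[OF update(3) 3] by (simp add: mpoly_eval_add mderiv_plus)
qed

text \<open>Product of a real polynomial and a polynomial with Hermitian coefficients.\<close>

definition mpoly_smult :: "'n::finite real_mpoly \<Rightarrow> ('m::finite, 'n) herm_mpoly \<Rightarrow> ('m, 'n) herm_mpoly"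
  where "mpoly_smult f P = (\<Sum>\<beta>\<in>Poly_Mapping.keys f. \<Sum>\<gamma>\<in>Poly_Mapping.keys P.
           Poly_Mapping.single (\<beta> + \<gamma>) (Poly_Mapping.lookup f \<beta> *\<^sub>R Poly_Mapping.lookup P \<gamma>))"

definition Pos :: "(real^'n) set \<Rightarrow> ('m::finite, 'n::finite) herm_mpoly set" where
  "Pos K = {P. \<forall>x\<in>K. herm_psd (mpoly_eval P x)}"

section \<open>Canonical representation\<close>

text \<open>The linear map \<open>Q \<times> \<partial>\<^sup>\<alpha>\<close>, determined by \<open>M x\<^sup>\<beta> \<mapsto> Q(M) \<cdot> \<partial>\<^sup>\<alpha> x\<^sup>\<beta>\<close>.\<close>

definition times_deriv ::
  "('m::finite herm \<Rightarrow> ('m, 'n::finite) herm_mpoly) \<Rightarrow> 'n multiindex \<Rightarrow>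
   ('m, 'n) herm_mpoly \<Rightarrow> ('m, 'n) herm_mpoly" where
  "times_deriv Q \<alpha> p = (\<Sum>\<beta>\<in>Poly_Mapping.keys p.
     mpoly_smult (mderiv \<alpha> (Poly_Mapping.single \<beta> 1)) (Q (Poly_Mapping.lookup p \<beta>)))"

lemma times_deriv_single:
  assumes "linear Q"
  shows "times_deriv Q \<alpha> (Poly_Mapping.single \<beta> M) =
         mpoly_smult (mderiv \<alpha> (Poly_Mapping.single \<beta> 1)) (Q M)"
  using linear_0[OF assms] by (cases "M = 0") (auto simp: times_deriv_def mpoly_smult_def)

text \<open>The operator \<open>\<Sum>\<^sub>\<alpha> (1 / \<alpha>!) (Q\<^sub>\<alpha> \<times> \<partial>\<^sup>\<alpha>)\<close>. The sum over all multi-indices has only finitely many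
  nonzero terms at each \<open>p\<close> (lemma \<open>finite_canonical_terms\<close>), so \<^const>\<open>Sum_any\<close> is the actual sum.\<close>

definition canonical_op ::
  "('n::finite multiindex \<Rightarrow> 'm::finite herm \<Rightarrow> ('m, 'n) herm_mpoly) \<Rightarrow>
   ('m, 'n) herm_mpoly \<Rightarrow> ('m, 'n) herm_mpoly" where
  "canonical_op Q p = Sum_any (\<lambda>\<alpha>. (1 / mfact \<alpha>) *\<^sub>R times_deriv (Q \<alpha>) \<alpha> p)"

lemma finite_multiindex_le: "finite {\<alpha> :: 'n::finite multiindex. \<forall>i. \<alpha> $ i \<le> \<beta> $ i}"
proof -
  have "finite (UNIV \<rightarrow>\<^sub>E {..Max (range (($) \<beta>))} :: ('n \<Rightarrow> nat) set)"
    by (intro finite_PiE) auto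
  then have "finite (vec_lambda ` (UNIV \<rightarrow>\<^sub>E {..Max (range (($) \<beta>))} :: ('n \<Rightarrow> nat) set))"
    by simp
  then show ?thesis
  proof (rule rev_finite_subset, safe)
    fix \<alpha> :: "'n multiindex" assume le: "\<forall>i. \<alpha> $ i \<le> \<beta> $ i"
    have "\<alpha> $ i \<le> Max (range (($) \<beta>))" for i
      using le[rule_format, of i] Max_ge[of "range (($) \<beta>)" "\<beta> $ i"] by (meson finite finite_imageI le_trans rangeI)
    then show "\<alpha> \<in> vec_lambda ` (UNIV \<rightarrow>\<^sub>E {..Max (range (($) \<beta>))})"
      by (intro image_eqI[of _ _ "($) \<alpha>"]) auto
  qed
qed

lemma finite_canonical_terms:
  "finite {\<alpha>. (1 / mfact \<alpha>) *\<^sub>R times_deriv (Q \<alpha>) \<alpha> p \<noteq> 0}"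
proof -
  have "{\<alpha>. (1 / mfact \<alpha>) *\<^sub>R times_deriv (Q \<alpha>) \<alpha> p \<noteq> 0}
      \<subseteq> (\<Union>\<beta>\<in>Poly_Mapping.keys p. {\<alpha>. \<forall>i. \<alpha> $ i \<le> \<beta> $ i})"
  proof (rule subsetI, rule ccontr)
    fix \<alpha> assume a: "\<alpha> \<in> {\<alpha>. (1 / mfact \<alpha>) *\<^sub>R times_deriv (Q \<alpha>) \<alpha> p \<noteq> 0}"
      and n: "\<alpha> \<notin> (\<Union>\<beta>\<in>Poly_Mapping.keys p. {\<alpha>. \<forall>i. \<alpha> $ i \<le> \<beta> $ i})"
    have "mderiv \<alpha> (Poly_Mapping.single \<beta> 1) = 0" if "\<beta> \<in> Poly_Mapping.keys p" for \<beta>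
    proof -
      have "\<gamma> + \<alpha> \<noteq> \<beta>" for \<gamma>
        using n that by auto
      then show ?thesis
        by transfer (auto simp: fun_eq_iff when_def)
    qed
    then have "times_deriv (Q \<alpha>) \<alpha> p = 0"
      by (simp add: times_deriv_def mpoly_smult_def)
    with a show False by simp
  qed
  then show ?thesis
    by (rule finite_subset) (auto intro: finite_multiindex_le)
qed

definition canonical_rep ::
  "(('m::finite, 'n::finite) herm_mpoly \<Rightarrow> ('m, 'n) herm_mpoly) \<Rightarrow>
   ('n multiindex \<Rightarrow> 'm herm \<Rightarrow> ('m, 'n) herm_mpoly) \<Rightarrow> bool" where
  "canonical_rep T Q \<longleftrightarrow> (\<forall>\<alpha>. linear (Q \<alpha>)) \<and> T = canonical_op Q"

text \<open>\<open>T\<^sub>y\<close>, for \<open>T\<close> with canonical representation \<open>Q\<close>: every \<open>Q\<^sub>\<alpha>(M)\<close> is replaced by the constant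
  polynomial with value \<open>Q\<^sub>\<alpha>(M)(y)\<close>.\<close>

definition op_at ::
  "('n::finite multiindex \<Rightarrow> 'm::finite herm \<Rightarrow> ('m, 'n) herm_mpoly) \<Rightarrow> real^'n \<Rightarrow>
   ('m, 'n) herm_mpoly \<Rightarrow> ('m, 'n) herm_mpoly" where
  "op_at Q y = canonical_op (\<lambda>\<alpha> M. Poly_Mapping.single 0 (mpoly_eval (Q \<alpha> M) y))"

section \<open>Matrix-valued and operator-valued measures\<close>

text \<open>A finite complex measure is a countably additive complex-valued set function on the measurable
  sets; \<open>\<rho> {} = 0\<close> follows, as does the independence of the sum from the enumeration.\<close>

definition complex_measure :: "'a measure \<Rightarrow> ('a set \<Rightarrow> complex) \<Rightarrow> bool" where
  "complex_measure N \<rho> \<longleftrightarrow>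
     (\<forall>A :: nat \<Rightarrow> 'a set. range A \<subseteq> sets N \<longrightarrow> disjoint_family A \<longrightarrow>
        (\<lambda>i. \<rho> (A i)) sums \<rho> (\<Union>i. A i))"

definition matrix_measure :: "'a measure \<Rightarrow> ('a set \<Rightarrow> 'm::finite herm) \<Rightarrow> bool" where
  "matrix_measure N \<mu> \<longleftrightarrow> (\<forall>i j. complex_measure N (\<lambda>S. herm_mat (\<mu> S) $ i $ j))"

definition positive_matrix_measure :: "'a measure \<Rightarrow> ('a set \<Rightarrow> 'm::finite herm) \<Rightarrow> bool" where
  "positive_matrix_measure N \<mu> \<longleftrightarrow> matrix_measure N \<mu> \<and> (\<forall>S\<in>sets N. herm_psd (\<mu> S))"

definition positive_operator_measure ::
  "('a::topological_space) set \<Rightarrow> ('a set \<Rightarrow> 'm::finite herm \<Rightarrow> 'm herm) \<Rightarrow> bool" where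
  "positive_operator_measure K \<mu> \<longleftrightarrow>
     (\<forall>S\<in>sets (restrict_space borel K). linear (\<mu> S)) \<and>
     (\<forall>M. herm_psd M \<longrightarrow> positive_matrix_measure (restrict_space borel K) (\<lambda>S. \<mu> S M))"

text \<open>Integration against a complex measure through the Jordan decomposition of its real and
  imaginary parts. The positive part of a signed measure \<open>\<nu>\<close> is \<open>\<nu>\<^sup>+(A) = sup {\<nu>(B) | B \<subseteq> A}\<close>; since
  \<open>B = {}\<close> is admitted, truncation at \<open>0\<close> by \<^const>\<open>ennreal\<close> does not affect the supremum.\<close>

definition positive_part :: "'a measure \<Rightarrow> ('a set \<Rightarrow> real) \<Rightarrow> 'a measure" where
  "positive_part N \<nu> = measure_of (space N) (sets N) (\<lambda>A. SUP B\<in>{B \<in> sets N. B \<subseteq> A}. ennreal (\<nu> B))"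

definition signed_integral :: "'a measure \<Rightarrow> ('a set \<Rightarrow> real) \<Rightarrow> ('a \<Rightarrow> real) \<Rightarrow> real" where
  "signed_integral N \<nu> f =
     integral\<^sup>L (positive_part N \<nu>) f - integral\<^sup>L (positive_part N (\<lambda>S. - \<nu> S)) f"

lemma signed_integral_finite_measure:
  assumes "finite_measure \<mu>" and sets: "sets \<mu> = sets N"
  shows "signed_integral N (measure \<mu>) f = integral\<^sup>L \<mu> f"
proof -
  interpret finite_measure \<mu> by fact
  have sp: "space \<mu> = space N" using sets by (rule sets_eq_imp_space_eq)
  have "positive_part N (measure \<mu>) = measure_of (space N) (sets N) (emeasure \<mu>)"
    unfolding positive_part_def
  proof (rule measure_of_eq)
    fix A assume "A \<in> sigma_sets (space N) (sets N)"
    then have A: "A \<in> sets N" by (simp add: sets.sigma_sets_eq)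
    show "(SUP B\<in>{B \<in> sets N. B \<subseteq> A}. ennreal (measure \<mu> B)) = emeasure \<mu> A"
      by (rule antisym; (rule SUP_least | rule SUP_upper2[of A]))
        (use A in \<open>auto simp: emeasure_eq_measure[symmetric] sets[symmetric] intro: emeasure_mono\<close>)
  qed (simp add: sets.space_closed)
  also have "\<dots> = \<mu>"
    using measure_of_of_measure[of \<mu>] by (simp add: sp sets)
  finally have 1: "positive_part N (measure \<mu>) = \<mu>" .
  have "positive_part N (\<lambda>S. - measure \<mu> S) = measure_of (space N) (sets N) (\<lambda>_. 0)"
    unfolding positive_part_def
    by (rule measure_of_eq[OF sets.space_closed], rule SUP_eq_const) (auto simp: ennreal_neg)
  also have "\<dots> = null_measure N"
    by (simp add: null_measure_def)
  finally show ?thesis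
    by (simp add: signed_integral_def 1)
qed

definition complex_measure_integral ::
  "'a measure \<Rightarrow> ('a set \<Rightarrow> complex) \<Rightarrow> ('a \<Rightarrow> real) \<Rightarrow> complex" where
  "complex_measure_integral N \<rho> f =
     Complex (signed_integral N (\<lambda>S. Re (\<rho> S)) f) (signed_integral N (\<lambda>S. Im (\<rho> S)) f)"

lift_definition matrix_measure_integral ::
  "'a measure \<Rightarrow> ('a set \<Rightarrow> 'm::finite herm) \<Rightarrow> ('a \<Rightarrow> real) \<Rightarrow> 'm herm" is
  "\<lambda>N \<mu> f. \<chi> i j. complex_measure_integral N (\<lambda>S. \<mu> S $ i $ j) f"
proof -
  fix N :: "'a measure" and \<mu> :: "'a set \<Rightarrow> complex^'m^'m" and f :: "'a \<Rightarrow> real"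
  assume h: "\<And>S. hermitian (\<mu> S)"
  have h': "\<mu> S $ i $ j = cnj (\<mu> S $ j $ i)" for S i j
    using h[of S] unfolding hermitian_def by simp
  have neg: "signed_integral N (\<lambda>S. - \<nu> S) f = - signed_integral N \<nu> f" for \<nu>
    by (simp add: signed_integral_def)
  have "cnj (complex_measure_integral N (\<lambda>S. \<mu> S $ i $ j) f) =
        complex_measure_integral N (\<lambda>S. \<mu> S $ j $ i) f" for i j
  proof -
    have "(\<lambda>S. Re (\<mu> S $ j $ i)) = (\<lambda>S. Re (\<mu> S $ i $ j))"
      by (subst h') (simp only: cnj.sel)
    moreover have "(\<lambda>S. Im (\<mu> S $ j $ i)) = (\<lambda>S. - Im (\<mu> S $ i $ j))"
      by (subst h') (simp only: cnj.sel)
    ultimately show ?thesis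
      by (simp only: complex_measure_integral_def neg complex_cnj)
  qed
  then show "hermitian (\<chi> i j. complex_measure_integral N (\<lambda>S. \<mu> S $ i $ j) f)"
    unfolding hermitian_def by simp
qed

definition operator_measure_integral ::
  "'a::topological_space set \<Rightarrow> ('a set \<Rightarrow> 'm::{finite,linorder} herm \<Rightarrow> 'm herm) \<Rightarrow>
   ('a \<Rightarrow> 'm herm) \<Rightarrow> 'm herm" where
  "operator_measure_integral K \<mu> p =
     (\<Sum>i\<in>UNIV. \<Sum>j\<in>UNIV. matrix_measure_integral (restrict_space borel K)
        (\<lambda>S. \<mu> S (herm_basis i j)) (\<lambda>x. herm_inner (p x) (herm_basis i j)))"

text \<open>\<open>\<nu>\<close> represents the family \<open>\<beta>, M \<mapsto> Q\<^sub>\<beta>(M)(y)\<close> as moments on the translate \<open>K - y\<close>.\<close>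

definition represents_at ::
  "(real^'n) set \<Rightarrow> ('n::finite multiindex \<Rightarrow> 'm::finite herm \<Rightarrow> ('m, 'n) herm_mpoly) \<Rightarrow> real^'n \<Rightarrow>
   ((real^'n) set \<Rightarrow> 'm herm \<Rightarrow> 'm herm) \<Rightarrow> bool" where
  "represents_at K Q y \<nu> \<longleftrightarrow>
     positive_operator_measure ((\<lambda>k. k - y) ` K) \<nu> \<and>
     (\<forall>\<beta> M. mpoly_eval (Q \<beta> M) y =
        matrix_measure_integral (restrict_space borel ((\<lambda>k. k - y) ` K)) (\<lambda>S. \<nu> S M) (monom_eval \<beta>))"

end

theory Submission
  imports Defs
begin

text \<open>At a point \<open>y\<close> of \<open>K\<close>, positivity preservation says that \<open>q \<mapsto> (T (q(x - y) M))(y)\<close> is, for every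
  positive semidefinite \<open>M\<close>, a functional on real polynomials which maps polynomials that are nonnegative on
  \<open>K - y\<close> to positive semidefinite matrices, and its value at \<open>t\<^sup>\<beta>\<close> is \<open>Q\<^sub>\<beta>(M)(y)\<close> by Taylor expansion.
  Composed with a quadratic form it extends by Stone-Weierstrass to a positive functional on \<open>C(K - y)\<close>
  and is represented by a measure. Uniqueness of representing measures makes the measures obtained from
  different forms and different \<open>M\<close> fit together linearly. Conversely, the integral of a
  positive semidefinite polynomial is a limit of sums \<open>\<Sum>\<^sub>d \<integral> f\<^sub>d d\<nu>\<^sub>y[M\<^sub>d]\<close> with \<open>f\<^sub>d \<ge> 0\<close> and \<open>M\<^sub>d\<close>
  positive semidefinite, and evaluates to \<open>T p\<close> at \<open>y\<close> by the same Taylor expansion.\<close>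

text \<open>The binder of \<^const>\<open>Sum_any\<close> would make \<open>\<Sum>i. f i\<close> ambiguous.\<close>

no_syntax
  "_Sum_any" :: "pttrn \<Rightarrow> 'a \<Rightarrow> 'a::comm_monoid_add"    (\<open>(\<open>indent=2 notation=\<open>binder \<Sum>\<close>\<close>\<Sum>_. _)\<close> [0, 10] 10)

section \<open>A Riesz representation theorem on compact metric spaces\<close>

text \<open>Positivity of \<open>T\<close> gives information for one psd coefficient
  \<open>M\<close> and one quadratic form at a time, and each such datum yields a separate measure.
  The entries of a matrix-valued measure are signed, so representation is phrased for differences of
  finite positive measures: polarization writes the real or imaginary part of an entry through three
  quadratic forms, and every \<open>M\<close> is a difference of two psd matrices. The integral of
  the definitions rests on suprema over subsets; a Hahn set shows that any decomposition into
  positive measures computes it, and this makes it linear in the measure. No factorial appears in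
  the moments because the derivative of order \<open>\<alpha>\<close> of \<open>q(x - y)\<close> at
  \<open>y\<close> is \<open>\<alpha>!\<close> times a coefficient of \<open>q\<close>, which
  cancels the factor in the canonical representation. In the converse the obstacle is that
  positivity of \<open>\<nu>\<close> concerns a fixed psd \<open>M\<close>, whereas the values of
  \<open>p(y + t)\<close> vary with \<open>t\<close>; uniform continuity on the compact set reduces
  them to finitely many fixed matrices. Compactness also makes every polynomial bounded, hence
  integrable against all measures that occur.\<close>

lemma suminf_ennreal_telescope:
  fixes a :: "nat \<Rightarrow> real"
  assumes "incseq a" "a 0 = 0"
  shows "(\<Sum>k. ennreal (a (Suc k) - a k)) = (SUP k. ennreal (a k))"
proof -
  have "(\<Sum>k<n. ennreal (a (Suc k) - a k)) = ennreal (a n)" for n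
    using assms by (subst sum_ennreal) (auto simp: incseq_Suc_iff sum_lessThan_telescope)
  then show ?thesis
    by (simp add: suminf_eq_SUP)
qed

text \<open>The functional takes total functions but is constrained only on those continuous on
  \<open>K\<close>; monotonicity then makes the value depend on nothing but the restriction to
  \<open>K\<close>.\<close>

locale positive_functional =
  fixes K :: "'a::metric_space set" and L :: "('a \<Rightarrow> real) \<Rightarrow> real"
  assumes compact_K: "compact K"
    and L_add: "continuous_on K f \<Longrightarrow> continuous_on K g \<Longrightarrow> L (\<lambda>x. f x + g x) = L f + L g"
    and L_scale: "continuous_on K f \<Longrightarrow> L (\<lambda>x. c * f x) = c * L f"
    and L_nonneg: "continuous_on K f \<Longrightarrow> (\<And>x. x \<in> K \<Longrightarrow> 0 \<le> f x) \<Longrightarrow> 0 \<le> L f"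
begin

lemma L_diff:
  assumes "continuous_on K f" "continuous_on K g"
  shows "L (\<lambda>x. f x - g x) = L f - L g"
  using L_add[of "\<lambda>x. f x - g x" g] assms by (simp add: continuous_intros)

lemma L_mono:
  assumes "continuous_on K f" "continuous_on K g" "\<And>x. x \<in> K \<Longrightarrow> f x \<le> g x"
  shows "L f \<le> L g"
  using L_nonneg[of "\<lambda>x. g x - f x"] L_diff[OF assms(2,1)] assms by (simp add: continuous_intros)

lemma L_zero: "L (\<lambda>x. 0) = 0"
  using L_scale[of "\<lambda>x. 0" 0] by simp

lemma L_const: "L (\<lambda>x. c) = c * L (\<lambda>x. 1)"
  using L_scale[of "\<lambda>x. 1" c] by simp

lemma L_sum:
  assumes "finite I" "\<And>i. i \<in> I \<Longrightarrow> continuous_on K (f i)"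
  shows "L (\<lambda>x. \<Sum>i\<in>I. f i x) = (\<Sum>i\<in>I. L (f i))"
  using assms
proof (induction I rule: finite_induct)
  case empty
  then show ?case by (simp add: L_zero)
next
  case (insert i I)
  then show ?case
    by (simp add: L_add continuous_on_sum)
qed

section \<open>An outer measure from series of continuous functions\<close>

definition cover :: "'a set \<Rightarrow> (nat \<Rightarrow> 'a \<Rightarrow> real) \<Rightarrow> bool" where
  "cover E f \<longleftrightarrow> (\<forall>i. continuous_on K (f i) \<and> (\<forall>x\<in>K. 0 \<le> f i x)) \<and>
     (\<forall>x\<in>E. 1 \<le> (\<Sum>i. ennreal (f i x)))"

text \<open>This is Daniell's upper integral of the indicator of \<open>E\<close>. Admitting
  countable sums of functions, instead of single ones, is what makes it countably
  subadditive.\<close>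

definition outer :: "'a set \<Rightarrow> ennreal" where
  "outer E = (INF f\<in>{f. cover E f}. \<Sum>i. ennreal (L (f i)))"

lemma outer_le: "cover E f \<Longrightarrow> outer E \<le> (\<Sum>i. ennreal (L (f i)))"
  unfolding outer_def by (rule INF_lower) simp

lemma outer_close: "outer E < e \<Longrightarrow> \<exists>f. cover E f \<and> (\<Sum>i. ennreal (L (f i))) < e"
  unfolding outer_def INF_less_iff by auto

lemma outer_mono: "E \<subseteq> F \<Longrightarrow> outer E \<le> outer F"
  unfolding outer_def cover_def by (rule INF_superset_mono) blast+

lemma outer_empty: "outer {} = 0"
proof -
  have "outer {} \<le> (\<Sum>i. ennreal (L (\<lambda>x. 0)))"
    by (rule outer_le) (simp add: cover_def)
  then show ?thesis by (simp add: L_zero)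
qed

lemma outer_le_single:
  assumes "continuous_on K f" "\<And>x. x \<in> K \<Longrightarrow> 0 \<le> f x" "\<And>x. x \<in> E \<Longrightarrow> 1 \<le> f x"
  shows "outer E \<le> ennreal (L f)"
proof -
  let ?f = "\<lambda>i::nat. if i = 0 then f else (\<lambda>x. 0)"
  have s: "(\<Sum>i. ennreal (?f i x)) = ennreal (f x)" for x
    using suminf_offset[of "\<lambda>i. ennreal (?f i x)" 1] by simp
  have l: "(\<Sum>i. ennreal (L (?f i))) = ennreal (L f)"
    using suminf_offset[of "\<lambda>i. ennreal (L (?f i))" 1] by (simp add: L_zero)
  have "outer E \<le> (\<Sum>i. ennreal (L (?f i)))"
    by (rule outer_le) (use assms in \<open>auto simp: cover_def s\<close>)
  then show ?thesis by (simp only: l)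
qed

text \<open>Nearly optimal covers of the \<open>A n\<close>, with slack \<open>e/2^(n+1)\<close>,
  are enumerated through \<open>prod_decode\<close> as one cover; nonnegative double series may be
  summed in any order.\<close>

lemma countably_subadditive_outer: "outer (\<Union>i. A i) \<le> (\<Sum>n. outer (A (n::nat)))"
proof (rule ennreal_le_epsilon)
  fix e :: real assume "0 < e" and fin: "(\<Sum>n. outer (A n)) < top"
  \<comment> \<open>Finiteness of the total makes each \<open>outer (A n)\<close> finite; otherwise
    adding slack would not give a strict inequality.\<close>
  then have *: "outer (A n) < outer (A n) + e * (1/2)^Suc n" for n
    by (auto simp add: less_top dest!: ennreal_suminf_lessD)
  obtain B where B: "\<And>n. cover (A n) (B n)"
    and Ble: "\<And>n. (\<Sum>i. ennreal (L (B n i))) \<le> outer (A n) + e * (1/2)^(Suc n)"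
    by (metis less_imp_le outer_close[OF *])
  define C where "C = case_prod B o prod_decode"
  have two: "(\<Sum>i. ennreal (C i x)) = (\<Sum>n. \<Sum>i. ennreal (B n i x))" for x
    using suminf_ennreal_2dimen[of "\<lambda>n. \<Sum>i. ennreal (B n i x)" "\<lambda>(n, i). ennreal (B n i x)"]
    by (simp add: C_def case_prod_beta)
  have "cover (\<Union>i. A i) C"
    unfolding cover_def
  proof (intro conjI ballI allI)
    fix x assume "x \<in> (\<Union>i. A i)"
    then obtain n where "x \<in> A n" by auto
    then have "1 \<le> (\<Sum>i. ennreal (B n i x))"
      using B[of n] by (auto simp: cover_def)
    also have "\<dots> \<le> (\<Sum>n. \<Sum>i. ennreal (B n i x))"
      using sum_le_suminf[of "\<lambda>n. \<Sum>i. ennreal (B n i x)" "{n}"] by simp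
    finally show "1 \<le> (\<Sum>i. ennreal (C i x))" by (simp only: two)
  qed (use B in \<open>auto simp: cover_def C_def case_prod_beta\<close>)
  then have "outer (\<Union>i. A i) \<le> (\<Sum>i. ennreal (L (C i)))"
    by (rule outer_le)
  also have "\<dots> = (\<Sum>n. \<Sum>i. ennreal (L (B n i)))"
    using suminf_ennreal_2dimen[of "\<lambda>n. \<Sum>i. ennreal (L (B n i))" "\<lambda>(n, i). ennreal (L (B n i))"]
    by (simp add: C_def case_prod_beta)
  also have "\<dots> \<le> (\<Sum>n. outer (A n) + e * (1/2) ^ Suc n)"
    by (intro suminf_le allI Ble) auto
  also have "\<dots> = (\<Sum>n. outer (A n)) + (\<Sum>n. ennreal e * ennreal ((1/2) ^ Suc n))"
    using \<open>0 < e\<close> by (subst suminf_add[symmetric])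
      (auto simp del: ennreal_suminf_cmult simp add: ennreal_mult[symmetric])
  also have "\<dots> = (\<Sum>n. outer (A n)) + e"
    unfolding ennreal_suminf_cmult
    by (subst suminf_ennreal_eq[OF zero_le_power power_half_series]) auto
  finally show "outer (\<Union>i. A i) \<le> (\<Sum>n. outer (A n)) + e" .
qed

lemma outer_measure_space_outer: "outer_measure_space (Pow K) outer"
  by (auto simp: outer_measure_space_def positive_def increasing_def countably_subadditive_def
      outer_empty outer_mono countably_subadditive_outer)

text \<open>The functions \<open>h\<^sub>k = min 1 (k g)\<close> increase to the indicator of \<open>{g > 0}\<close>, so a cover \<open>f\<close> of \<open>E\<close>
  splits into the cover \<open>f\<^sub>i (h\<^sub>k\<^sub>+\<^sub>1 - h\<^sub>k)\<close> of \<open>E \<inter> {g > 0}\<close> and the covers \<open>f\<^sub>i (1 - h\<^sub>k)\<close> of the rest.\<close>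

lemma outer_split:
  fixes g :: "'a \<Rightarrow> real"
  assumes g: "continuous_on K g" "\<And>x. x \<in> K \<Longrightarrow> 0 \<le> g x" and "E \<subseteq> K"
  shows "outer (E \<inter> {x\<in>K. 0 < g x}) + outer (E - {x\<in>K. 0 < g x}) \<le> outer E"
proof -
  let ?A = "{x\<in>K. 0 < g x}"
  define h where "h k x = min 1 (real k * g x)" for k x
  have h_cont: "continuous_on K (h k)" for k
    unfolding h_def by (intro continuous_intros g)
  have h_range: "0 \<le> h k x" "h k x \<le> 1" if "x \<in> K" for k x
    using g(2)[OF that] by (auto simp: h_def)
  have h_mono: "h k x \<le> h (Suc k) x" if "x \<in> K" for k x
    unfolding h_def using g(2)[OF that] by (intro min.mono mult_right_mono) auto
  have h_sup: "(SUP k. ennreal (f * h k x)) = ennreal f" if "x \<in> ?A" "0 \<le> f" for f x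
  proof (rule antisym)
    obtain k where "1 / g x < real k" using reals_Archimedean2 by blast
    then have "h k x = 1" using that by (simp add: h_def field_simps)
    then show "ennreal f \<le> (SUP k. ennreal (f * h k x))"
      by (intro SUP_upper2[of k]) auto
    show "(SUP k. ennreal (f * h k x)) \<le> ennreal f"
      using that h_range[of x] by (auto intro!: SUP_least ennreal_leI mult_left_le)
  qed
  show ?thesis
    unfolding outer_def[of E]
  proof (rule INF_greatest)
    fix f assume "f \<in> {f. cover E f}"
    then have f: "\<And>i. continuous_on K (f i)" "\<And>i x. x \<in> K \<Longrightarrow> 0 \<le> f i x"
      and cov: "\<And>x. x \<in> E \<Longrightarrow> 1 \<le> (\<Sum>i. ennreal (f i x))"
      by (auto simp: cover_def)
    let ?a = "\<lambda>i k. L (\<lambda>x. f i x * h k x)"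
    have a_cont: "continuous_on K (\<lambda>x. f i x * h k x)" for i k
      by (intro continuous_intros f h_cont)
    have a_inc: "incseq (?a i)" for i
      unfolding incseq_Suc_iff
      by (intro allI L_mono a_cont mult_left_mono h_mono f)
    have a0: "?a i 0 = 0" for i
      by (simp add: h_def L_zero)
    have a_nn: "0 \<le> ?a i k" for i k
      by (intro L_nonneg a_cont mult_nonneg_nonneg f h_range)
    have b_nn: "0 \<le> L (\<lambda>x. f i x * (1 - h k x))" for i k
      by (intro L_nonneg continuous_intros f h_cont mult_nonneg_nonneg) (use h_range in auto)
    \<comment> \<open>For fixed \<open>k\<close> the products \<open>f i * h k\<close> need not
      cover \<open>?A\<close>, since \<open>h k\<close> can be small there. Their increments in
      \<open>k\<close> do, and the \<open>L\<close>-values of the increments telescope, so no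
      continuity of \<open>L\<close> along monotone limits is required.\<close>
    define D where "D i k x = f i x * h (Suc k) x - f i x * h k x" for i k x
    have D_sum: "(\<Sum>k. ennreal (D i k x)) = ennreal (f i x)" if "x \<in> ?A" for i x
      unfolding D_def using that f(2)[of x i] h_mono[of x] h_sup[OF that, of "f i x"]
      by (subst suminf_ennreal_telescope) (auto simp: incseq_Suc_iff h_def[of 0] mult_left_mono)
    have "outer (E \<inter> ?A) \<le> (\<Sum>j. ennreal (L (case_prod D (prod_decode j))))"
    proof (rule outer_le, unfold cover_def, intro conjI ballI allI)
      fix x assume x: "x \<in> E \<inter> ?A"
      have "(\<Sum>j. ennreal (case_prod D (prod_decode j) x)) = (\<Sum>i. \<Sum>k. ennreal (D i k x))"
        using suminf_ennreal_2dimen[of "\<lambda>i. \<Sum>k. ennreal (D i k x)" "\<lambda>(i, k). ennreal (D i k x)"]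
        by (simp add: case_prod_beta)
      with x D_sum cov show "1 \<le> (\<Sum>j. ennreal (case_prod D (prod_decode j) x))" by simp
    next
      fix j show "continuous_on K (case_prod D (prod_decode j))"
        unfolding case_prod_beta D_def by (intro continuous_intros f h_cont)
    next
      fix j x assume "x \<in> K"
      then show "0 \<le> case_prod D (prod_decode j) x"
        using f(2) h_mono by (auto simp: case_prod_beta D_def intro!: mult_left_mono)
    qed
    also have "\<dots> = (\<Sum>i. \<Sum>k. ennreal (L (D i k)))"
      using suminf_ennreal_2dimen[of "\<lambda>i. \<Sum>k. ennreal (L (D i k))" "\<lambda>(i, k). ennreal (L (D i k))"]
      by (simp add: case_prod_beta)
    also have "\<dots> = (\<Sum>i. SUP k. ennreal (?a i k))"
      unfolding D_def L_diff[OF a_cont a_cont] suminf_ennreal_telescope[OF a_inc a0] ..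
    also have "\<dots> = (SUP k. \<Sum>i. ennreal (?a i k))"
      using a_inc by (intro ennreal_suminf_SUP_eq) (auto simp: incseq_def ennreal_leI)
    finally have 1: "outer (E \<inter> ?A) \<le> (SUP k. \<Sum>i. ennreal (?a i k))" .
    have 2: "(\<Sum>i. ennreal (?a i k)) + outer (E - ?A) \<le> (\<Sum>i. ennreal (L (f i)))" for k
    proof -
      have "outer (E - ?A) \<le> (\<Sum>i. ennreal (L (\<lambda>x. f i x * (1 - h k x))))"
      proof (rule outer_le, unfold cover_def, intro conjI ballI allI)
        fix x assume x: "x \<in> E - ?A"
        then have "g x = 0" using g(2)[of x] \<open>E \<subseteq> K\<close> by auto
        then have "h k x = 0" by (simp add: h_def)
        then show "1 \<le> (\<Sum>i. ennreal (f i x * (1 - h k x)))" using cov x by simp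
      qed (use f h_range in \<open>auto intro!: continuous_intros h_cont mult_nonneg_nonneg\<close>)
      then have "(\<Sum>i. ennreal (?a i k)) + outer (E - ?A) \<le>
         (\<Sum>i. ennreal (?a i k)) + (\<Sum>i. ennreal (L (\<lambda>x. f i x * (1 - h k x))))"
        by (rule add_left_mono)
      also have "\<dots> = (\<Sum>i. ennreal (?a i k) + ennreal (L (\<lambda>x. f i x * (1 - h k x))))"
        by (rule suminf_add) auto
      also have "\<dots> = (\<Sum>i. ennreal (L (f i)))"
      proof (rule arg_cong[of _ _ suminf], rule ext)
        fix i
        have "L (f i) = L (\<lambda>x. f i x * h k x + f i x * (1 - h k x))"
          by (simp add: algebra_simps)
        also have "\<dots> = ?a i k + L (\<lambda>x. f i x * (1 - h k x))"
          by (intro L_add a_cont continuous_intros f h_cont)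
        finally show "ennreal (?a i k) + ennreal (L (\<lambda>x. f i x * (1 - h k x))) = ennreal (L (f i))"
          using a_nn b_nn by simp
      qed
      finally show ?thesis .
    qed
    have "outer (E \<inter> ?A) + outer (E - ?A) \<le> (SUP k. \<Sum>i. ennreal (?a i k)) + outer (E - ?A)"
      using 1 by (rule add_right_mono)
    also have "\<dots> = (SUP k. (\<Sum>i. ennreal (?a i k)) + outer (E - ?A))"
      by (rule ennreal_SUP_add_left[symmetric]) simp
    also have "\<dots> \<le> (\<Sum>i. ennreal (L (f i)))"
      by (rule SUP_least) (rule 2)
    finally show "outer (E \<inter> ?A) + outer (E - ?A) \<le> (\<Sum>i. ennreal (L (f i)))" .
  qed
qed

text \<open>By compactness, a Dini argument turns the pointwise bound \<open>1 \<le> \<Sum>\<^sub>i f\<^sub>i\<close> into a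
  uniform one for a finite partial sum.\<close>

lemma outer_space: "outer K = ennreal (L (\<lambda>x. 1))"
proof (rule antisym)
  show "outer K \<le> ennreal (L (\<lambda>x. 1))"
    by (rule outer_le_single) auto
  have l1: "0 \<le> L (\<lambda>x. 1)" by (rule L_nonneg) auto
  show "ennreal (L (\<lambda>x. 1)) \<le> outer K"
    unfolding outer_def
  proof (rule INF_greatest)
    fix f assume "f \<in> {f. cover K f}"
    then have f: "\<And>i. continuous_on K (f i)" "\<And>i x. x \<in> K \<Longrightarrow> 0 \<le> f i x"
      and cov: "\<And>x. x \<in> K \<Longrightarrow> 1 \<le> (\<Sum>i. ennreal (f i x))"
      by (auto simp: cover_def)
    let ?s = "\<lambda>n x. \<Sum>i<n. f i x"
    have dini: "\<exists>n. \<forall>x\<in>K. c < ?s n x" if c: "c < 1" for c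
    proof (rule ccontr)
      assume "\<not> ?thesis"
      then obtain X where X: "\<And>n. X n \<in> K" "\<And>n. ?s n (X n) \<le> c"
        by (metis not_less)
      then obtain x r where x: "x \<in> K" "strict_mono r" "(X \<circ> r) \<longlonglongrightarrow> x"
        using compact_K unfolding compact_eq_seq_compact_metric seq_compact_def by metis
      \<comment> \<open>Once \<open>r n\<close> is at least \<open>m\<close>, the partial sum of
        length \<open>m\<close> at \<open>X (r n)\<close> is below the one of length
        \<open>r n\<close>, hence below \<open>c\<close>. Continuity of the fixed partial sum
        carries this bound to the limit point.\<close>
      have le: "?s m x \<le> c" for m
      proof (rule LIMSEQ_le_const2)
        have "continuous_on K (?s m)" by (intro continuous_intros f)
        then show "(\<lambda>n. ?s m (X (r n))) \<longlonglongrightarrow> ?s m x"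
          using x X(1) unfolding continuous_on_sequentially by (auto simp: o_def)
        show "\<exists>N. \<forall>n\<ge>N. ?s m (X (r n)) \<le> c"
        proof (intro exI[of _ m] allI impI)
          fix n assume "m \<le> n"
          then have "m \<le> r n" using seq_suble[OF x(2), of n] by linarith
          then have "?s m (X (r n)) \<le> ?s (r n) (X (r n))"
            using f(2) X(1) by (intro sum_mono2) auto
          with X(2)[of "r n"] show "?s m (X (r n)) \<le> c" by linarith
        qed
      qed
      have "(\<Sum>i. ennreal (f i x)) = (SUP n. \<Sum>i<n. ennreal (f i x))"
        by (rule suminf_eq_SUP)
      also have "\<dots> \<le> ennreal c"
        using le x(1) f(2) by (auto intro!: SUP_least ennreal_leI)
      finally have "1 \<le> ennreal c" using cov[OF x(1)] by order
      with c show False by (simp add: ennreal_ge_1)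
    qed
    have fin: "ennreal (c * L (\<lambda>x. 1)) \<le> (\<Sum>i. ennreal (L (f i)))" if c: "c < 1" for c
    proof -
      obtain n where n: "\<forall>x\<in>K. c < ?s n x" using dini[OF c] by auto
      have "c * L (\<lambda>x. 1) = L (\<lambda>x. c)" by (rule L_const[symmetric])
      also have "\<dots> \<le> L (?s n)"
        using n by (intro L_mono continuous_intros f) auto
      also have "\<dots> = (\<Sum>i<n. L (f i))"
        by (intro L_sum f) auto
      finally have "ennreal (c * L (\<lambda>x. 1)) \<le> (\<Sum>i<n. ennreal (L (f i)))"
        using L_nonneg[OF f] by (simp add: ennreal_leI)
      also have "\<dots> \<le> (\<Sum>i. ennreal (L (f i)))"
        by (rule sum_le_suminf) auto
      finally show ?thesis .
    qed
    \<comment> \<open>The uniform bound is available only for \<open>c < 1\<close>; it is pushed to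
      the limit along \<open>1 - 1/(n+1)\<close>.\<close>
    have "(\<lambda>n. ennreal ((1 - inverse (real (Suc n))) * L (\<lambda>x. 1))) \<longlonglongrightarrow> ennreal ((1 - 0) * L (\<lambda>x. 1))"
      by (intro tendsto_ennrealI tendsto_intros LIMSEQ_inverse_real_of_nat)
    then show "ennreal (L (\<lambda>x. 1)) \<le> (\<Sum>i. ennreal (L (f i)))"
      using fin by (intro LIMSEQ_le_const2[where X = "\<lambda>n. ennreal ((1 - inverse (real (Suc n))) * L (\<lambda>x. 1))"]) auto
  qed
qed

section \<open>Caratheodory measurability of Borel sets\<close>

lemma measure_space_outer: "measure_space K (lambda_system K (Pow K) outer) outer"
  by (rule sigma_algebra.caratheodory_lemma[OF sigma_algebra_Pow outer_measure_space_outer])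

text \<open>One inequality of Caratheodory's condition is \<open>outer_split\<close>, the other is
  subadditivity. With \<open>g\<close> the distance to the complement, this reaches the traces on
  \<open>K\<close> of all open sets other than the whole space, and so all Borel sets.\<close>

lemma positive_set_in_lambda_system:
  fixes g :: "'a \<Rightarrow> real"
  assumes g: "continuous_on K g" "\<And>x. x \<in> K \<Longrightarrow> 0 \<le> g x"
  shows "{x\<in>K. 0 < g x} \<in> lambda_system K (Pow K) outer"
proof -
  let ?A = "{x\<in>K. 0 < g x}"
  interpret sigma_algebra K "Pow K" by (rule sigma_algebra_Pow)
  have "outer (E \<inter> ?A) + outer (E - ?A) = outer E" if "E \<subseteq> K" for E
  proof (rule antisym)
    show "outer (E \<inter> ?A) + outer (E - ?A) \<le> outer E"
      using g that by (rule outer_split)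
    have "subadditive (Pow K) outer"
      using outer_measure_space_outer
      by (simp add: outer_measure_space_def countably_subadditive_subadditive)
    from subadditiveD[OF this, of "E \<inter> ?A" "E - ?A"] that
    show "outer E \<le> outer (E \<inter> ?A) + outer (E - ?A)"
      by (auto simp: Int_Diff_Un)
  qed
  then show ?thesis by (auto simp: lambda_system_eq)
qed

definition caratheodory_measure :: "'a measure" where
  "caratheodory_measure = measure_of K (lambda_system K (Pow K) outer) outer"

lemma
  shows space_caratheodory: "space caratheodory_measure = K"
    and sets_caratheodory: "sets caratheodory_measure = lambda_system K (Pow K) outer"
    and emeasure_caratheodory: "E \<in> lambda_system K (Pow K) outer \<Longrightarrow>
      emeasure caratheodory_measure E = outer E"
proof -
  interpret sigma_algebra K "lambda_system K (Pow K) outer"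
    using measure_space_outer by (simp add: measure_space_def)
  show "space caratheodory_measure = K" "sets caratheodory_measure = lambda_system K (Pow K) outer"
    by (simp_all add: caratheodory_measure_def space_measure_of_conv sets_measure_of_conv
        space_closed sigma_sets_eq)
  show "emeasure caratheodory_measure E = outer E" if "E \<in> lambda_system K (Pow K) outer"
    using that measure_space_outer unfolding caratheodory_measure_def measure_space_def
    by (intro emeasure_measure_of_sigma) auto
qed

text \<open>The sigma-algebra of Caratheodory-measurable sets may exceed the Borel sets of
  \<open>K\<close>. Pushing forward along the identity keeps the values and restricts the measure to
  \<open>restrict_space borel K\<close>.\<close>

definition riesz_measure :: "'a measure" where
  "riesz_measure = distr caratheodory_measure (restrict_space borel K) (\<lambda>x. x)"

lemma measurable_caratheodory: "(\<lambda>x. x) \<in> caratheodory_measure \<rightarrow>\<^sub>M restrict_space borel K"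
proof (rule measurable_restrict_space2)
  show "(\<lambda>x. x) \<in> space caratheodory_measure \<rightarrow> K"
    by (simp add: space_caratheodory)
  show "(\<lambda>x. x) \<in> borel_measurable caratheodory_measure"
  proof (rule borel_measurableI)
    fix U :: "'a set" assume "open U"
    show "(\<lambda>x. x) -` U \<inter> space caratheodory_measure \<in> sets caratheodory_measure"
    \<comment> \<open>\<open>infdist x {}\<close> is \<open>0\<close> by convention, so the open set
      with empty complement is treated separately.\<close>
    proof (cases "U = UNIV")
      case True
      then show ?thesis using sets.top[of caratheodory_measure] by simp
    next
      case False
      then have "x \<in> U \<longleftrightarrow> 0 < infdist x (- U)" for x
        using \<open>open U\<close> in_closed_iff_infdist_zero[of "- U" x] infdist_nonneg[of x "- U"]
        by (auto simp: closed_Compl less_le)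
      then have "(\<lambda>x. x) -` U \<inter> space caratheodory_measure = {x\<in>K. 0 < infdist x (- U)}"
        by (auto simp: space_caratheodory)
      also have "\<dots> \<in> sets caratheodory_measure"
        unfolding sets_caratheodory
        by (rule positive_set_in_lambda_system)
          (auto intro!: continuous_intros infdist_nonneg)
      finally show ?thesis .
    qed
  qed
qed

lemma sets_riesz: "sets riesz_measure = sets (restrict_space borel K)"
  by (simp add: riesz_measure_def)

lemma space_riesz: "space riesz_measure = K"
  by (simp add: riesz_measure_def space_restrict_space)

lemma emeasure_riesz:
  assumes "S \<in> sets (restrict_space borel K)"
  shows "emeasure riesz_measure S = outer S"
proof -
  have "S \<subseteq> K" using sets.sets_into_space[OF assms] by (simp add: space_restrict_space)
  then have "(\<lambda>x. x) -` S \<inter> space caratheodory_measure = S"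
    by (auto simp: space_caratheodory)
  then show ?thesis
    using measurable_sets[OF measurable_caratheodory assms] emeasure_caratheodory[of S]
    unfolding riesz_measure_def
    by (simp add: emeasure_distr[OF measurable_caratheodory assms] sets_caratheodory)
qed

lemma finite_measure_riesz: "finite_measure riesz_measure"
proof
  have "K \<in> sets (restrict_space borel K)"
    using sets.top[of "restrict_space borel K"] by (simp add: space_restrict_space)
  then show "emeasure riesz_measure (space riesz_measure) \<noteq> \<infinity>"
    by (simp add: space_riesz emeasure_riesz outer_space)
qed

section \<open>Integrals of continuous functions\<close>

lemma borel_measurable_riesz: "continuous_on K f \<Longrightarrow> (f :: 'a \<Rightarrow> real) \<in> borel_measurable riesz_measure"
  using borel_measurable_continuous_on_restrict measurable_cong_sets[OF sets_riesz refl] by blast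

lemma integrable_riesz:
  assumes "continuous_on K (f :: 'a \<Rightarrow> real)"
  shows "integrable riesz_measure f"
proof -
  interpret finite_measure riesz_measure by (rule finite_measure_riesz)
  obtain B where "\<forall>x\<in>K. norm (f x) \<le> B"
    using compact_imp_bounded[OF compact_continuous_image[OF assms compact_K]]
    by (auto simp: bounded_iff)
  then show ?thesis
    by (intro integrable_const_bound[of _ B] borel_measurable_riesz assms)
      (auto simp: space_riesz)
qed

lemma measure_riesz_space: "measure riesz_measure K = L (\<lambda>x. 1)"
proof -
  have "K \<in> sets (restrict_space borel K)"
    using sets.top[of "restrict_space borel K"] by (simp add: space_restrict_space)
  moreover have "0 \<le> L (\<lambda>x. 1)" by (rule L_nonneg) auto
  ultimately show ?thesis
    by (simp add: measure_def emeasure_riesz outer_space)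
qed

text \<open>The function \<open>f\<close> is cut into layers \<open>m\<^sub>k\<^sub>+\<^sub>1 - m\<^sub>k\<close> of height \<open>d\<close>, where \<open>m\<^sub>k = min f (k d)\<close>; each
  layer equals \<open>d\<close> where the next one is positive.\<close>

lemma riesz_le:
  assumes f: "continuous_on K f" "\<And>x. x \<in> K \<Longrightarrow> 0 \<le> f x"
  shows "integral\<^sup>L riesz_measure f \<le> L f"
proof (rule field_le_epsilon)
  interpret finite_measure riesz_measure by (rule finite_measure_riesz)
  fix e :: real assume "0 < e"
  \<comment> \<open>The total error below is \<open>d\<close> times the mass
    \<open>L (\<lambda>x. 1)\<close>; the summand \<open>1\<close> keeps the denominator positive
    when the mass vanishes.\<close>
  define d where "d = e / (L (\<lambda>x. 1) + 1)"
  have l1: "0 \<le> L (\<lambda>x. 1)" by (rule L_nonneg) auto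
  have d: "0 < d" "d * L (\<lambda>x. 1) \<le> e"
    using \<open>0 < e\<close> l1 by (auto simp: d_def field_simps)
  obtain B where "\<forall>x\<in>K. norm (f x) \<le> B"
    using compact_imp_bounded[OF compact_continuous_image[OF f(1) compact_K]]
    by (auto simp: bounded_iff)
  moreover obtain n where "B / d < real n" using reals_Archimedean2 by blast
  ultimately have n: "f x \<le> real n * d" if "x \<in> K" for x
    using that d(1) by (fastforce simp: field_simps)
  define m where "m k x = min (f x) (real k * d)" for k x
  have m_cont: "continuous_on K (m k)" for k
    unfolding m_def by (intro continuous_intros f)
  have diff_range: "0 \<le> m (Suc k) x - m k x" "m (Suc k) x - m k x \<le> d" for k x
    using d(1) by (auto simp: m_def min_def field_simps)
  have m_mono: "m k x \<le> f x" for k x by (simp add: m_def)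
  have mn: "m n x = f x" "m 0 x = 0" if "x \<in> K" for x
    using n[OF that] f(2)[OF that] by (auto simp: m_def)
  let ?A = "\<lambda>k. {x\<in>K. 0 < m (Suc k) x - m k x}"
  have A_sets: "?A k \<in> sets riesz_measure" for k
    using borel_measurable_less[OF borel_measurable_const[of 0]
        borel_measurable_riesz[OF continuous_on_diff[OF m_cont m_cont, of "Suc k" k]]]
    by (simp add: space_riesz)
  have layer: "integral\<^sup>L riesz_measure (\<lambda>x. m (Suc k) x - m k x) \<le> d * measure riesz_measure (?A k)" for k
  proof -
    have "integral\<^sup>L riesz_measure (\<lambda>x. m (Suc k) x - m k x) \<le>
        integral\<^sup>L riesz_measure (\<lambda>x. d * indicator (?A k) x)"
    proof (rule integral_mono)
      show "integrable riesz_measure (\<lambda>x. m (Suc k) x - m k x)"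
        by (intro integrable_riesz continuous_intros m_cont)
      show "integrable riesz_measure (\<lambda>x. d * indicator (?A k) x :: real)"
        using A_sets by (intro integrable_mult_right) (simp add: emeasure_eq_measure)
      fix x assume "x \<in> space riesz_measure"
      then show "m (Suc k) x - m k x \<le> d * indicator (?A k) x"
        using diff_range[where k = k and x = x] by (auto simp: space_riesz indicator_def)
    qed
    then show ?thesis using A_sets[of k] sets.sets_into_space by (simp add: Int_absorb1)
  qed
  have chain: "d * measure riesz_measure (?A (Suc k)) \<le> L (m (Suc k)) - L (m k)" for k
  proof -
    have "outer (?A (Suc k)) \<le> ennreal (L (\<lambda>x. 1/d * (m (Suc k) x - m k x)))"
    proof (rule outer_le_single)
      show "continuous_on K (\<lambda>x. 1/d * (m (Suc k) x - m k x))"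
        by (intro continuous_intros m_cont)
      show "0 \<le> 1/d * (m (Suc k) x - m k x)" if "x \<in> K" for x
        using d diff_range[where k = k and x = x] by simp
      show "1 \<le> 1/d * (m (Suc k) x - m k x)" if "x \<in> ?A (Suc k)" for x
        using that d by (auto simp: m_def min_def field_simps split: if_splits)
    qed
    also have "L (\<lambda>x. 1/d * (m (Suc k) x - m k x)) = 1/d * (L (m (Suc k)) - L (m k))"
      by (subst L_scale) (auto intro!: continuous_intros m_cont simp: L_diff m_cont)
    finally have "emeasure riesz_measure (?A (Suc k)) \<le> ennreal (1/d * (L (m (Suc k)) - L (m k)))"
      using A_sets emeasure_riesz by (simp add: sets_riesz)
    moreover have "L (m k) \<le> L (m (Suc k))"
      using diff_range[where k = k] by (intro L_mono m_cont) auto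
    ultimately show ?thesis
      using d(1) by (simp add: emeasure_eq_measure field_simps)
  qed
  have tele: "(\<Sum>k<n. L (m (Suc k)) - L (m k)) \<le> L f" for n
  proof -
    have "(\<Sum>k<n. L (m (Suc k)) - L (m k)) = L (m n) - L (m 0)"
      by (rule sum_lessThan_telescope)
    moreover have "L (m n) \<le> L f" by (intro L_mono m_cont f m_mono)
    moreover have "0 \<le> L (m 0)" by (intro L_nonneg m_cont) (simp add: mn)
    ultimately show ?thesis by linarith
  qed
  have "integral\<^sup>L riesz_measure f = integral\<^sup>L riesz_measure (\<lambda>x. \<Sum>k<n. m (Suc k) x - m k x)"
    by (intro Bochner_Integration.integral_cong refl, subst sum_lessThan_telescope)
      (simp add: space_riesz mn)
  also have "\<dots> = (\<Sum>k<n. integral\<^sup>L riesz_measure (\<lambda>x. m (Suc k) x - m k x))"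
    by (intro Bochner_Integration.integral_sum integrable_riesz continuous_intros m_cont)
  also have "\<dots> \<le> (\<Sum>k<n. d * measure riesz_measure (?A k))"
    by (intro sum_mono layer)
  \<comment> \<open>\<open>chain\<close> bounds each layer by its predecessor, so the bottom layer,
    which has none, must be split off. It is at most \<open>d\<close> times the total mass, the only
    source of error; the extra top term merely completes the index shift.\<close>
  also have "\<dots> \<le> (\<Sum>k<Suc n. d * measure riesz_measure (?A k))"
    using d(1) by simp
  also have "\<dots> = d * measure riesz_measure (?A 0) + (\<Sum>k<n. d * measure riesz_measure (?A (Suc k)))"
    by (rule sum.lessThan_Suc_shift)
  also have "\<dots> \<le> d * measure riesz_measure K + (\<Sum>k<n. L (m (Suc k)) - L (m k))"
    using d(1) sets.top[of riesz_measure] A_sets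
    by (intro add_mono sum_mono chain mult_left_mono finite_measure_mono) (auto simp: space_riesz)
  also have "\<dots> \<le> e + L f"
    using d(2) tele[of n] by (simp add: measure_riesz_space)
  finally show "integral\<^sup>L riesz_measure f \<le> L f + e" by simp
qed

text \<open>\<open>riesz_le\<close> is one-sided and needs nonnegativity. Applied to
  \<open>f + B\<close> and to \<open>B - f\<close>, it gives both inequalities, because the total
  mass is known exactly.\<close>

lemma integral_riesz:
  assumes f: "continuous_on K f"
  shows "integral\<^sup>L riesz_measure f = L f"
proof -
  interpret finite_measure riesz_measure by (rule finite_measure_riesz)
  obtain B where "\<forall>x\<in>K. norm (f x) \<le> B"
    using compact_imp_bounded[OF compact_continuous_image[OF f compact_K]]
    by (auto simp: bounded_iff)
  then have B: "- B \<le> f x" "f x \<le> B" if "x \<in> K" for x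
    using that by (auto simp: abs_le_iff)
  have "integral\<^sup>L riesz_measure f + B * L (\<lambda>x. 1) = integral\<^sup>L riesz_measure (\<lambda>x. f x + B)"
    using integrable_riesz[OF f] by (simp add: measure_riesz_space space_riesz mult.commute)
  also have "\<dots> \<le> L (\<lambda>x. f x + B)"
    using B(1) by (intro riesz_le continuous_intros f) (metis add.commute minus_le_iff diff_ge_0_iff_ge diff_minus_eq_add)
  also have "\<dots> = L f + B * L (\<lambda>x. 1)"
    using L_add[OF f continuous_on_const[of K B]] L_const[of B] by simp
  finally have 1: "integral\<^sup>L riesz_measure f \<le> L f" by simp
  have "B * L (\<lambda>x. 1) - integral\<^sup>L riesz_measure f = integral\<^sup>L riesz_measure (\<lambda>x. B - f x)"
    using integrable_riesz[OF f] by (simp add: measure_riesz_space space_riesz mult.commute)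
  also have "\<dots> \<le> L (\<lambda>x. B - f x)"
    using B by (intro riesz_le continuous_intros f) simp
  also have "\<dots> = B * L (\<lambda>x. 1) - L f"
    using L_diff[OF continuous_on_const[of K B] f] L_const[of B] by simp
  finally have 2: "L f \<le> integral\<^sup>L riesz_measure f" by simp
  from 1 2 show ?thesis by (rule antisym)
qed

end

section \<open>Signed measures\<close>

definition signed_measure :: "'a measure \<Rightarrow> ('a set \<Rightarrow> real) \<Rightarrow> bool" where
  "signed_measure N \<nu> \<longleftrightarrow>
     (\<forall>A :: nat \<Rightarrow> 'a set. range A \<subseteq> sets N \<longrightarrow> disjoint_family A \<longrightarrow>
        (\<lambda>i. \<nu> (A i)) sums \<nu> (\<Union>i. A i))"

definition pos_measure :: "'a measure \<Rightarrow> ('a set \<Rightarrow> real) \<Rightarrow> bool" where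
  "pos_measure N \<nu> \<longleftrightarrow> signed_measure N \<nu> \<and> (\<forall>S\<in>sets N. 0 \<le> \<nu> S)"

definition as_measure :: "'a measure \<Rightarrow> ('a set \<Rightarrow> real) \<Rightarrow> 'a measure" where
  "as_measure N \<nu> = measure_of (space N) (sets N) (\<lambda>S. ennreal (\<nu> S))"

text \<open>Being a difference of finite positive measures is visibly stable under real linear
  combinations, which is how the entries of matrix-valued measures arise from quadratic forms.
  Values outside the measurable sets stay free.\<close>

definition jordan_measure :: "'a measure \<Rightarrow> ('a set \<Rightarrow> real) \<Rightarrow> bool" where
  "jordan_measure N \<nu> \<longleftrightarrow>
     (\<exists>\<nu>1 \<nu>2. pos_measure N \<nu>1 \<and> pos_measure N \<nu>2 \<and> (\<forall>S\<in>sets N. \<nu> S = \<nu>1 S - \<nu>2 S))"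

text \<open>Bounded functions are integrable against every finite measure at once, so linearity in
  the measure needs no further integrability condition. Functions continuous on a compact set
  qualify.\<close>

definition bounded_measurable :: "'a measure \<Rightarrow> ('a \<Rightarrow> real) \<Rightarrow> bool" where
  "bounded_measurable N f \<longleftrightarrow> f \<in> borel_measurable N \<and> (\<exists>B. \<forall>x\<in>space N. \<bar>f x\<bar> \<le> B)"

lemma signed_measure_cong:
  assumes \<nu>: "signed_measure N \<nu>" and eq: "\<And>S. S \<in> sets N \<Longrightarrow> \<nu>' S = \<nu> S"
  shows "signed_measure N \<nu>'"
  unfolding signed_measure_def
proof (intro allI impI)
  fix A :: "nat \<Rightarrow> 'a set" assume A: "range A \<subseteq> sets N" "disjoint_family A"
  have "(\<lambda>i. \<nu>' (A i)) = (\<lambda>i. \<nu> (A i))" using A(1) by (intro ext eq) auto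
  moreover have "\<nu>' (\<Union>i. A i) = \<nu> (\<Union>i. A i)"
    using A(1) by (intro eq sets.countable_UN)
  moreover have "(\<lambda>i. \<nu> (A i)) sums \<nu> (\<Union>i. A i)"
    using \<nu> A unfolding signed_measure_def by blast
  ultimately show "(\<lambda>i. \<nu>' (A i)) sums \<nu>' (\<Union>i. A i)" by simp
qed

lemma signed_measure_add:
  "signed_measure N \<nu> \<Longrightarrow> signed_measure N \<nu>' \<Longrightarrow> signed_measure N (\<lambda>S. \<nu> S + \<nu>' S)"
  by (simp add: signed_measure_def sums_add)

lemma signed_measure_diff:
  "signed_measure N \<nu> \<Longrightarrow> signed_measure N \<nu>' \<Longrightarrow> signed_measure N (\<lambda>S. \<nu> S - \<nu>' S)"
  by (simp add: signed_measure_def sums_diff)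

lemma signed_measure_scale: "signed_measure N \<nu> \<Longrightarrow> signed_measure N (\<lambda>S. c * \<nu> S)"
  by (simp add: signed_measure_def sums_mult)

lemma signed_measure_empty:
  assumes "signed_measure N \<nu>" shows "\<nu> {} = 0"
proof -
  have "(\<lambda>i::nat. \<nu> {}) sums \<nu> (\<Union>i::nat. {})"
    using assms[unfolded signed_measure_def, rule_format, of "\<lambda>i. {}"]
    by (simp add: disjoint_family_on_def image_subset_iff)
  then have "summable (\<lambda>i::nat. \<nu> {})" by (rule sums_summable)
  then show ?thesis by (simp add: summable_const_iff)
qed

lemma signed_measure_Un:
  assumes "signed_measure N \<nu>" "A \<in> sets N" "B \<in> sets N" "A \<inter> B = {}"
  shows "\<nu> (A \<union> B) = \<nu> A + \<nu> B"
proof -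
  have "range (binaryset A B) \<subseteq> sets N" "disjoint_family (binaryset A B)"
    using assms by (auto simp: range_binaryset_eq disjoint_family_on_def binaryset_def)
  then have "(\<lambda>i. \<nu> (binaryset A B i)) sums \<nu> (\<Union>i. binaryset A B i)"
    using assms(1) by (simp add: signed_measure_def)
  then have "(\<lambda>i. \<nu> (binaryset A B i)) sums \<nu> (A \<union> B)"
    by (simp only: UN_binaryset_eq)
  moreover have "(\<lambda>i. \<nu> (binaryset A B i)) sums (\<nu> A + \<nu> B)"
    by (rule binaryset_sums) (rule signed_measure_empty[OF assms(1)])
  ultimately show ?thesis by (rule sums_unique2)
qed

lemma signed_measure_restrict:
  assumes "signed_measure N \<nu>" "P \<in> sets N"
  shows "signed_measure N (\<lambda>S. \<nu> (S \<inter> P))"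
  unfolding signed_measure_def
proof (intro allI impI)
  fix A :: "nat \<Rightarrow> 'a set" assume "range A \<subseteq> sets N" "disjoint_family A"
  then have "range (\<lambda>i. A i \<inter> P) \<subseteq> sets N" "disjoint_family (\<lambda>i. A i \<inter> P)"
    using assms(2) by (auto simp: disjoint_family_on_def)
  then have "(\<lambda>i. \<nu> (A i \<inter> P)) sums \<nu> (\<Union>i. A i \<inter> P)"
    using assms(1) unfolding signed_measure_def by blast
  then show "(\<lambda>i. \<nu> (A i \<inter> P)) sums \<nu> ((\<Union>i. A i) \<inter> P)" by simp
qed

lemma signed_measure_measure:
  assumes "finite_measure A" "sets A = sets N"
  shows "signed_measure N (measure A)"
  unfolding signed_measure_def
  using finite_measure.finite_measure_UNION[OF assms(1), unfolded assms(2)] by blast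

lemma pos_measure_measure:
  assumes "finite_measure A" "sets A = sets N"
  shows "pos_measure N (measure A)"
  using signed_measure_measure[OF assms] by (simp add: pos_measure_def)

lemma pos_measure_zero: "pos_measure N (\<lambda>S. 0)"
  by (simp add: pos_measure_def signed_measure_def)

lemma pos_measure_add:
  "pos_measure N \<nu> \<Longrightarrow> pos_measure N \<nu>' \<Longrightarrow> pos_measure N (\<lambda>S. \<nu> S + \<nu>' S)"
  by (simp add: pos_measure_def signed_measure_add)

lemma pos_measure_scale: "pos_measure N \<nu> \<Longrightarrow> 0 \<le> c \<Longrightarrow> pos_measure N (\<lambda>S. c * \<nu> S)"
  by (simp add: pos_measure_def signed_measure_scale)

section \<open>Set functions turned into measures; additivity of the integral in the measure\<close>

lemma
  shows space_as_measure: "space (as_measure N \<nu>) = space N"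
    and sets_as_measure: "sets (as_measure N \<nu>) = sets N"
  by (auto simp: as_measure_def)

lemma measurable_as_measure: "measurable (as_measure N \<nu>) M = measurable N M"
  by (rule measurable_cong_sets) (simp_all add: sets_as_measure)

lemma emeasure_as_measure:
  assumes "pos_measure N \<nu>" "S \<in> sets N"
  shows "emeasure (as_measure N \<nu>) S = ennreal (\<nu> S)"
proof (rule emeasure_measure_of[OF as_measure_def sets.space_closed])
  show "S \<in> sets (as_measure N \<nu>)" using assms by (simp add: sets_as_measure)
  show "positive (sets (as_measure N \<nu>)) (\<lambda>S. ennreal (\<nu> S))"
    using assms signed_measure_empty by (auto simp: positive_def pos_measure_def)
  show "countably_additive (sets (as_measure N \<nu>)) (\<lambda>S. ennreal (\<nu> S))"
  proof (rule countably_additiveI)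
    fix A :: "nat \<Rightarrow> _" assume A: "range A \<subseteq> sets (as_measure N \<nu>)" "disjoint_family A"
    then have "(\<lambda>i. \<nu> (A i)) sums \<nu> (\<Union>i. A i)" "\<And>i. 0 \<le> \<nu> (A i)"
      using assms(1) by (auto simp: pos_measure_def signed_measure_def sets_as_measure)
    then show "(\<Sum>i. ennreal (\<nu> (A i))) = ennreal (\<nu> (\<Union>i. A i))"
      by (subst suminf_ennreal_eq) auto
  qed
qed

lemma finite_measure_as_measure:
  assumes "pos_measure N \<nu>" shows "finite_measure (as_measure N \<nu>)"
  by (rule finite_measureI) (simp add: space_as_measure emeasure_as_measure[OF assms])

lemma measure_as_measure:
  assumes "pos_measure N \<nu>" "S \<in> sets N"
  shows "measure (as_measure N \<nu>) S = \<nu> S"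
  using assms by (simp add: measure_def emeasure_as_measure) (simp add: pos_measure_def)

lemma as_measure_cong: "(\<And>S. S \<in> sets N \<Longrightarrow> \<nu> S = \<nu>' S) \<Longrightarrow> as_measure N \<nu> = as_measure N \<nu>'"
  unfolding as_measure_def
  by (rule measure_of_eq) (auto simp: sets.sigma_sets_eq sets.space_closed)

lemma integrable_as_measure:
  assumes "pos_measure N \<nu>" "bounded_measurable N f"
  shows "integrable (as_measure N \<nu>) f"
proof -
  interpret finite_measure "as_measure N \<nu>" by (rule finite_measure_as_measure) fact
  obtain B where B: "\<forall>x\<in>space N. \<bar>f x\<bar> \<le> B" and f: "f \<in> borel_measurable N"
    using assms(2) by (auto simp: bounded_measurable_def)
  show ?thesis
    by (intro integrable_const_bound[of _ B])
      (use B f in \<open>auto simp: space_as_measure measurable_as_measure\<close>)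
qed

text \<open>Additivity in the measure is clear for indicators and is lifted through nonnegative
  combinations and monotone limits.\<close>

lemma nn_integral_as_measure_add:
  assumes \<nu>: "pos_measure N \<nu>" "pos_measure N \<nu>'" and f: "f \<in> borel_measurable N"
  shows "nn_integral (as_measure N (\<lambda>S. \<nu> S + \<nu>' S)) f =
    nn_integral (as_measure N \<nu>) f + nn_integral (as_measure N \<nu>') f"
  using f
proof (induction rule: borel_measurable_induct)
  case (cong f g)
  then have "nn_integral (as_measure N \<mu>) f = nn_integral (as_measure N \<mu>) g" for \<mu>
    by (intro nn_integral_cong) (simp add: space_as_measure)
  with cong show ?case by metis
next
  case (set A)
  then have "A \<in> sets (as_measure N \<mu>)" for \<mu> by (simp add: sets_as_measure)
  then show ?case
    using set \<nu> by (simp add: emeasure_as_measure pos_measure_add) (auto simp: pos_measure_def)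
next
  case (mult u c)
  then show ?case by (simp add: nn_integral_cmult distrib_left measurable_as_measure)
next
  case (add u v)
  then show ?case by (simp add: nn_integral_add algebra_simps measurable_as_measure)
next
  case (seq U)
  have m: "U i \<in> borel_measurable (as_measure N \<mu>)" for \<mu> i
    using seq(1) by (simp add: measurable_as_measure)
  have S: "nn_integral (as_measure N \<mu>) (SUP i. U i) = (SUP i. nn_integral (as_measure N \<mu>) (U i))" for \<mu>
    using nn_integral_monotone_convergence_SUP[OF seq(3) m] by (simp add: SUP_apply[abs_def])
  have inc: "incseq (\<lambda>i. nn_integral (as_measure N \<mu>) (U i))" for \<mu>
    using seq(3) by (auto simp: incseq_def le_fun_def intro!: nn_integral_mono)
  show ?case
    unfolding S seq by (rule ennreal_SUP_add) (rule inc)+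
qed

lemma integral_as_measure_add:
  assumes \<nu>: "pos_measure N \<nu>" "pos_measure N \<nu>'" and f: "bounded_measurable N f"
  shows "integral\<^sup>L (as_measure N (\<lambda>S. \<nu> S + \<nu>' S)) f =
    integral\<^sup>L (as_measure N \<nu>) f + integral\<^sup>L (as_measure N \<nu>') f"
proof -
  have fm: "(\<lambda>x. ennreal (f x)) \<in> borel_measurable N" "(\<lambda>x. ennreal (- f x)) \<in> borel_measurable N"
    using f by (auto simp: bounded_measurable_def)
  have fin: "nn_integral (as_measure N \<mu>) (\<lambda>x. ennreal (f x)) < top"
      "nn_integral (as_measure N \<mu>) (\<lambda>x. ennreal (- f x)) < top" if "pos_measure N \<mu>" for \<mu>
    using integrable_as_measure[OF that f] by (auto simp: real_integrable_def less_top)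
  show ?thesis
    using \<nu> fin by (simp add: real_lebesgue_integral_def integrable_as_measure f pos_measure_add
        nn_integral_as_measure_add fm enn2real_plus)
qed

lemma integral_as_measure_scale:
  assumes \<nu>: "pos_measure N \<nu>" and c: "0 \<le> c" and f: "bounded_measurable N f"
  shows "integral\<^sup>L (as_measure N (\<lambda>S. c * \<nu> S)) f = c * integral\<^sup>L (as_measure N \<nu>) f"
proof -
  have "as_measure N (\<lambda>S. c * \<nu> S) = scale_measure (ennreal c) (as_measure N \<nu>)"
  proof (rule measure_eqI)
    show "sets (as_measure N (\<lambda>S. c * \<nu> S)) = sets (scale_measure (ennreal c) (as_measure N \<nu>))"
      by (simp add: sets_as_measure)
    fix S assume "S \<in> sets (as_measure N (\<lambda>S. c * \<nu> S))"
    then show "emeasure (as_measure N (\<lambda>S. c * \<nu> S)) S =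
        emeasure (scale_measure (ennreal c) (as_measure N \<nu>)) S"
      using c \<nu> by (simp add: sets_as_measure emeasure_as_measure pos_measure_scale ennreal_mult')
  qed
  moreover have "integrable (as_measure N \<nu>) f" "integrable (as_measure N (\<lambda>S. c * \<nu> S)) f"
    using assms by (auto intro!: integrable_as_measure pos_measure_scale)
  moreover have "(\<lambda>x. ennreal (f x)) \<in> borel_measurable (as_measure N \<nu>)"
      "(\<lambda>x. ennreal (- f x)) \<in> borel_measurable (as_measure N \<nu>)"
    using f by (auto simp: bounded_measurable_def measurable_as_measure)
  ultimately show ?thesis
    using c by (simp add: real_lebesgue_integral_def nn_integral_scale_measure enn2real_mult
        right_diff_distrib)
qed

section \<open>The signed integral as a bilinear pairing\<close>

lemma signed_integral_cong:
  assumes "\<And>S. S \<in> sets N \<Longrightarrow> \<nu> S = \<nu>' S"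
  shows "signed_integral N \<nu> f = signed_integral N \<nu>' f"
proof -
  have "positive_part N \<mu> = positive_part N \<mu>'" if "\<And>S. S \<in> sets N \<Longrightarrow> \<mu> S = \<mu>' S"
    for \<mu> \<mu>' :: "'a set \<Rightarrow> real"
    using that unfolding positive_part_def
    by (intro arg_cong[of _ _ "measure_of _ _"] ext SUP_cong) auto
  from this[of \<nu> \<nu>'] this[of "\<lambda>S. - \<nu> S" "\<lambda>S. - \<nu>' S"] assms show ?thesis
    unfolding signed_integral_def by simp
qed

text \<open>With \<open>P\<close> the positive set of a Hahn decomposition, the supremum over
  \<open>B \<subseteq> A\<close> is attained at \<open>A \<inter> P\<close>: dropping
  \<open>B - P\<close> and adding the rest of \<open>A \<inter> P\<close> can only increase the
  value.\<close>

lemma positive_part_hahn: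
  assumes \<nu>: "signed_measure N \<nu>" and P: "P \<in> sets N"
    and pos: "\<And>S. S \<in> sets N \<Longrightarrow> S \<subseteq> P \<Longrightarrow> 0 \<le> \<nu> S"
    and neg: "\<And>S. S \<in> sets N \<Longrightarrow> S \<inter> P = {} \<Longrightarrow> \<nu> S \<le> 0"
  shows "positive_part N \<nu> = as_measure N (\<lambda>S. \<nu> (S \<inter> P))"
  unfolding positive_part_def as_measure_def
proof (rule measure_of_eq[OF sets.space_closed])
  fix A assume "A \<in> sigma_sets (space N) (sets N)"
  then have A: "A \<in> sets N" by (simp add: sets.sigma_sets_eq)
  show "(SUP B\<in>{B \<in> sets N. B \<subseteq> A}. ennreal (\<nu> B)) = ennreal (\<nu> (A \<inter> P))"
  proof (rule antisym)
    show "ennreal (\<nu> (A \<inter> P)) \<le> (SUP B\<in>{B \<in> sets N. B \<subseteq> A}. ennreal (\<nu> B))"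
      using A P by (intro SUP_upper) auto
    show "(SUP B\<in>{B \<in> sets N. B \<subseteq> A}. ennreal (\<nu> B)) \<le> ennreal (\<nu> (A \<inter> P))"
    proof (rule SUP_least, rule ennreal_leI)
      fix B assume B: "B \<in> {B \<in> sets N. B \<subseteq> A}"
      have "\<nu> B = \<nu> (B \<inter> P) + \<nu> (B - P)"
        using signed_measure_Un[OF \<nu>, of "B \<inter> P" "B - P"] B P by (auto simp: Int_Diff_Un)
      also have "\<nu> (B - P) \<le> 0" using neg[of "B - P"] B P by auto
      finally have "\<nu> B \<le> \<nu> (B \<inter> P)" by simp
      moreover have "A \<inter> P = (B \<inter> P) \<union> ((A - B) \<inter> P)" using B by auto
      moreover have "\<nu> ((B \<inter> P) \<union> ((A - B) \<inter> P)) = \<nu> (B \<inter> P) + \<nu> ((A - B) \<inter> P)"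
        using A B P by (intro signed_measure_Un[OF \<nu>]) auto
      moreover have "0 \<le> \<nu> ((A - B) \<inter> P)" using A B P by (intro pos) auto
      ultimately show "\<nu> B \<le> \<nu> (A \<inter> P)" by simp
    qed
  qed
qed

text \<open>The given decomposition need not be the minimal one. Writing
  \<open>?p - ?n = \<nu>1 - \<nu>2\<close> without subtraction as
  \<open>?p + \<nu>2 = ?n + \<nu>1\<close> yields an equality of genuine measures, to which
  additivity of integrals applies. Every linearity property below goes through this
  reduction.\<close>

lemma signed_integral_diff_measures:
  assumes pos: "pos_measure N \<nu>1" "pos_measure N \<nu>2"
    and \<nu>: "\<forall>S\<in>sets N. \<nu> S = \<nu>1 S - \<nu>2 S" and f: "bounded_measurable N f"
  shows "signed_integral N \<nu> f = integral\<^sup>L (as_measure N \<nu>1) f - integral\<^sup>L (as_measure N \<nu>2) f"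
proof -
  let ?M1 = "as_measure N \<nu>1" and ?M2 = "as_measure N \<nu>2"
  have "\<exists>P\<in>sets N. (\<forall>X\<in>sets N. X \<subseteq> P \<longrightarrow> emeasure ?M2 X \<le> emeasure ?M1 X) \<and>
      (\<forall>X\<in>sets N. X \<inter> P = {} \<longrightarrow> emeasure ?M1 X \<le> emeasure ?M2 X)"
    using finite_unsigned_Hahn_decomposition[OF finite_measure_as_measure[OF pos(1)]
        finite_measure_as_measure[OF pos(2)] trans[OF sets_as_measure sets_as_measure[symmetric]]]
    unfolding sets_as_measure .
  then obtain P where P: "P \<in> sets N"
    and P1: "\<forall>X\<in>sets N. X \<subseteq> P \<longrightarrow> emeasure ?M2 X \<le> emeasure ?M1 X"
    and P2: "\<forall>X\<in>sets N. X \<inter> P = {} \<longrightarrow> emeasure ?M1 X \<le> emeasure ?M2 X"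
    by (elim bexE conjE)
  have "signed_measure N (\<lambda>S. \<nu>1 S - \<nu>2 S)"
    using pos by (intro signed_measure_diff) (auto simp: pos_measure_def)
  then have sm: "signed_measure N \<nu>"
    using \<nu> by (auto intro: signed_measure_cong)
  then have smn: "signed_measure N (\<lambda>S. - \<nu> S)"
    using signed_measure_scale[of N \<nu> "-1"] by simp
  have pP: "0 \<le> \<nu> S" if "S \<in> sets N" "S \<subseteq> P" for S
    using P1[rule_format, OF that] that(1) pos \<nu>
    by (simp add: emeasure_as_measure pos_measure_def)
  have nP: "\<nu> S \<le> 0" if "S \<in> sets N" "S \<inter> P = {}" for S
    using P2[rule_format, OF that] that(1) pos \<nu>
    by (simp add: emeasure_as_measure pos_measure_def)
  let ?p = "\<lambda>S. \<nu> (S \<inter> P)" and ?n = "\<lambda>S. - \<nu> (S \<inter> (space N - P))"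
  have pp: "positive_part N \<nu> = as_measure N ?p"
    using sm P pP nP by (rule positive_part_hahn)
  have pn: "positive_part N (\<lambda>S. - \<nu> S) = as_measure N ?n"
  proof (rule positive_part_hahn[OF smn])
    show "0 \<le> - \<nu> S" if "S \<in> sets N" "S \<subseteq> space N - P" for S using nP[of S] that by auto
    show "- \<nu> S \<le> 0" if "S \<in> sets N" "S \<inter> (space N - P) = {}" for S
      using pP[of S] that sets.sets_into_space[OF that(1)] by auto
  qed (use P in auto)
  have p: "pos_measure N ?p"
    using signed_measure_restrict[OF sm P] P by (auto simp: pos_measure_def intro!: pP)
  have n: "pos_measure N ?n"
    using signed_measure_restrict[OF smn, of "space N - P"] P
    by (auto simp: pos_measure_def intro!: nP)
  have "as_measure N (\<lambda>S. ?p S + \<nu>2 S) = as_measure N (\<lambda>S. ?n S + \<nu>1 S)"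
  proof (rule as_measure_cong)
    fix S assume S: "S \<in> sets N"
    then have "S = (S \<inter> P) \<union> (S \<inter> (space N - P))" using sets.sets_into_space by auto
    moreover have "\<nu> ((S \<inter> P) \<union> (S \<inter> (space N - P))) = \<nu> (S \<inter> P) + \<nu> (S \<inter> (space N - P))"
      using S P by (intro signed_measure_Un[OF sm]) auto
    ultimately have "\<nu> S = \<nu> (S \<inter> P) + \<nu> (S \<inter> (space N - P))" by simp
    with \<nu> S show "?p S + \<nu>2 S = ?n S + \<nu>1 S" by simp
  qed
  then have "integral\<^sup>L (as_measure N ?p) f + integral\<^sup>L ?M2 f =
      integral\<^sup>L (as_measure N ?n) f + integral\<^sup>L ?M1 f"
    using integral_as_measure_add[OF p pos(2) f] integral_as_measure_add[OF n pos(1) f] by simp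
  then show ?thesis unfolding signed_integral_def pp pn by simp
qed

lemma jordan_measure_pos: "pos_measure N \<nu> \<Longrightarrow> jordan_measure N \<nu>"
  unfolding jordan_measure_def
  by (intro exI[of _ \<nu>] exI[of _ "\<lambda>S. 0"] conjI pos_measure_zero) auto

lemma jordan_measure_signed:
  assumes "jordan_measure N \<nu>" shows "signed_measure N \<nu>"
proof -
  obtain a b where ab: "pos_measure N a" "pos_measure N b" "\<forall>S\<in>sets N. \<nu> S = a S - b S"
    using assms unfolding jordan_measure_def by auto
  then have "signed_measure N (\<lambda>S. a S - b S)"
    by (intro signed_measure_diff) (auto simp: pos_measure_def)
  then show ?thesis
    using ab(3) by (auto intro: signed_measure_cong)
qed

lemma jordan_measure_cong:
  "jordan_measure N \<nu> \<Longrightarrow> (\<And>S. S \<in> sets N \<Longrightarrow> \<nu>' S = \<nu> S) \<Longrightarrow> jordan_measure N \<nu>'"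
  by (simp add: jordan_measure_def)

lemma
  assumes "jordan_measure N \<nu>" "jordan_measure N \<nu>'"
  shows jordan_measure_add: "jordan_measure N (\<lambda>S. \<nu> S + \<nu>' S)"
    and signed_integral_add_measure: "bounded_measurable N f \<Longrightarrow>
      signed_integral N (\<lambda>S. \<nu> S + \<nu>' S) f = signed_integral N \<nu> f + signed_integral N \<nu>' f"
proof -
  obtain a b a' b' where ab: "pos_measure N a" "pos_measure N b" "\<forall>S\<in>sets N. \<nu> S = a S - b S"
    and ab': "pos_measure N a'" "pos_measure N b'" "\<forall>S\<in>sets N. \<nu>' S = a' S - b' S"
    using assms unfolding jordan_measure_def by auto
  have sum: "pos_measure N (\<lambda>S. a S + a' S)" "pos_measure N (\<lambda>S. b S + b' S)"
    "\<forall>S\<in>sets N. \<nu> S + \<nu>' S = (a S + a' S) - (b S + b' S)"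
    using ab ab' by (auto intro: pos_measure_add)
  then show "jordan_measure N (\<lambda>S. \<nu> S + \<nu>' S)"
    unfolding jordan_measure_def by blast
  assume f: "bounded_measurable N f"
  show "signed_integral N (\<lambda>S. \<nu> S + \<nu>' S) f = signed_integral N \<nu> f + signed_integral N \<nu>' f"
    unfolding signed_integral_diff_measures[OF ab f] signed_integral_diff_measures[OF ab' f]
      signed_integral_diff_measures[OF sum f]
      integral_as_measure_add[OF ab(1) ab'(1) f] integral_as_measure_add[OF ab(2) ab'(2) f]
    by simp
qed

lemma
  assumes "jordan_measure N \<nu>"
  shows jordan_measure_scale: "jordan_measure N (\<lambda>S. c * \<nu> S)"
    and signed_integral_scale_measure: "bounded_measurable N f \<Longrightarrow>
      signed_integral N (\<lambda>S. c * \<nu> S) f = c * signed_integral N \<nu> f"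
proof -
  obtain a b where ab: "pos_measure N a" "pos_measure N b" "\<forall>S\<in>sets N. \<nu> S = a S - b S"
    using assms unfolding jordan_measure_def by auto
  have "jordan_measure N (\<lambda>S. c * \<nu> S) \<and> (bounded_measurable N f \<longrightarrow>
      signed_integral N (\<lambda>S. c * \<nu> S) f = c * signed_integral N \<nu> f)" for f
  proof (cases "0 \<le> c")
    case True
    have *: "pos_measure N (\<lambda>S. c * a S)" "pos_measure N (\<lambda>S. c * b S)"
      "\<forall>S\<in>sets N. c * \<nu> S = c * a S - c * b S"
      using ab True by (auto intro: pos_measure_scale simp: right_diff_distrib)
    then have "jordan_measure N (\<lambda>S. c * \<nu> S)"
      unfolding jordan_measure_def by blast
    then show ?thesis
      using signed_integral_diff_measures[OF *, of f] signed_integral_diff_measures[OF ab, of f]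
        integral_as_measure_scale[OF ab(1) True, of f] integral_as_measure_scale[OF ab(2) True, of f]
      by (auto simp: right_diff_distrib)
  next
    case False
    then have c: "0 \<le> - c" by simp
    \<comment> \<open>A negative factor interchanges the roles of the two positive measures.\<close>
    have *: "pos_measure N (\<lambda>S. - c * b S)" "pos_measure N (\<lambda>S. - c * a S)"
      "\<forall>S\<in>sets N. c * \<nu> S = - c * b S - - c * a S"
      using ab c pos_measure_scale[OF _ c] by (auto simp: right_diff_distrib)
    then have "jordan_measure N (\<lambda>S. c * \<nu> S)"
      unfolding jordan_measure_def by blast
    then show ?thesis
      using signed_integral_diff_measures[OF *, of f] signed_integral_diff_measures[OF ab, of f]
        integral_as_measure_scale[OF ab(1) c, of f] integral_as_measure_scale[OF ab(2) c, of f]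
      by (auto simp: right_diff_distrib)
  qed
  then show "jordan_measure N (\<lambda>S. c * \<nu> S)" and "bounded_measurable N f \<Longrightarrow>
      signed_integral N (\<lambda>S. c * \<nu> S) f = c * signed_integral N \<nu> f"
    by blast+
qed

lemma jordan_measure_zero: "jordan_measure N (\<lambda>S. 0)"
  by (intro jordan_measure_pos pos_measure_zero)

lemma signed_integral_zero_measure: "signed_integral N (\<lambda>S. 0) f = 0"
  by (simp add: signed_integral_def)

lemma
  assumes "finite I" "\<And>i. i \<in> I \<Longrightarrow> jordan_measure N (\<nu> i)"
  shows jordan_measure_sum: "jordan_measure N (\<lambda>S. \<Sum>i\<in>I. \<nu> i S)"
    and signed_integral_sum_measure: "bounded_measurable N f \<Longrightarrow>
      signed_integral N (\<lambda>S. \<Sum>i\<in>I. \<nu> i S) f = (\<Sum>i\<in>I. signed_integral N (\<nu> i) f)"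
proof -
  have "jordan_measure N (\<lambda>S. \<Sum>i\<in>I. \<nu> i S) \<and> (bounded_measurable N f \<longrightarrow>
      signed_integral N (\<lambda>S. \<Sum>i\<in>I. \<nu> i S) f = (\<Sum>i\<in>I. signed_integral N (\<nu> i) f))" for f
    using assms
  proof (induction I rule: finite_induct)
    case empty
    then show ?case by (simp add: jordan_measure_zero signed_integral_zero_measure)
  next
    case (insert i I)
    then show ?case by (auto simp: jordan_measure_add signed_integral_add_measure)
  qed
  then show "jordan_measure N (\<lambda>S. \<Sum>i\<in>I. \<nu> i S)" and "bounded_measurable N f \<Longrightarrow>
      signed_integral N (\<lambda>S. \<Sum>i\<in>I. \<nu> i S) f = (\<Sum>i\<in>I. signed_integral N (\<nu> i) f)"
    by blast+
qed

lemma bounded_measurable_const: "bounded_measurable N (\<lambda>x. c)"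
  by (auto simp: bounded_measurable_def)

lemma bounded_measurable_add:
  assumes "bounded_measurable N f" "bounded_measurable N g"
  shows "bounded_measurable N (\<lambda>x. f x + g x)"
proof -
  obtain A B where "\<forall>x\<in>space N. \<bar>f x\<bar> \<le> A" "\<forall>x\<in>space N. \<bar>g x\<bar> \<le> B"
    using assms by (auto simp: bounded_measurable_def)
  then have "\<forall>x\<in>space N. \<bar>f x + g x\<bar> \<le> A + B"
    by (meson abs_triangle_ineq add_mono order_trans)
  then show ?thesis using assms by (auto simp: bounded_measurable_def)
qed

lemma bounded_measurable_mult:
  assumes "bounded_measurable N f" "bounded_measurable N g"
  shows "bounded_measurable N (\<lambda>x. f x * g x)"
proof -
  obtain A B where "\<forall>x\<in>space N. \<bar>f x\<bar> \<le> A" "\<forall>x\<in>space N. \<bar>g x\<bar> \<le> B"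
    using assms by (auto simp: bounded_measurable_def)
  then have "\<forall>x\<in>space N. \<bar>f x * g x\<bar> \<le> A * B"
    by (auto simp: abs_mult intro!: mult_mono order_trans[OF abs_ge_zero])
  then show ?thesis using assms by (auto simp: bounded_measurable_def)
qed

lemma bounded_measurable_sum:
  assumes "finite I" "\<And>i. i \<in> I \<Longrightarrow> bounded_measurable N (f i)"
  shows "bounded_measurable N (\<lambda>x. \<Sum>i\<in>I. f i x)"
  using assms
proof (induction I rule: finite_induct)
  case (insert i I)
  then show ?case
    using bounded_measurable_add[of N "f i" "\<lambda>x. \<Sum>i\<in>I. f i x"] by simp
qed (simp add: bounded_measurable_const)

lemma bounded_measurable_continuous:
  fixes f :: "'a::topological_space \<Rightarrow> real"
  assumes K: "compact K" and f: "continuous_on K f"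
  shows "bounded_measurable (restrict_space borel K) f"
proof -
  obtain B where "\<forall>x\<in>K. norm (f x) \<le> B"
    using compact_imp_bounded[OF compact_continuous_image[OF f K]] by (auto simp: bounded_iff)
  then show ?thesis
    using borel_measurable_continuous_on_restrict[OF f]
    by (auto simp: bounded_measurable_def space_restrict_space)
qed

lemma signed_integral_add:
  assumes "jordan_measure N \<nu>" and f: "bounded_measurable N f" and g: "bounded_measurable N g"
  shows "signed_integral N \<nu> (\<lambda>x. f x + g x) = signed_integral N \<nu> f + signed_integral N \<nu> g"
proof -
  obtain a b where ab: "pos_measure N a" "pos_measure N b" "\<forall>S\<in>sets N. \<nu> S = a S - b S"
    using assms(1) unfolding jordan_measure_def by auto
  note eq = signed_integral_diff_measures[OF ab]
    and int = integrable_as_measure[OF ab(1)] integrable_as_measure[OF ab(2)]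
  show ?thesis
    using int[OF f] int[OF g]
    by (simp add: eq[OF f] eq[OF g] eq[OF bounded_measurable_add[OF f g]])
qed

lemma signed_integral_scale:
  assumes "jordan_measure N \<nu>" and f: "bounded_measurable N f"
  shows "signed_integral N \<nu> (\<lambda>x. c * f x) = c * signed_integral N \<nu> f"
proof -
  obtain a b where ab: "pos_measure N a" "pos_measure N b" "\<forall>S\<in>sets N. \<nu> S = a S - b S"
    using assms(1) unfolding jordan_measure_def by auto
  note eq = signed_integral_diff_measures[OF ab]
  show ?thesis
    unfolding eq[OF f] eq[OF bounded_measurable_mult[OF bounded_measurable_const[of N c] f]]
      integral_mult_right_zero right_diff_distrib ..
qed

lemma signed_integral_sum:
  assumes "finite I" "\<And>i. i \<in> I \<Longrightarrow> bounded_measurable N (f i)" "jordan_measure N \<nu>"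
  shows "signed_integral N \<nu> (\<lambda>x. \<Sum>i\<in>I. f i x) = (\<Sum>i\<in>I. signed_integral N \<nu> (f i))"
  using assms
proof (induction I rule: finite_induct)
  case empty
  show ?case by (simp add: signed_integral_def)
next
  case (insert i I)
  have "signed_integral N \<nu> (\<lambda>x. f i x + (\<Sum>i\<in>I. f i x)) =
      signed_integral N \<nu> (f i) + signed_integral N \<nu> (\<lambda>x. \<Sum>i\<in>I. f i x)"
    using insert by (intro signed_integral_add bounded_measurable_sum) auto
  with insert show ?case by simp
qed

text \<open>The decomposition \<open>\<nu> - 0\<close> is admissible, so the value is an ordinary
  integral of a nonnegative function.\<close>

lemma signed_integral_nonneg:
  assumes \<nu>: "jordan_measure N \<nu>" "\<And>S. S \<in> sets N \<Longrightarrow> 0 \<le> \<nu> S"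
    and f: "bounded_measurable N f" "\<And>x. x \<in> space N \<Longrightarrow> 0 \<le> f x"
  shows "0 \<le> signed_integral N \<nu> f"
proof -
  have "pos_measure N \<nu>"
    using \<nu> jordan_measure_signed by (auto simp: pos_measure_def)
  then have "signed_integral N \<nu> f =
      integral\<^sup>L (as_measure N \<nu>) f - integral\<^sup>L (as_measure N (\<lambda>S. 0)) f"
    by (intro signed_integral_diff_measures pos_measure_zero f) auto
  also have "as_measure N (\<lambda>S. 0) = null_measure N"
    by (simp add: as_measure_def null_measure_def)
  finally have "signed_integral N \<nu> f = integral\<^sup>L (as_measure N \<nu>) f" by simp
  then show ?thesis using f(2) by (auto simp: space_as_measure intro!: integral_nonneg_AE)
qed

text \<open>Any decomposition gives a constant, the sum of its two total masses. As it is uniform in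
  \<open>f\<close>, uniform approximation passes through signed integrals.\<close>

lemma signed_integral_bound:
  assumes \<nu>: "jordan_measure N \<nu>"
  obtains C where "0 \<le> C" "\<And>f e. bounded_measurable N f \<Longrightarrow> (\<And>x. x \<in> space N \<Longrightarrow> \<bar>f x\<bar> \<le> e) \<Longrightarrow>
    0 \<le> e \<Longrightarrow> \<bar>signed_integral N \<nu> f\<bar> \<le> C * e"
proof -
  obtain a b where ab: "pos_measure N a" "pos_measure N b" "\<forall>S\<in>sets N. \<nu> S = a S - b S"
    using \<nu> unfolding jordan_measure_def by auto
  have bound: "\<bar>integral\<^sup>L (as_measure N \<mu>) f\<bar> \<le> \<mu> (space N) * e"
    if "pos_measure N \<mu>" "bounded_measurable N f" "\<And>x. x \<in> space N \<Longrightarrow> \<bar>f x\<bar> \<le> e" for \<mu> f e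
  proof -
    interpret finite_measure "as_measure N \<mu>" by (rule finite_measure_as_measure) fact
    have "\<bar>integral\<^sup>L (as_measure N \<mu>) f\<bar> \<le> integral\<^sup>L (as_measure N \<mu>) (\<lambda>x. \<bar>f x\<bar>)"
      by (rule integral_abs_bound)
    also have "\<dots> \<le> integral\<^sup>L (as_measure N \<mu>) (\<lambda>x. e)"
      using that by (intro integral_mono integrable_abs integrable_as_measure)
        (auto simp: space_as_measure bounded_measurable_const)
    finally show ?thesis
      by (simp add: measure_as_measure[OF that(1)] space_as_measure)
  qed
  show ?thesis
  proof (rule that[of "a (space N) + b (space N)"])
    show "0 \<le> a (space N) + b (space N)" using ab by (simp add: pos_measure_def)
    fix f e assume f: "bounded_measurable N f" "\<And>x. x \<in> space N \<Longrightarrow> \<bar>f x\<bar> \<le> e" and "0 \<le> (e::real)"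
    show "\<bar>signed_integral N \<nu> f\<bar> \<le> (a (space N) + b (space N)) * e"
      unfolding signed_integral_diff_measures[OF ab f(1)]
      using bound[OF ab(1) f] bound[OF ab(2) f] by (simp add: distrib_right)
  qed
qed

section \<open>Representing functionals on a dense space of functions\<close>

lemma eq_zero_if_le_mult_epsilon:
  fixes x c :: real
  assumes "\<And>e. 0 < e \<Longrightarrow> \<bar>x\<bar> \<le> c * e"
  shows "x = 0"
proof (rule ccontr)
  assume x: "x \<noteq> 0"
  \<comment> \<open>\<open>c\<close> may be zero or negative; \<open>\<bar>c\<bar> + 1\<close> is
    positive, dominates it and brings the bound down to half of
    \<open>\<bar>x\<bar>\<close>.\<close>
  define e where "e = \<bar>x\<bar> / (2 * (\<bar>c\<bar> + 1))"
  have "0 < e" using x by (simp add: e_def add_nonneg_pos)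
  have "\<bar>x\<bar> \<le> c * e" by (rule assms) fact
  also have "\<dots> \<le> (\<bar>c\<bar> + 1) * e" using \<open>0 < e\<close> by (intro mult_right_mono) auto
  also have "\<dots> = \<bar>x\<bar> / 2" by (simp add: e_def add_pos_nonneg field_simps)
  finally show False using x by simp
qed

text \<open>Elements of \<open>'p\<close> stand for formal polynomials and \<open>e\<close> for
  evaluation. Beyond density only the vector space structure and a unit enter, so multiplication of
  polynomials stays confined to the proof of density.\<close>

locale dense_functions =
  fixes K :: "'a::metric_space set" and e :: "'p::real_vector \<Rightarrow> 'a \<Rightarrow> real" and u :: 'p
  assumes compact_K: "compact K"
    and e_add: "e (p + q) x = e p x + e q x"
    and e_scale: "e (c *\<^sub>R p) x = c * e p x"
    and e_unit: "e u x = 1"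
    and e_cont: "continuous_on K (e p)"
    and e_dense: "continuous_on K f \<Longrightarrow> 0 < \<epsilon> \<Longrightarrow> \<exists>p. \<forall>x\<in>K. \<bar>f x - e p x\<bar> < \<epsilon>"
begin

abbreviation N :: "'a measure" where "N \<equiv> restrict_space borel K"

lemma e_diff: "e (p - q) x = e p x - e q x"
  using e_add[of p "- q" x] e_scale[of "-1" q x] by simp

lemma space_N: "space N = K"
  by (simp add: space_restrict_space)

lemma integrable_continuous:
  assumes "finite_measure M" "sets M = sets N" "continuous_on K f"
  shows "integrable M (f :: 'a \<Rightarrow> real)"
proof -
  obtain B where B: "\<forall>x\<in>space N. \<bar>f x\<bar> \<le> B" and f: "f \<in> borel_measurable N"
    using bounded_measurable_continuous[OF compact_K assms(3)] by (auto simp: bounded_measurable_def)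
  moreover have "space M = space N" using assms(2) by (rule sets_eq_imp_space_eq)
  moreover have "f \<in> borel_measurable M" using f measurable_cong_sets[OF assms(2) refl] by blast
  ultimately show ?thesis
    by (intro finite_measure.integrable_const_bound[OF assms(1), of _ B]) auto
qed

text \<open>Positivity together with the unit makes \<open>l\<close> Lipschitz for the sup norm on
  \<open>K\<close>, with constant \<open>l u\<close>; hence it extends uniquely from a dense
  subspace to the continuous functions.\<close>

lemma positive_extension:
  fixes l :: "'p \<Rightarrow> real"
  assumes l: "linear l" and pos: "\<And>p. (\<And>x. x \<in> K \<Longrightarrow> 0 \<le> e p x) \<Longrightarrow> 0 \<le> l p"
  obtains L where "positive_functional K L" "\<And>p. L (e p) = l p"
proof -
  interpret linear l by fact
  \<comment> \<open>Each approximant \<open>p\<close> with error at most \<open>\<epsilon>\<close>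
    forces the value at \<open>f\<close> to be at most \<open>l p + \<epsilon> * l u\<close>. The
    infimum of these bounds defines the extension without choosing a sequence; \<open>cmp\<close>
    says that the corresponding lower bounds never exceed them.\<close>
  define D where "D f = {l p + \<epsilon> * l u | p \<epsilon>. \<forall>x\<in>K. \<bar>f x - e p x\<bar> \<le> \<epsilon>}" for f
  define L where "L f = Inf (D f)" for f
  have cmp: "l q - \<delta> * l u \<le> l p + \<epsilon> * l u"
    if "\<forall>x\<in>K. \<bar>f x - e p x\<bar> \<le> \<epsilon>" "\<forall>x\<in>K. \<bar>f x - e q x\<bar> \<le> \<delta>" for f p q \<epsilon> \<delta>
  proof -
    have "0 \<le> e (p - q + (\<epsilon> + \<delta>) *\<^sub>R u) x" if "x \<in> K" for x
      using \<open>\<forall>x\<in>K. \<bar>f x - e p x\<bar> \<le> \<epsilon>\<close>[rule_format, OF that]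
        \<open>\<forall>x\<in>K. \<bar>f x - e q x\<bar> \<le> \<delta>\<close>[rule_format, OF that]
      unfolding e_add e_diff e_scale e_unit mult_1_right abs_le_iff by linarith
    from pos[OF this] show ?thesis
      by (simp add: add diff scale algebra_simps)
  qed
  have key: "\<bar>L f - l p\<bar> \<le> \<epsilon> * l u" if p: "\<forall>x\<in>K. \<bar>f x - e p x\<bar> \<le> \<epsilon>" for f p \<epsilon>
  proof -
    have "l p - \<epsilon> * l u \<le> L f"
      unfolding L_def by (rule cInf_greatest) (use p cmp in \<open>auto simp: D_def\<close>)
    moreover have "L f \<le> l p + \<epsilon> * l u"
      unfolding L_def
    proof (rule cInf_lower)
      show "l p + \<epsilon> * l u \<in> D f" using p by (auto simp: D_def)
      show "bdd_below (D f)"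
        using p cmp by (intro bdd_belowI[of _ "l p - \<epsilon> * l u"]) (auto simp: D_def)
    qed
    ultimately show ?thesis by linarith
  qed
  have "0 \<le> l u" by (rule pos) (simp add: e_unit)
  have approx: "\<exists>p. (\<forall>x\<in>K. \<bar>f x - e p x\<bar> \<le> \<epsilon>) \<and> \<bar>L f - l p\<bar> \<le> \<epsilon> * l u"
    if "continuous_on K f" "0 < \<epsilon>" for f \<epsilon>
    using e_dense[OF that] key by (meson less_imp_le)
  show ?thesis
  proof (rule that)
    \<comment> \<open>An approximant with error \<open>0\<close> pins the value exactly.\<close>
    show "L (e p) = l p" for p using key[of "e p" p 0] by simp
    show "positive_functional K L"
    proof
      show "compact K" by (rule compact_K)
    next
      fix f g :: "'a \<Rightarrow> real" assume f: "continuous_on K f" and g: "continuous_on K g"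
      have "L (\<lambda>x. f x + g x) - (L f + L g) = 0"
      proof (rule eq_zero_if_le_mult_epsilon[where c = "4 * l u"])
        fix \<epsilon> :: real assume "0 < \<epsilon>"
        obtain p where p: "\<forall>x\<in>K. \<bar>f x - e p x\<bar> \<le> \<epsilon>" "\<bar>L f - l p\<bar> \<le> \<epsilon> * l u"
          using approx[OF f \<open>0 < \<epsilon>\<close>] by auto
        obtain q where q: "\<forall>x\<in>K. \<bar>g x - e q x\<bar> \<le> \<epsilon>" "\<bar>L g - l q\<bar> \<le> \<epsilon> * l u"
          using approx[OF g \<open>0 < \<epsilon>\<close>] by auto
        have "\<forall>x\<in>K. \<bar>(f x + g x) - e (p + q) x\<bar> \<le> 2 * \<epsilon>"
        proof
          fix x assume "x \<in> K"
          then show "\<bar>(f x + g x) - e (p + q) x\<bar> \<le> 2 * \<epsilon>"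
            using p(1)[rule_format, of x] q(1)[rule_format, of x] unfolding e_add by linarith
        qed
        from key[OF this] have "\<bar>L (\<lambda>x. f x + g x) - (l p + l q)\<bar> \<le> 2 * (\<epsilon> * l u)"
          by (simp add: add)
        with p(2) q(2) have "\<bar>L (\<lambda>x. f x + g x) - (L f + L g)\<bar> \<le> 4 * (\<epsilon> * l u)" by linarith
        then show "\<bar>L (\<lambda>x. f x + g x) - (L f + L g)\<bar> \<le> 4 * l u * \<epsilon>" by (simp add: mult_ac)
      qed
      then show "L (\<lambda>x. f x + g x) = L f + L g" by simp
    next
      fix f :: "'a \<Rightarrow> real" and c assume f: "continuous_on K f"
      have "L (\<lambda>x. c * f x) - c * L f = 0"
      proof (rule eq_zero_if_le_mult_epsilon[where c = "2 * \<bar>c\<bar> * l u"])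
        fix \<epsilon> :: real assume "0 < \<epsilon>"
        obtain p where p: "\<forall>x\<in>K. \<bar>f x - e p x\<bar> \<le> \<epsilon>" "\<bar>L f - l p\<bar> \<le> \<epsilon> * l u"
          using approx[OF f \<open>0 < \<epsilon>\<close>] by auto
        have "\<forall>x\<in>K. \<bar>c * f x - e (c *\<^sub>R p) x\<bar> \<le> \<bar>c\<bar> * \<epsilon>"
          using p(1) by (simp add: e_scale abs_mult mult_left_mono flip: right_diff_distrib)
        from key[OF this] have "\<bar>L (\<lambda>x. c * f x) - c * l p\<bar> \<le> \<bar>c\<bar> * (\<epsilon> * l u)"
          by (simp add: scale mult_ac)
        moreover have "\<bar>c * L f - c * l p\<bar> \<le> \<bar>c\<bar> * (\<epsilon> * l u)"
          using p(2) by (simp add: abs_mult mult_left_mono flip: right_diff_distrib)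
        ultimately have "\<bar>L (\<lambda>x. c * f x) - c * L f\<bar> \<le> 2 * (\<bar>c\<bar> * (\<epsilon> * l u))" by linarith
        then show "\<bar>L (\<lambda>x. c * f x) - c * L f\<bar> \<le> 2 * \<bar>c\<bar> * l u * \<epsilon>" by (simp add: mult_ac)
      qed
      then show "L (\<lambda>x. c * f x) = c * L f" by simp
    next
      fix f :: "'a \<Rightarrow> real" assume f: "continuous_on K f" and nn: "\<And>x. x \<in> K \<Longrightarrow> 0 \<le> f x"
      show "0 \<le> L f"
      proof (rule field_le_epsilon)
        fix d :: real assume "0 < d"
        \<comment> \<open>One \<open>\<epsilon> * l u\<close> is lost between \<open>L f\<close> and
          \<open>l p\<close>, another because \<open>e p\<close> is only at least
          \<open>- \<epsilon>\<close> on \<open>K\<close>.\<close>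
        define \<epsilon> where "\<epsilon> = d / (2 * l u + 1)"
        have \<epsilon>: "0 < \<epsilon>" "2 * (\<epsilon> * l u) \<le> d"
          using \<open>0 < d\<close> \<open>0 \<le> l u\<close> by (auto simp: \<epsilon>_def field_simps add_nonneg_pos)
        obtain p where p: "\<forall>x\<in>K. \<bar>f x - e p x\<bar> \<le> \<epsilon>" "\<bar>L f - l p\<bar> \<le> \<epsilon> * l u"
          using approx[OF f \<epsilon>(1)] by auto
        have "0 \<le> e (p + \<epsilon> *\<^sub>R u) x" if "x \<in> K" for x
          using p(1)[rule_format, OF that] nn[OF that] unfolding e_add e_scale e_unit by linarith
        then have "0 \<le> l p + \<epsilon> * l u"
          using pos by (metis add scale real_scaleR_def)
        with p(2) \<epsilon>(2) show "0 \<le> L f + d" by linarith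
      qed
    qed
  qed
qed

section \<open>Uniqueness and linearity of representing measures\<close>

text \<open>Traces of open sets on \<open>K\<close> form an intersection-stable generator, and their
  indicators are dominated pointwise limits of the continuous functions
  \<open>min 1 (k * infdist x (- U))\<close>.\<close>

lemma measure_eqI_continuous:
  assumes M: "finite_measure M" "sets M = sets N" and M': "finite_measure M'" "sets M' = sets N"
    and eq: "\<And>f. continuous_on K f \<Longrightarrow> integral\<^sup>L M f = (integral\<^sup>L M' f :: real)"
  shows "M = M'"
proof -
  let ?E = "{(\<lambda>x. x) -` U \<inter> K | U. U \<in> {U. open U}}"
  have sets: "sets N = sigma_sets K ?E"
  proof -
    have "sets N = sets (vimage_algebra K (\<lambda>x. x) (sigma UNIV {U. open U}))"
      using restrict_space_eq_vimage_algebra[of K borel] by (simp add: borel_def)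
    also have "\<dots> = sets (sigma K ?E)"
      by (subst vimage_algebra_sigma) auto
    finally show ?thesis by (subst (asm) sets_measure_of) auto
  qed
  have space: "space M = K" "space M' = K"
    using sets_eq_imp_space_eq[OF M(2)] sets_eq_imp_space_eq[OF M'(2)] by (auto simp: space_N)
  have lim: "(\<lambda>k. integral\<^sup>L M (\<lambda>x. min 1 (real k * infdist x (- U)))) \<longlonglongrightarrow> measure M (U \<inter> K)"
    if M: "finite_measure M" "sets M = sets N" and U: "open U" "U \<noteq> UNIV" for M U
  proof -
    interpret finite_measure M by fact
    have sp: "space M = K" using sets_eq_imp_space_eq[OF M(2)] by (simp add: space_N)
    have "(\<lambda>k. integral\<^sup>L M (\<lambda>x. min 1 (real k * infdist x (- U)))) \<longlonglongrightarrow> integral\<^sup>L M (indicator (U \<inter> K))"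
    proof (rule integral_dominated_convergence[where w = "\<lambda>x. 1"])
      have "U \<inter> K \<in> sets M"
        using U(1) M(2) by (auto simp: sets_restrict_space)
      then show "indicator (U \<inter> K) \<in> borel_measurable M" by simp
      show "(\<lambda>x. min 1 (real k * infdist x (- U))) \<in> borel_measurable M" for k
        by (intro borel_measurable_integrable integrable_continuous M continuous_intros)
      have "(\<lambda>k. min 1 (real k * infdist x (- U))) \<longlonglongrightarrow> indicator (U \<inter> K) x" if "x \<in> K" for x
      proof (cases "x \<in> U")
        case True
        then have "0 < infdist x (- U)"
          using U in_closed_iff_infdist_zero[of "- U" x] infdist_nonneg[of x "- U"]
          by (auto simp: closed_Compl less_le)
        then obtain k0 where k0: "1 / infdist x (- U) < real k0" using reals_Archimedean2 by blast
        have "min 1 (real k * infdist x (- U)) = 1" if "k0 \<le> k" for k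
        proof -
          have "1 / infdist x (- U) \<le> real k" using k0 that by linarith
          then show ?thesis using \<open>0 < infdist x (- U)\<close> by (simp add: field_simps)
        qed
        then show ?thesis
          using True \<open>x \<in> K\<close> by (intro tendsto_eventually) (auto simp: eventually_sequentially)
      next
        case False
        then show ?thesis by (simp add: infdist_zero)
      qed
      then show "AE x in M. (\<lambda>k. min 1 (real k * infdist x (- U))) \<longlonglongrightarrow> indicator (U \<inter> K) x"
        by (intro AE_I2) (simp add: sp)
      show "AE x in M. norm (min 1 (real k * infdist x (- U))) \<le> 1" for k
        by (intro AE_I2) (simp add: infdist_nonneg)
    qed simp
    moreover have "U \<inter> K \<subseteq> space M" using sp by auto
    ultimately show ?thesis by (simp add: Int_absorb1 Int_absorb2)
  qed
  have meas: "measure M (U \<inter> K) = measure M' (U \<inter> K)" if U: "open U" for U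
  proof (cases "U = UNIV")
    case True
    then show ?thesis using eq[of "\<lambda>x. 1"] by (simp add: space)
  next
    case False
    have "integral\<^sup>L M (\<lambda>x. min 1 (real k * infdist x (- U))) =
        integral\<^sup>L M' (\<lambda>x. min 1 (real k * infdist x (- U)))" for k
      by (intro eq continuous_intros)
    with lim[OF M U False] lim[OF M' U False] show ?thesis
      by (auto intro: LIMSEQ_unique)
  qed
  show ?thesis
  proof (rule measure_eqI_generator_eq[where E = ?E and \<Omega> = K and A = "\<lambda>i. K"])
    have "(\<lambda>x. x) -` U \<inter> K \<inter> ((\<lambda>x. x) -` V \<inter> K) = (\<lambda>x. x) -` (U \<inter> V) \<inter> K" for U V :: "'a set"
      by auto
    then show "Int_stable ?E"
      unfolding Int_stable_def by (smt (verit, ccfv_threshold) mem_Collect_eq open_Int)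
    show "emeasure M X = emeasure M' X" if "X \<in> ?E" for X
      using that meas M M' by (auto simp: finite_measure.emeasure_eq_measure)
    show "emeasure M K \<noteq> \<infinity>" using M(1) by (simp add: finite_measure.emeasure_eq_measure)
    show "range (\<lambda>i. K) \<subseteq> ?E" by (auto intro: exI[of _ UNIV])
  qed (use sets M M' in auto)
qed

lemma measure_eqI_dense:
  assumes M: "finite_measure M" "sets M = sets N" and M': "finite_measure M'" "sets M' = sets N"
    and eq: "\<And>p. integral\<^sup>L M (e p) = integral\<^sup>L M' (e p)"
  shows "M = M'"
proof (rule measure_eqI_continuous[OF M M'])
  fix f :: "'a \<Rightarrow> real" assume f: "continuous_on K f"
  have bound: "\<bar>integral\<^sup>L M f - integral\<^sup>L M (e p)\<bar> \<le> measure M K * \<epsilon>"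
    if M: "finite_measure M" "sets M = sets N" and p: "\<forall>x\<in>K. \<bar>f x - e p x\<bar> < \<epsilon>" for M p \<epsilon>
  proof -
    interpret finite_measure M by fact
    have sp: "space M = K" using sets_eq_imp_space_eq[OF M(2)] by (simp add: space_N)
    have int: "integrable M f" "integrable M (e p)"
      by (intro integrable_continuous M f e_cont)+
    have "\<bar>integral\<^sup>L M f - integral\<^sup>L M (e p)\<bar> = \<bar>integral\<^sup>L M (\<lambda>x. f x - e p x)\<bar>"
      using int by simp
    also have "\<dots> \<le> integral\<^sup>L M (\<lambda>x. \<bar>f x - e p x\<bar>)"
      by (rule integral_abs_bound)
    also have "\<dots> \<le> integral\<^sup>L M (\<lambda>x. \<epsilon>)"
      using int p by (intro integral_mono integrable_abs) (auto simp: sp intro: less_imp_le)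
    finally show ?thesis by (simp add: sp)
  qed
  have "integral\<^sup>L M f - integral\<^sup>L M' f = 0"
  proof (rule eq_zero_if_le_mult_epsilon[where c = "measure M K + measure M' K"])
    fix \<epsilon> :: real assume "0 < \<epsilon>"
    obtain p where p: "\<forall>x\<in>K. \<bar>f x - e p x\<bar> < \<epsilon>" using e_dense[OF f \<open>0 < \<epsilon>\<close>] by auto
    show "\<bar>integral\<^sup>L M f - integral\<^sup>L M' f\<bar> \<le> (measure M K + measure M' K) * \<epsilon>"
      using bound[OF M p] bound[OF M' p] eq[of p] by (simp add: distrib_right)
  qed
  then show "integral\<^sup>L M f = integral\<^sup>L M' f" by simp
qed

definition represents :: "('p \<Rightarrow> real) \<Rightarrow> ('a set \<Rightarrow> real) \<Rightarrow> bool" where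
  "represents l \<nu> \<longleftrightarrow> jordan_measure N \<nu> \<and> (\<forall>p. l p = signed_integral N \<nu> (e p))"

text \<open>Two decompositions are compared crosswise, \<open>a + b'\<close> against
  \<open>a' + b\<close>, which turns equality of signed integrals into equality of integrals against
  genuine measures.\<close>

lemma represents_unique:
  assumes "represents l \<nu>" "represents l \<nu>'" "S \<in> sets N"
  shows "\<nu> S = \<nu>' S"
proof -
  obtain a b where ab: "pos_measure N a" "pos_measure N b" "\<forall>S\<in>sets N. \<nu> S = a S - b S"
    using assms(1) unfolding represents_def jordan_measure_def by auto
  obtain a' b' where ab': "pos_measure N a'" "pos_measure N b'" "\<forall>S\<in>sets N. \<nu>' S = a' S - b' S"
    using assms(2) unfolding represents_def jordan_measure_def by auto
  have bm: "bounded_measurable N (e p)" for p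
    by (intro bounded_measurable_continuous compact_K e_cont)
  have pos: "pos_measure N (\<lambda>S. a S + b' S)" "pos_measure N (\<lambda>S. a' S + b S)"
    using ab ab' by (auto intro: pos_measure_add)
  have "as_measure N (\<lambda>S. a S + b' S) = as_measure N (\<lambda>S. a' S + b S)"
  proof (rule measure_eqI_dense)
    fix p
    have "signed_integral N \<nu> (e p) = signed_integral N \<nu>' (e p)"
      using assms(1,2) unfolding represents_def by metis
    then show "integral\<^sup>L (as_measure N (\<lambda>S. a S + b' S)) (e p) =
        integral\<^sup>L (as_measure N (\<lambda>S. a' S + b S)) (e p)"
      unfolding signed_integral_diff_measures[OF ab bm] signed_integral_diff_measures[OF ab' bm]
        integral_as_measure_add[OF ab(1) ab'(2) bm] integral_as_measure_add[OF ab'(1) ab(2) bm]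
      by linarith
  qed (intro finite_measure_as_measure pos sets_as_measure)+
  then have "a S + b' S = a' S + b S"
    using measure_as_measure[OF pos(1) assms(3)] measure_as_measure[OF pos(2) assms(3)] by simp
  with ab(3) ab'(3) assms(3) show ?thesis by auto
qed

lemma represents_positive:
  assumes "linear l" "\<And>p. (\<And>x. x \<in> K \<Longrightarrow> 0 \<le> e p x) \<Longrightarrow> 0 \<le> l p"
  obtains \<nu> where "represents l \<nu>" "\<And>S. S \<in> sets N \<Longrightarrow> 0 \<le> \<nu> S"
proof -
  obtain L where L: "positive_functional K L" "\<And>p. L (e p) = l p"
    using positive_extension[OF assms] by blast
  interpret L: positive_functional K L by fact
  have "represents l (measure L.riesz_measure)"
    unfolding represents_def
  proof (intro conjI allI)
    show "jordan_measure N (measure L.riesz_measure)"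
      by (intro jordan_measure_pos pos_measure_measure L.finite_measure_riesz L.sets_riesz)
    fix p
    have "signed_integral N (measure L.riesz_measure) (e p) = integral\<^sup>L L.riesz_measure (e p)"
      by (intro signed_integral_finite_measure L.finite_measure_riesz L.sets_riesz)
    then show "l p = signed_integral N (measure L.riesz_measure) (e p)"
      by (simp add: L.integral_riesz e_cont L(2))
  qed
  then show ?thesis by (rule that) simp
qed

lemma represents_add:
  "represents l \<nu> \<Longrightarrow> represents l' \<nu>' \<Longrightarrow> represents (\<lambda>p. l p + l' p) (\<lambda>S. \<nu> S + \<nu>' S)"
  by (simp add: represents_def jordan_measure_add signed_integral_add_measure
      bounded_measurable_continuous compact_K e_cont)

lemma represents_scale:
  "represents l \<nu> \<Longrightarrow> represents (\<lambda>p. c * l p) (\<lambda>S. c * \<nu> S)"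
  by (simp add: represents_def jordan_measure_scale signed_integral_scale_measure
      bounded_measurable_continuous compact_K e_cont)

lemma represents_cong:
  "represents l \<nu> \<Longrightarrow> (\<And>S. S \<in> sets N \<Longrightarrow> \<nu>' S = \<nu> S) \<Longrightarrow> represents l \<nu>'"
  unfolding represents_def using jordan_measure_cong[of N \<nu> \<nu>'] signed_integral_cong[of N \<nu>' \<nu>] by simp

lemma represents_zero: "represents (\<lambda>p. 0) (\<lambda>S. 0)"
  by (simp add: represents_def jordan_measure_zero signed_integral_zero_measure)

lemma represents_sum:
  "finite I \<Longrightarrow> (\<And>i. i \<in> I \<Longrightarrow> represents (l i) (\<nu> i)) \<Longrightarrow>
    represents (\<lambda>p. \<Sum>i\<in>I. l i p) (\<lambda>S. \<Sum>i\<in>I. \<nu> i S)"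
  by (induction I rule: finite_induct) (simp_all add: represents_zero represents_add)

text \<open>The choice depends on the functional alone. Relations between chosen representatives are
  recovered on measurable sets from relations between functionals, by uniqueness.\<close>

definition representing :: "('p \<Rightarrow> real) \<Rightarrow> 'a set \<Rightarrow> real" where
  "representing l = (SOME \<nu>. represents l \<nu>)"

lemma represents_representing: "represents l \<nu> \<Longrightarrow> represents l (representing l)"
  unfolding representing_def by (rule someI[of "represents l"])

end

section \<open>Hermitian matrices\<close>

lemma herm_eqI:
  "(\<And>i j. herm_mat A $ i $ j = herm_mat B $ i $ j) \<Longrightarrow> A = B"
  by (simp add: vec_eq_iff flip: herm_mat_inject)

lemma cnj_herm_mat: "cnj (herm_mat A $ i $ j) = herm_mat A $ j $ i"
  using herm_mat[of A] by (simp add: hermitian_def)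

lemma herm_mat_sum: "herm_mat (\<Sum>k\<in>I. A k) = (\<Sum>k\<in>I. herm_mat (A k))"
  by (induction I rule: infinite_finite_induct) (simp_all add: zero_herm.rep_eq plus_herm.rep_eq)

definition herm_quad :: "'m::finite herm \<Rightarrow> complex^'m \<Rightarrow> real" where
  "herm_quad A v = Re (\<Sum>i\<in>UNIV. \<Sum>j\<in>UNIV. cnj (v $ i) * herm_mat A $ i $ j * v $ j)"

lemma herm_psd_iff: "herm_psd A \<longleftrightarrow> (\<forall>v. 0 \<le> herm_quad A v)"
  by (simp add: herm_psd.rep_eq herm_quad_def)

text \<open>A quadratic form is a fixed real-linear combination of the real and imaginary parts of the
  entries, and vice versa; this passes between positivity and signed measures entry by entry.\<close>

lemma herm_quad_expand:
  "herm_quad A v = (\<Sum>i\<in>UNIV. \<Sum>j\<in>UNIV. Re (cnj (v $ i) * v $ j) * Re (herm_mat A $ i $ j)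
     + (- Im (cnj (v $ i) * v $ j)) * Im (herm_mat A $ i $ j))"
  by (simp add: herm_quad_def algebra_simps)

lemma linear_herm_quad: "linear (\<lambda>A. herm_quad A v)"
  by (rule linearI) (simp_all add: herm_quad_def plus_herm.rep_eq scaleR_herm.rep_eq
      sum.distrib distrib_left distrib_right flip: scaleR_sum_right)

text \<open>In the sesquilinear expansion the two mixed terms are conjugate to each other. With
  \<open>a = 1\<close>, the choices \<open>b = 1\<close> and \<open>b = - \<i>\<close> isolate the
  real and the imaginary part of an entry.\<close>

lemma herm_quad_polar:
  "herm_quad A (axis i a + axis j b) =
    (cmod a)\<^sup>2 * Re (herm_mat A $ i $ i) + (cmod b)\<^sup>2 * Re (herm_mat A $ j $ j)
      + 2 * Re (cnj a * b * herm_mat A $ i $ j)"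
proof -
  define s where "s v w = (\<Sum>i\<in>UNIV. \<Sum>j\<in>UNIV. cnj (v $ i) * herm_mat A $ i $ j * w $ j)" for v w
  have add: "s (v + v') w = s v w + s v' w" "s v (w + w') = s v w + s v w'" for v v' w w'
    by (simp_all add: s_def algebra_simps sum.distrib)
  have ax: "s (axis k c) (axis l d) = cnj c * herm_mat A $ k $ l * d" for k l c d
  proof -
    have "s (axis k c) (axis l d) = (\<Sum>i\<in>UNIV. \<Sum>j\<in>UNIV.
        (if i = k then cnj c else 0) * herm_mat A $ i $ j * (if j = l then d else 0))"
      unfolding s_def axis_def by (intro sum.cong refl) auto
    then show ?thesis
      by (simp add: mult_delta_left mult_delta_right)
  qed
  have sq: "Re (cnj c * herm_mat A $ k $ k * c) = (cmod c)\<^sup>2 * Re (herm_mat A $ k $ k)" for c k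
  proof -
    have "cnj c * herm_mat A $ k $ k * c = complex_of_real ((cmod c)\<^sup>2) * herm_mat A $ k $ k"
      using complex_norm_square[of c] by (simp add: mult_ac)
    moreover have "Re (complex_of_real r * z) = r * Re z" for r z by simp
    ultimately show ?thesis by metis
  qed
  have "herm_quad A (axis i a + axis j b) = Re (s (axis i a + axis j b) (axis i a + axis j b))"
    by (simp add: herm_quad_def s_def)
  also have "\<dots> = Re (cnj a * herm_mat A $ i $ i * a) + Re (cnj b * herm_mat A $ j $ j * b)
      + (Re (cnj a * herm_mat A $ i $ j * b) + Re (cnj b * herm_mat A $ j $ i * a))"
    by (simp add: add ax)
  also have "Re (cnj b * herm_mat A $ j $ i * a) = Re (cnj (cnj a * herm_mat A $ i $ j * b))"
    by (simp add: cnj_herm_mat mult_ac)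
  also have "cnj a * herm_mat A $ i $ j * b = cnj a * b * herm_mat A $ i $ j"
    by (simp only: mult_ac)
  finally show ?thesis
    by (simp only: sq cnj.sel)
qed

lemma herm_quad_axis: "herm_quad A (axis i 1) = Re (herm_mat A $ i $ i)"
  using herm_quad_polar[of A i 1 i 0] by (simp add: axis_def zero_vec_def[symmetric])

lemma Re_herm_mat_eq:
  "Re (herm_mat A $ i $ j) =
    (herm_quad A (axis i 1 + axis j 1) + (- herm_quad A (axis i 1) - herm_quad A (axis j 1))) / 2"
  by (simp add: herm_quad_polar herm_quad_axis)

lemma Im_herm_mat_eq:
  "Im (herm_mat A $ i $ j) =
    (herm_quad A (axis i 1 + axis j (- \<i>)) + (- herm_quad A (axis i 1) - herm_quad A (axis j 1))) / 2"
  by (simp add: herm_quad_polar herm_quad_axis)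

lemma herm_psd_scaleR: "herm_psd A \<Longrightarrow> 0 \<le> c \<Longrightarrow> herm_psd (c *\<^sub>R A)"
  by (simp add: herm_psd_iff linear_scale[OF linear_herm_quad])

lift_definition herm_one :: "'m::finite herm" is "mat 1"
  by (simp add: hermitian_def mat_def)

lemma herm_quad_one: "herm_quad herm_one v = (norm v)\<^sup>2"
proof -
  have "herm_quad herm_one v = Re (\<Sum>i\<in>UNIV. \<Sum>j\<in>UNIV. if j = i then cnj (v $ i) * v $ j else 0)"
    unfolding herm_quad_def herm_one.rep_eq mat_def
    by (intro arg_cong[of _ _ Re] sum.cong refl) auto
  also have "\<dots> = (\<Sum>i\<in>UNIV. (cmod (v $ i))\<^sup>2)"
    by (simp add: cmod_power2) (simp add: power2_eq_square)
  finally show ?thesis by (simp add: norm_vec_def L2_set_def sum_nonneg)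
qed

text \<open>The sum of the moduli of all entries is a crude bound for the spectral radius; it serves
  to shift \<open>A\<close> into the psd cone.\<close>

lemma abs_herm_quad_le:
  "\<bar>herm_quad A v\<bar> \<le> (\<Sum>i\<in>UNIV. \<Sum>j\<in>UNIV. cmod (herm_mat A $ i $ j)) * (norm v)\<^sup>2"
proof -
  have "\<bar>herm_quad A v\<bar> \<le> cmod (\<Sum>i\<in>UNIV. \<Sum>j\<in>UNIV. cnj (v $ i) * herm_mat A $ i $ j * v $ j)"
    unfolding herm_quad_def by (rule abs_Re_le_cmod)
  also have "\<dots> \<le> (\<Sum>i\<in>UNIV. \<Sum>j\<in>UNIV. cmod (herm_mat A $ i $ j) * (norm v)\<^sup>2)"
  proof (intro order_trans[OF norm_sum] sum_mono)
    fix i j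
    have "cmod (v $ i) * cmod (v $ j) \<le> norm v * norm v"
      by (intro mult_mono Finite_Cartesian_Product.norm_nth_le) auto
    then have "cmod (herm_mat A $ i $ j) * (cmod (v $ i) * cmod (v $ j)) \<le>
        cmod (herm_mat A $ i $ j) * (norm v)\<^sup>2"
      by (intro mult_left_mono) (auto simp: power2_eq_square)
    then show "cmod (cnj (v $ i) * herm_mat A $ i $ j * v $ j) \<le> cmod (herm_mat A $ i $ j) * (norm v)\<^sup>2"
      by (simp add: norm_mult mult_ac)
  qed
  finally show ?thesis by (simp add: sum_distrib_right)
qed

text \<open>A large multiple of the identity is added and subtracted. This carries statements known
  for psd coefficients over to arbitrary ones by linearity.\<close>

lemma herm_diff_psd:
  obtains B C where "herm_psd B" "herm_psd C" "A = B - C"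
proof -
  define c where "c = (\<Sum>i\<in>UNIV. \<Sum>j\<in>UNIV. cmod (herm_mat A $ i $ j))"
  have "0 \<le> c" by (simp add: c_def sum_nonneg)
  show ?thesis
  proof (rule that[of "A + c *\<^sub>R herm_one" "c *\<^sub>R herm_one"])
    show "herm_psd (c *\<^sub>R herm_one)"
      using \<open>0 \<le> c\<close> by (intro herm_psd_scaleR) (simp add: herm_psd_iff herm_quad_one)
    show "herm_psd (A + c *\<^sub>R herm_one)"
      unfolding herm_psd_iff
    proof
      fix v
      have "- (c * (norm v)\<^sup>2) \<le> herm_quad A v"
        using abs_herm_quad_le[of A v] unfolding c_def[symmetric] by linarith
      then show "0 \<le> herm_quad (A + c *\<^sub>R herm_one) v"
        by (simp add: linear_add[OF linear_herm_quad] linear_scale[OF linear_herm_quad] herm_quad_one)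
    qed
  qed simp
qed

section \<open>The orthonormal basis\<close>

lemma trace_matrix_unit: "trace (A ** matrix_unit k l) = A $ l $ k"
proof -
  have "trace (A ** matrix_unit k l) = (\<Sum>i\<in>UNIV. \<Sum>j\<in>UNIV. if j = k \<and> i = l then A $ i $ j else 0)"
    unfolding trace_def matrix_matrix_mult_def matrix_unit_def
    by (auto intro!: sum.cong)
  also have "\<dots> = (\<Sum>i\<in>UNIV. if i = l then (\<Sum>j\<in>UNIV. if j = k then A $ i $ j else 0) else 0)"
    by (intro sum.cong) auto
  finally show ?thesis by simp
qed

lemma herm_mat_basis_less:
  "k < l \<Longrightarrow> herm_mat (herm_basis k l) =
    (\<chi> i j. complex_of_real (1 / sqrt 2) * (matrix_unit k l + matrix_unit l k) $ i $ j)"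
  by (simp add: herm_basis.rep_eq vec_eq_iff) (simp add: scaleR_conv_of_real)

lemma herm_mat_basis_greater:
  "l < k \<Longrightarrow> herm_mat (herm_basis k l) =
    (\<chi> i j. (\<i> / complex_of_real (sqrt 2)) * (matrix_unit k l - matrix_unit l k) $ i $ j)"
  by (auto simp: herm_basis.rep_eq)

lemma herm_mat_basis_eq: "herm_mat (herm_basis k k) = matrix_unit k k"
  by (simp add: herm_basis.rep_eq)

lemma matrix_unit_entry: "matrix_unit k l $ i $ j = (if i = k \<and> j = l then 1 else 0)"
  by (simp add: matrix_unit_def)

lemma herm_basis_entry_0:
  assumes "(k, l) \<noteq> (a, b)" "(k, l) \<noteq> (b, a)"
  shows "herm_mat (herm_basis k l) $ a $ b = 0"
proof -
  have u: "matrix_unit k l $ a $ b = 0" "matrix_unit l k $ a $ b = 0"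
    using assms by (auto simp: matrix_unit_entry)
  show ?thesis
  proof (rule linorder_cases[of k l])
    assume "k < l"
    then show ?thesis by (simp add: herm_mat_basis_less u)
  next
    assume "k = l"
    then show ?thesis using u by (simp add: herm_mat_basis_eq)
  next
    assume "l < k"
    then show ?thesis by (simp add: herm_mat_basis_greater u)
  qed
qed

lemma matrix_diff_ldistrib: "A ** (B - C) = A ** B - A ** C" for A :: "'a::ring_1^'m^'n"
  by (simp add: matrix_matrix_mult_def vec_eq_iff right_diff_distrib sum_subtractf)

lemma trace_matrix_mul_scale:
  "trace (A ** (\<chi> i j. z * X $ i $ j)) = z * trace (A ** X)"
  for A X :: "complex^'m^'m::finite"
  by (simp add: trace_def matrix_matrix_mult_def sum_distrib_left mult.left_commute)

lemma Re_herm_mat_sym: "Re (herm_mat A $ l $ k) = Re (herm_mat A $ k $ l)"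
  and Im_herm_mat_sym: "Im (herm_mat A $ l $ k) = - Im (herm_mat A $ k $ l)"
  by (simp_all flip: cnj_herm_mat[of A k l])

lemma herm_inner_basis_less:
  assumes "k < l" shows "herm_inner A (herm_basis k l) = sqrt 2 * Re (herm_mat A $ k $ l)"
proof -
  have "herm_inner A (herm_basis k l) =
      Re (complex_of_real (1 / sqrt 2) * (herm_mat A $ l $ k + herm_mat A $ k $ l))"
    by (simp only: herm_inner_def herm_mat_basis_less[OF assms] trace_matrix_mul_scale matrix_add_ldistrib trace_add trace_matrix_unit)
  also have "\<dots> = 1 / sqrt 2 * (2 * Re (herm_mat A $ k $ l))"
    using Re_herm_mat_sym[of A l k] by (simp add: Re_divide_of_real)
  also have "\<dots> = (2 / sqrt 2) * Re (herm_mat A $ k $ l)" by simp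
  also have "2 / sqrt 2 = sqrt (2::real)" by (rule real_div_sqrt) simp
  finally show ?thesis .
qed

lemma herm_inner_basis_eq: "herm_inner A (herm_basis k k) = Re (herm_mat A $ k $ k)"
  by (simp add: herm_inner_def herm_mat_basis_eq trace_matrix_unit)

text \<open>By conjugate symmetry the entry difference is \<open>- 2 * \<i>\<close> times the
  imaginary part, and the factor \<open>\<i>\<close> of the basis element makes the product real
  with positive sign.\<close>

lemma herm_inner_basis_greater:
  assumes "l < k" shows "herm_inner A (herm_basis k l) = sqrt 2 * Im (herm_mat A $ k $ l)"
proof -
  have "herm_inner A (herm_basis k l) =
      Re ((\<i> / complex_of_real (sqrt 2)) * (herm_mat A $ l $ k - herm_mat A $ k $ l))"
    by (simp only: herm_inner_def herm_mat_basis_greater[OF assms] trace_matrix_mul_scale matrix_diff_ldistrib trace_sub trace_matrix_unit)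
  also have "\<dots> = 1 / sqrt 2 * (2 * Im (herm_mat A $ k $ l))"
    using Im_herm_mat_sym[of A l k] by (simp add: Re_divide_of_real)
  also have "\<dots> = (2 / sqrt 2) * Im (herm_mat A $ k $ l)" by simp
  also have "2 / sqrt 2 = sqrt (2::real)" by (rule real_div_sqrt) simp
  finally show ?thesis .
qed

lemma linear_herm_inner: "linear (\<lambda>A. herm_inner A B)"
  by (rule linearI)
    (simp_all add: herm_inner_def trace_def matrix_matrix_mult_def plus_herm.rep_eq scaleR_herm.rep_eq
      distrib_right sum.distrib sum_distrib_left)

text \<open>At the entry \<open>(a, b)\<close> only the basis elements indexed by
  \<open>(a, b)\<close> and \<open>(b, a)\<close> are nonzero. Off the diagonal one contributes the
  real part and the other the imaginary part, the order of \<open>a\<close> and \<open>b\<close>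
  deciding which; on the diagonal the two coincide.\<close>

lemma herm_basis_expand:
  "(\<Sum>k\<in>UNIV. \<Sum>l\<in>UNIV. herm_inner A (herm_basis k l) *\<^sub>R herm_basis k l) = A"
proof (rule herm_eqI)
  fix a b
  have real: "(sqrt 2 * r) *\<^sub>R (complex_of_real (1 / sqrt 2) * 1) = complex_of_real r" for r
    by (simp add: complex_eq_iff Re_divide_of_real)
  have imag: "(sqrt 2 * r) *\<^sub>R (\<i> / complex_of_real (sqrt 2) * 1) = \<i> * complex_of_real r"
    "(sqrt 2 * r) *\<^sub>R (\<i> / complex_of_real (sqrt 2) * (- 1)) = \<i> * complex_of_real (- r)" for r
    by (simp_all add: complex_eq_iff Im_divide_of_real)
  note entries = vec_lambda_beta vector_add_component vector_minus_component matrix_unit_entry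
  let ?t = "\<lambda>k l. herm_inner A (herm_basis k l) *\<^sub>R herm_mat (herm_basis k l) $ a $ b"
  have "herm_mat (\<Sum>k\<in>UNIV. \<Sum>l\<in>UNIV. herm_inner A (herm_basis k l) *\<^sub>R herm_basis k l) $ a $ b =
      (\<Sum>k\<in>UNIV. \<Sum>l\<in>UNIV. ?t k l)"
    by (simp add: herm_mat_sum scaleR_herm.rep_eq)
  also have "\<dots> = (\<Sum>(k, l)\<in>UNIV. ?t k l)"
    by (simp add: sum.cartesian_product)
  also have "\<dots> = (\<Sum>(k, l)\<in>{(a, b), (b, a)}. ?t k l)"
  proof (intro sum.mono_neutral_right ballI)
    fix x assume x: "x \<in> UNIV - {(a, b), (b, a)}"
    obtain k l where kl: "x = (k, l)" by (cases x)
    have "herm_mat (herm_basis k l) $ a $ b = 0"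
      using x kl by (intro herm_basis_entry_0) auto
    with kl show "(case x of (k, l) \<Rightarrow> ?t k l) = 0" by simp
  qed auto
  also have "\<dots> = herm_mat A $ a $ b"
  proof (rule linorder_cases[of a b])
    assume "a < b"
    then have neq: "a \<noteq> b" by auto
    then have "(\<Sum>(k, l)\<in>{(a, b), (b, a)}. ?t k l) = ?t a b + ?t b a" by auto
    also have "?t a b = complex_of_real (Re (herm_mat A $ a $ b))"
      using neq real by (simp only: herm_mat_basis_less[OF \<open>a < b\<close>]
          herm_inner_basis_less[OF \<open>a < b\<close>] entries) simp
    also have "?t b a = \<i> * complex_of_real (Im (herm_mat A $ a $ b))"
      using neq imag(2)[of "Im (herm_mat A $ b $ a)"] by (simp only: herm_mat_basis_greater[OF \<open>a < b\<close>]
          herm_inner_basis_greater[OF \<open>a < b\<close>] entries Im_herm_mat_sym[of A b a]) simp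
    finally show ?thesis by (simp add: complex_eq_iff)
  next
    assume "a = b"
    then show ?thesis using Im_herm_mat_sym[of A b b]
      by (simp add: herm_mat_basis_eq matrix_unit_entry herm_inner_basis_eq complex_eq_iff)
  next
    assume "b < a"
    then have neq: "a \<noteq> b" by auto
    then have "(\<Sum>(k, l)\<in>{(a, b), (b, a)}. ?t k l) = ?t b a + ?t a b" by auto
    also have "?t b a = complex_of_real (Re (herm_mat A $ a $ b))"
      using neq real by (simp only: herm_mat_basis_less[OF \<open>b < a\<close>]
          herm_inner_basis_less[OF \<open>b < a\<close>] entries Re_herm_mat_sym[of A b a]) simp
    also have "?t a b = \<i> * complex_of_real (Im (herm_mat A $ a $ b))"
      using neq imag(1)[of "Im (herm_mat A $ a $ b)"] by (simp only: herm_mat_basis_greater[OF \<open>b < a\<close>]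
          herm_inner_basis_greater[OF \<open>b < a\<close>] entries) simp
    finally show ?thesis by (simp add: complex_eq_iff)
  qed
  finally show "herm_mat (\<Sum>k\<in>UNIV. \<Sum>l\<in>UNIV. herm_inner A (herm_basis k l) *\<^sub>R herm_basis k l) $ a $ b =
    herm_mat A $ a $ b" .
qed

section \<open>Polynomials\<close>

lemma mpoly_eval_scaleR: "mpoly_eval (c *\<^sub>R p) x = c *\<^sub>R mpoly_eval p x"
proof -
  have "Poly_Mapping.keys (c *\<^sub>R p) \<subseteq> Poly_Mapping.keys p"
    by (auto simp: in_keys_iff scaleR_poly_mapping.rep_eq)
  then show ?thesis
    by (subst mpoly_eval_superset[of "Poly_Mapping.keys p"])
      (auto simp: mpoly_eval_def scaleR_poly_mapping.rep_eq scaleR_sum_right mult.commute)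
qed

lemma linear_mpoly_eval: "linear (\<lambda>p. mpoly_eval p x)"
  by (rule linearI) (simp_all add: mpoly_eval_add mpoly_eval_scaleR)

lemma mpoly_eval_sum: "mpoly_eval (\<Sum>i\<in>I. p i) x = (\<Sum>i\<in>I. mpoly_eval (p i) x)"
  by (rule linear_sum[OF linear_mpoly_eval])

lemma mpoly_eval_zero: "mpoly_eval 0 x = 0"
  by (rule linear_0[OF linear_mpoly_eval])

lemma monom_eval_0: "monom_eval 0 x = 1"
  by (simp add: monom_eval_def)

lemma monom_eval_plus: "monom_eval (\<alpha> + \<beta>) x = monom_eval \<alpha> x * monom_eval \<beta> x"
  by (simp add: monom_eval_def power_add prod.distrib)

lemma monom_eval_at_0: "monom_eval \<alpha> 0 = (if \<alpha> = 0 then 1 else 0)"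
proof (cases "\<alpha> = 0")
  case False
  then obtain i where "\<alpha> $ i \<noteq> 0" by (auto simp: vec_eq_iff)
  then have "monom_eval \<alpha> 0 = 0" unfolding monom_eval_def by (intro prod_zero) auto
  with False show ?thesis by simp
qed (simp add: monom_eval_0)

lemma mpoly_eval_at_0: "mpoly_eval p 0 = Poly_Mapping.lookup p 0"
proof -
  have "mpoly_eval p 0 = (\<Sum>\<alpha>\<in>insert 0 (Poly_Mapping.keys p). monom_eval \<alpha> 0 *\<^sub>R Poly_Mapping.lookup p \<alpha>)"
    by (rule mpoly_eval_superset) auto
  also have "\<dots> = (\<Sum>\<alpha>\<in>insert 0 (Poly_Mapping.keys p). if 0 = \<alpha> then Poly_Mapping.lookup p \<alpha> else 0)"
    by (intro sum.cong) (auto simp: monom_eval_at_0)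
  also have "\<dots> = Poly_Mapping.lookup p 0" by (subst sum.delta') auto
  finally show ?thesis .
qed

lemma continuous_on_monom_eval [continuous_intros]:
  "continuous_on S f \<Longrightarrow> continuous_on S (\<lambda>x. monom_eval \<alpha> (f x))"
  unfolding monom_eval_def by (intro continuous_intros)

lemma mpoly_eval_smult: "mpoly_eval (mpoly_smult f P) x = mpoly_eval f x *\<^sub>R mpoly_eval P x"
proof -
  have "mpoly_eval (mpoly_smult f P) x = (\<Sum>\<beta>\<in>Poly_Mapping.keys f. \<Sum>\<gamma>\<in>Poly_Mapping.keys P.
      (monom_eval \<beta> x * Poly_Mapping.lookup f \<beta>) *\<^sub>R monom_eval \<gamma> x *\<^sub>R Poly_Mapping.lookup P \<gamma>)"
    by (simp add: mpoly_smult_def mpoly_eval_sum mpoly_eval_single monom_eval_plus mult_ac)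
  then show ?thesis
    unfolding mpoly_eval_def[of f x] mpoly_eval_def[of P x] scaleR_sum_left scaleR_sum_right
    by (subst sum.swap) simp
qed

section \<open>Polynomial functions and Taylor expansion\<close>

text \<open>Translates and products are required only as functions that some formal polynomial
  evaluates to, so closure is shown for functions and no formal substitution is defined. These
  functions also form the algebra for Stone-Weierstrass.\<close>

definition polynomial_fun :: "(real^'n::finite \<Rightarrow> real) \<Rightarrow> bool" where
  "polynomial_fun f \<longleftrightarrow> (\<exists>q. \<forall>x. f x = mpoly_eval q x)"

lemma polynomial_fun_const: "polynomial_fun (\<lambda>x. c)"
  unfolding polynomial_fun_def
  by (rule exI[of _ "Poly_Mapping.single 0 c"]) (simp add: mpoly_eval_single monom_eval_0)

lemma polynomial_fun_coord: "polynomial_fun (\<lambda>x :: real^'n::finite. x $ i)"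
proof -
  have "monom_eval (axis i 1) x = x $ i" for x :: "real^'n"
  proof -
    have "monom_eval (axis i 1) x = (\<Prod>j\<in>UNIV. if j = i then x $ j else 1)"
      unfolding monom_eval_def by (intro prod.cong) (auto simp: axis_def)
    then show ?thesis by simp
  qed
  then show ?thesis unfolding polynomial_fun_def
    by (intro exI[of _ "Poly_Mapping.single (axis i 1) 1"]) (simp add: mpoly_eval_single)
qed

lemma polynomial_fun_add: "polynomial_fun f \<Longrightarrow> polynomial_fun g \<Longrightarrow> polynomial_fun (\<lambda>x. f x + g x)"
  unfolding polynomial_fun_def by (metis mpoly_eval_add)

lemma polynomial_fun_mult:
  assumes "polynomial_fun f" "polynomial_fun g"
  shows "polynomial_fun (\<lambda>x. f x * g x)"
proof -
  obtain p q where p: "\<And>x. f x = mpoly_eval p x" and q: "\<And>x. g x = mpoly_eval q x"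
    using assms unfolding polynomial_fun_def by blast
  define r where "r = (\<Sum>\<alpha>\<in>Poly_Mapping.keys p. \<Sum>\<beta>\<in>Poly_Mapping.keys q.
    Poly_Mapping.single (\<alpha> + \<beta>) (Poly_Mapping.lookup p \<alpha> * Poly_Mapping.lookup q \<beta>))"
  have "f x * g x = mpoly_eval r x" for x
    unfolding p q r_def mpoly_eval_sum mpoly_eval_single monom_eval_plus
    by (simp add: mpoly_eval_def sum_product mult_ac)
  then show ?thesis unfolding polynomial_fun_def by blast
qed

lemma polynomial_fun_sum:
  "(\<And>i. i \<in> I \<Longrightarrow> polynomial_fun (f i)) \<Longrightarrow> polynomial_fun (\<lambda>x. \<Sum>i\<in>I. f i x)"
  by (induction I rule: infinite_finite_induct) (auto intro: polynomial_fun_const polynomial_fun_add)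

lemma polynomial_fun_prod:
  "(\<And>i. i \<in> I \<Longrightarrow> polynomial_fun (f i)) \<Longrightarrow> polynomial_fun (\<lambda>x. \<Prod>i\<in>I. f i x)"
  by (induction I rule: infinite_finite_induct) (auto intro: polynomial_fun_const polynomial_fun_mult)

lemma polynomial_fun_power: "polynomial_fun f \<Longrightarrow> polynomial_fun (\<lambda>x. f x ^ k)"
  by (induction k) (auto intro: polynomial_fun_const polynomial_fun_mult)

lemma polynomial_fun_translate: "polynomial_fun (\<lambda>x. mpoly_eval p (x + y))"
  unfolding mpoly_eval_def monom_eval_def vector_add_component real_scaleR_def
  by (intro polynomial_fun_sum polynomial_fun_mult polynomial_fun_prod polynomial_fun_power
      polynomial_fun_add polynomial_fun_const polynomial_fun_coord)

text \<open>The polynomials are related only as functions, so their formal derivatives are compared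
  through analytic ones: induction on the total order removes one coordinate direction at a time,
  and derivatives along an axis are unique.\<close>

lemma mderiv_translate:
  assumes "\<And>x. mpoly_eval p x = mpoly_eval q (x - y)"
  shows "mpoly_eval (mderiv \<alpha> p) x = mpoly_eval (mderiv \<alpha> q) (x - y)"
proof (induction "\<Sum>i\<in>UNIV. \<alpha> $ i" arbitrary: \<alpha> x rule: less_induct)
  case less
  show ?case
  proof (cases "\<alpha> = 0")
    case True
    then show ?thesis by (simp add: mderiv_zero assms)
  next
    case False
    then obtain i where i: "\<alpha> $ i \<noteq> 0" by (auto simp: vec_eq_iff)
    define \<beta> where "\<beta> = \<alpha> - axis i 1"
    \<comment> \<open>Subtraction of multi-indices is truncated; it is undone here because
      \<open>\<alpha> $ i\<close> is nonzero.\<close>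
    have \<alpha>: "\<alpha> = axis i 1 + \<beta>" using i by (auto simp: vec_eq_iff \<beta>_def axis_def)
    have "(\<Sum>i\<in>UNIV. \<beta> $ i) < (\<Sum>i\<in>UNIV. \<alpha> $ i)"
      using i by (intro sum_strict_mono_ex1) (auto simp: \<beta>_def axis_def)
    then have IH: "mpoly_eval (mderiv \<beta> p) x = mpoly_eval (mderiv \<beta> q) (x - y)" for x
      by (rule less)
    have "((\<lambda>s. mpoly_eval (mderiv \<beta> q) (x - y + s *\<^sub>R axis i 1)) has_real_derivative
        mpoly_eval (mderiv \<alpha> p) x) (at 0)"
      using mderiv_axis_has_derivative[of "mderiv \<beta> p" x i] unfolding IH \<alpha> mderiv_add
      by (simp add: algebra_simps)
    then show ?thesis
      using mderiv_axis_has_derivative[of "mderiv \<beta> q" "x - y" i] unfolding \<alpha> mderiv_add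
      by (rule DERIV_unique)
  qed
qed

text \<open>Taylor's coefficient formula: at the origin only the constant term of
  \<open>mderiv \<alpha> q\<close> survives, and it is \<open>mfact \<alpha>\<close> times the
  coefficient of \<open>q\<close>.\<close>

lemma lookup_translate:
  assumes "\<And>x. mpoly_eval p x = mpoly_eval q (x - y)"
  shows "Poly_Mapping.lookup q \<alpha> = mpoly_eval (mderiv \<alpha> p) y / mfact \<alpha>"
proof -
  have "mpoly_eval (mderiv \<alpha> p) y = mpoly_eval (mderiv \<alpha> q) (y - y)"
    using assms by (rule mderiv_translate)
  also have "\<dots> = mfact \<alpha> * Poly_Mapping.lookup q \<alpha>"
    by (simp add: mpoly_eval_at_0 mderiv.rep_eq) (simp add: mfact_def)
  finally show ?thesis by (simp add: mfact_nonzero)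
qed

lemma mderiv_single_eq_0:
  assumes "\<not> (\<forall>i. \<alpha> $ i \<le> \<beta> $ i)"
  shows "mderiv \<alpha> (Poly_Mapping.single \<beta> c) = 0"
proof -
  have "\<gamma> + \<alpha> \<noteq> \<beta>" for \<gamma> using assms by auto
  then show ?thesis by transfer (auto simp: fun_eq_iff when_def)
qed

text \<open>\<open>D\<close> may be any finite set containing the multi-indices below
  \<open>\<beta>\<close>, so that all monomials of a polynomial can share one index set.\<close>

lemma monom_eval_taylor:
  assumes "finite D" "{\<alpha>. \<forall>i. \<alpha> $ i \<le> \<beta> $ i} \<subseteq> D"
  shows "monom_eval \<beta> (x + t) =
    (\<Sum>\<alpha>\<in>D. (mpoly_eval (mderiv \<alpha> (Poly_Mapping.single \<beta> 1)) x / mfact \<alpha>) * monom_eval \<alpha> t)"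
proof -
  let ?p = "Poly_Mapping.single \<beta> (1::real)"
  obtain q where q: "\<And>t. mpoly_eval ?p (t + x) = mpoly_eval q t"
    using polynomial_fun_translate[of ?p x] unfolding polynomial_fun_def by blast
  have "mpoly_eval ?p z = mpoly_eval q (z - x)" for z using q[of "z - x"] by simp
  then have l: "Poly_Mapping.lookup q \<alpha> = mpoly_eval (mderiv \<alpha> ?p) x / mfact \<alpha>" for \<alpha>
    by (rule lookup_translate)
  have "Poly_Mapping.keys q \<subseteq> D"
  proof
    fix \<alpha> assume "\<alpha> \<in> Poly_Mapping.keys q"
    then have "mderiv \<alpha> ?p \<noteq> 0" by (auto simp: in_keys_iff l mpoly_eval_zero)
    then show "\<alpha> \<in> D" using assms(2) mderiv_single_eq_0[of \<alpha> \<beta> 1] by auto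
  qed
  then have "mpoly_eval q t = (\<Sum>\<alpha>\<in>D. monom_eval \<alpha> t *\<^sub>R Poly_Mapping.lookup q \<alpha>)"
    using assms(1) by (intro mpoly_eval_superset)
  then show ?thesis
    using q[of t] by (simp add: l mpoly_eval_single add.commute mult.commute)
qed

lemma mderiv_scaleR: "mderiv \<alpha> (c *\<^sub>R p) = c *\<^sub>R mderiv \<alpha> p"
  by transfer (simp add: fun_eq_iff)

lemma mpoly_eval_mderiv_expand:
  assumes "finite B" "Poly_Mapping.keys f \<subseteq> B"
  shows "mpoly_eval (mderiv \<alpha> f) x =
    (\<Sum>\<beta>\<in>B. Poly_Mapping.lookup f \<beta> * mpoly_eval (mderiv \<alpha> (Poly_Mapping.single \<beta> 1)) x)"
proof -
  have lin: "linear (\<lambda>f. mpoly_eval (mderiv \<alpha> f) x)"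
    by (rule linearI) (simp_all add: mderiv_plus mderiv_scaleR mpoly_eval_add mpoly_eval_scaleR)
  have "f = (\<Sum>\<beta>\<in>B. Poly_Mapping.lookup f \<beta> *\<^sub>R Poly_Mapping.single \<beta> 1)"
  proof (rule poly_mapping_eqI)
    fix \<gamma>
    have "Poly_Mapping.lookup (\<Sum>\<beta>\<in>B. Poly_Mapping.lookup f \<beta> *\<^sub>R Poly_Mapping.single \<beta> 1) \<gamma> =
      (\<Sum>\<beta>\<in>B. if \<beta> = \<gamma> then Poly_Mapping.lookup f \<beta> else 0)"
      by (auto simp: lookup_sum scaleR_poly_mapping.rep_eq lookup_single when_def intro!: sum.cong)
    also have "\<dots> = Poly_Mapping.lookup f \<gamma>"
      using assms by (auto simp: sum.delta in_keys_iff)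
    finally show "Poly_Mapping.lookup f \<gamma> =
      Poly_Mapping.lookup (\<Sum>\<beta>\<in>B. Poly_Mapping.lookup f \<beta> *\<^sub>R Poly_Mapping.single \<beta> 1) \<gamma>" ..
  qed
  then have "mpoly_eval (mderiv \<alpha> f) x =
      mpoly_eval (mderiv \<alpha> (\<Sum>\<beta>\<in>B. Poly_Mapping.lookup f \<beta> *\<^sub>R Poly_Mapping.single \<beta> 1)) x"
    by simp
  then show ?thesis
    unfolding linear_sum[OF lin] linear_scale[OF lin] by simp
qed

section \<open>Evaluation of canonical representations\<close>

text \<open>Enlarging \<open>B\<close> adds only zero coefficients, which \<open>Q \<alpha>\<close>
  sends to \<open>0\<close>; enlarging \<open>D\<close> adds only derivatives that annihilate the
  monomials of \<open>B\<close>. Different operators can thus be compared over common index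
  sets.\<close>

lemma mpoly_eval_canonical_op:
  assumes Q: "\<And>\<alpha>. linear (Q \<alpha>)"
    and B: "finite B" "Poly_Mapping.keys p \<subseteq> B"
    and D: "finite D" "\<And>\<beta>. \<beta> \<in> B \<Longrightarrow> {\<alpha>. \<forall>i. \<alpha> $ i \<le> \<beta> $ i} \<subseteq> D"
  shows "mpoly_eval (canonical_op Q p) x = (\<Sum>\<alpha>\<in>D. \<Sum>\<beta>\<in>B.
    (mpoly_eval (mderiv \<alpha> (Poly_Mapping.single \<beta> 1)) x / mfact \<alpha>) *\<^sub>R
      mpoly_eval (Q \<alpha> (Poly_Mapping.lookup p \<beta>)) x)"
proof -
  have td: "times_deriv (Q \<alpha>) \<alpha> p = (\<Sum>\<beta>\<in>B.
     mpoly_smult (mderiv \<alpha> (Poly_Mapping.single \<beta> 1)) (Q \<alpha> (Poly_Mapping.lookup p \<beta>)))" for \<alpha>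
    unfolding times_deriv_def using B linear_0[OF Q]
    by (intro sum.mono_neutral_left) (auto simp: in_keys_iff mpoly_smult_def)
  have "\<alpha> \<in> D" if nz: "(1 / mfact \<alpha>) *\<^sub>R times_deriv (Q \<alpha>) \<alpha> p \<noteq> 0" for \<alpha>
  proof (rule ccontr)
    assume "\<alpha> \<notin> D"
    then have "mderiv \<alpha> (Poly_Mapping.single \<beta> (1::real)) = 0" if "\<beta> \<in> B" for \<beta>
      using D(2)[OF that] by (intro mderiv_single_eq_0) auto
    then have "times_deriv (Q \<alpha>) \<alpha> p = 0" unfolding td by (simp add: mpoly_smult_def)
    with nz show False by simp
  qed
  then have "canonical_op Q p = (\<Sum>\<alpha>\<in>D. (1 / mfact \<alpha>) *\<^sub>R times_deriv (Q \<alpha>) \<alpha> p)"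
    unfolding canonical_op_def using D(1) by (intro Sum_any.expand_superset) auto
  then show ?thesis
    by (simp add: td mpoly_eval_sum mpoly_eval_scaleR mpoly_eval_smult scaleR_sum_right)
qed

lemma mpoly_eval_op_at:
  assumes Q: "\<And>\<alpha>. linear (Q \<alpha>)"
    and B: "finite B" "Poly_Mapping.keys p \<subseteq> B"
    and D: "finite D" "\<And>\<beta>. \<beta> \<in> B \<Longrightarrow> {\<alpha>. \<forall>i. \<alpha> $ i \<le> \<beta> $ i} \<subseteq> D"
  shows "mpoly_eval (op_at Q y p) x = (\<Sum>\<alpha>\<in>D. \<Sum>\<beta>\<in>B.
    (mpoly_eval (mderiv \<alpha> (Poly_Mapping.single \<beta> 1)) x / mfact \<alpha>) *\<^sub>R
      mpoly_eval (Q \<alpha> (Poly_Mapping.lookup p \<beta>)) y)"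
proof -
  have "linear (\<lambda>M. Poly_Mapping.single 0 (mpoly_eval (Q \<alpha> M) y))" for \<alpha>
  proof (rule linearI)
    show "Poly_Mapping.single 0 (mpoly_eval (Q \<alpha> (M + M')) y) =
        Poly_Mapping.single 0 (mpoly_eval (Q \<alpha> M) y) + Poly_Mapping.single 0 (mpoly_eval (Q \<alpha> M') y)" for M M'
      by (simp add: linear_add[OF Q] mpoly_eval_add single_add)
    show "Poly_Mapping.single 0 (mpoly_eval (Q \<alpha> (c *\<^sub>R M)) y) =
        c *\<^sub>R Poly_Mapping.single 0 (mpoly_eval (Q \<alpha> M) y)" for c M
      by (rule poly_mapping_eqI) (simp add: linear_scale[OF Q] mpoly_eval_scaleR
          scaleR_poly_mapping.rep_eq lookup_single when_def)
  qed
  from mpoly_eval_canonical_op[OF this B D] show ?thesis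
    by (simp add: op_at_def mpoly_eval_single monom_eval_0)
qed

text \<open>\<open>op_at Q y\<close> freezes the argument of the coefficient polynomials but not
  that of the derivatives, so the two operators agree at the point \<open>y\<close> itself.\<close>

lemma canonical_op_eq_op_at:
  assumes Q: "\<And>\<alpha>. linear (Q \<alpha>)"
  shows "mpoly_eval (canonical_op Q p) y = mpoly_eval (op_at Q y p) y"
proof -
  let ?B = "Poly_Mapping.keys p" and ?D = "\<Union>\<beta>\<in>Poly_Mapping.keys p. {\<alpha>. \<forall>i. \<alpha> $ i \<le> \<beta> $ i}"
  have *: "finite ?B" "?B \<subseteq> ?B" "finite ?D" "\<And>\<beta>. \<beta> \<in> ?B \<Longrightarrow> {\<alpha>. \<forall>i. \<alpha> $ i \<le> \<beta> $ i} \<subseteq> ?D"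
    by (auto simp: finite_multiindex_le)
  show ?thesis
    by (simp only: mpoly_eval_canonical_op[OF Q *] mpoly_eval_op_at[OF Q *])
qed

definition scalar_times :: "'n::finite real_mpoly \<Rightarrow> 'm::finite herm \<Rightarrow> ('m, 'n) herm_mpoly" where
  "scalar_times f M = Poly_Mapping.map (\<lambda>c. c *\<^sub>R M) f"

lemma lookup_scalar_times:
  "Poly_Mapping.lookup (scalar_times f M) \<gamma> = Poly_Mapping.lookup f \<gamma> *\<^sub>R M"
  by (simp add: scalar_times_def map.rep_eq when_def)

lemma keys_scalar_times: "Poly_Mapping.keys (scalar_times f M) \<subseteq> Poly_Mapping.keys f"
  by (auto simp: in_keys_iff lookup_scalar_times)

lemma mpoly_eval_scalar_times: "mpoly_eval (scalar_times f M) x = mpoly_eval f x *\<^sub>R M"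
  by (subst mpoly_eval_superset[OF finite_keys keys_scalar_times])
    (simp add: mpoly_eval_def lookup_scalar_times scaleR_sum_left)

text \<open>Here \<open>f\<close> is \<open>q\<close> expanded around \<open>y\<close>: its
  derivatives at \<open>y\<close> are the coefficients of \<open>q\<close> times
  \<open>mfact \<alpha>\<close>, and the factorials cancel.\<close>

lemma mpoly_eval_canonical_op_translate:
  assumes Q: "\<And>\<alpha>. linear (Q \<alpha>)" and f: "\<And>x. mpoly_eval f x = mpoly_eval q (x - y)"
  shows "mpoly_eval (canonical_op Q (scalar_times f M)) y =
    (\<Sum>\<alpha>\<in>Poly_Mapping.keys q. Poly_Mapping.lookup q \<alpha> *\<^sub>R mpoly_eval (Q \<alpha> M) y)"
proof -
  let ?B = "Poly_Mapping.keys f" and ?D = "\<Union>\<beta>\<in>Poly_Mapping.keys f. {\<alpha>. \<forall>i. \<alpha> $ i \<le> \<beta> $ i}"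
  have D: "finite ?B" "Poly_Mapping.keys (scalar_times f M) \<subseteq> ?B" "finite ?D"
      "\<And>\<beta>. \<beta> \<in> ?B \<Longrightarrow> {\<alpha>. \<forall>i. \<alpha> $ i \<le> \<beta> $ i} \<subseteq> ?D"
    using keys_scalar_times by (auto simp: finite_multiindex_le)
  note l = lookup_translate[OF f]
  have expand: "mpoly_eval (mderiv \<alpha> f) y =
     (\<Sum>\<beta>\<in>?B. Poly_Mapping.lookup f \<beta> * mpoly_eval (mderiv \<alpha> (Poly_Mapping.single \<beta> 1)) y)" for \<alpha>
    by (intro mpoly_eval_mderiv_expand) auto
  have keys: "Poly_Mapping.keys q \<subseteq> ?D"
  proof
    fix \<alpha> assume "\<alpha> \<in> Poly_Mapping.keys q"
    then have "mpoly_eval (mderiv \<alpha> f) y \<noteq> 0" by (auto simp: in_keys_iff l)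
    then obtain \<beta> where "\<beta> \<in> ?B" "mpoly_eval (mderiv \<alpha> (Poly_Mapping.single \<beta> (1::real))) y \<noteq> 0"
      unfolding expand by (metis (no_types, lifting) mult_zero_right sum.neutral)
    then have "\<forall>i. \<alpha> $ i \<le> \<beta> $ i"
      using mderiv_single_eq_0[of \<alpha> \<beta> "1::real"] mpoly_eval_zero by metis
    with \<open>\<beta> \<in> ?B\<close> show "\<alpha> \<in> ?D" by blast
  qed
  have "mpoly_eval (canonical_op Q (scalar_times f M)) y = (\<Sum>\<alpha>\<in>?D. \<Sum>\<beta>\<in>?B.
    (mpoly_eval (mderiv \<alpha> (Poly_Mapping.single \<beta> 1)) y / mfact \<alpha>) *\<^sub>R
      mpoly_eval (Q \<alpha> (Poly_Mapping.lookup f \<beta> *\<^sub>R M)) y)"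
    by (simp only: mpoly_eval_canonical_op[OF Q D] lookup_scalar_times)
  also have "\<dots> = (\<Sum>\<alpha>\<in>?D. Poly_Mapping.lookup q \<alpha> *\<^sub>R mpoly_eval (Q \<alpha> M) y)"
    unfolding l expand linear_scale[OF Q] mpoly_eval_scaleR
    by (simp add: scaleR_sum_left sum_divide_distrib mult.commute)
  also have "\<dots> = (\<Sum>\<alpha>\<in>Poly_Mapping.keys q. Poly_Mapping.lookup q \<alpha> *\<^sub>R mpoly_eval (Q \<alpha> M) y)"
    using D(3) keys by (intro sum.mono_neutral_right) (auto simp: in_keys_iff)
  finally show ?thesis .
qed

lemma mpoly_dense:
  fixes f :: "real^'n::finite \<Rightarrow> real"
  assumes "compact K" "continuous_on K f" "0 < \<epsilon>"
  shows "\<exists>p. \<forall>x\<in>K. \<bar>f x - mpoly_eval p x\<bar> < \<epsilon>"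
proof -
  have "\<exists>g. polynomial_fun g \<and> (\<forall>x\<in>K. \<bar>f x - g x\<bar> < \<epsilon>)"
  proof (rule Stone_Weierstrass_HOL[OF assms(1), where P = polynomial_fun])
    show "continuous_on K g" if g: "polynomial_fun g" for g
    proof -
      obtain q where "\<forall>x. g x = mpoly_eval q x" using g by (auto simp: polynomial_fun_def)
      moreover have "continuous_on K (\<lambda>x. mpoly_eval q x)"
        unfolding mpoly_eval_def by (intro continuous_intros)
      ultimately show ?thesis by (simp cong: continuous_on_cong)
    qed
    show "\<exists>g. polynomial_fun g \<and> g x \<noteq> g y" if "x \<in> K \<and> y \<in> K \<and> x \<noteq> y" for x y
      using that polynomial_fun_coord by (metis vec_eq_iff)
  qed (use assms polynomial_fun_const polynomial_fun_add polynomial_fun_mult in auto)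
  then show ?thesis unfolding polynomial_fun_def by metis
qed

section \<open>Matrix-valued measures\<close>

definition jordan_matrix :: "'a measure \<Rightarrow> ('a set \<Rightarrow> 'm::finite herm) \<Rightarrow> bool" where
  "jordan_matrix N \<mu> \<longleftrightarrow> (\<forall>i j. jordan_measure N (\<lambda>S. Re (herm_mat (\<mu> S) $ i $ j)) \<and>
     jordan_measure N (\<lambda>S. Im (herm_mat (\<mu> S) $ i $ j)))"

lemma herm_mat_integral:
  "herm_mat (matrix_measure_integral N \<mu> f) $ i $ j =
    Complex (signed_integral N (\<lambda>S. Re (herm_mat (\<mu> S) $ i $ j)) f)
      (signed_integral N (\<lambda>S. Im (herm_mat (\<mu> S) $ i $ j)) f)"
  by (simp add: matrix_measure_integral.rep_eq complex_measure_integral_def)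

lemma
  fixes \<mu> :: "'a set \<Rightarrow> 'm::finite herm"
  assumes \<mu>: "jordan_matrix N \<mu>"
  shows jordan_measure_quad: "jordan_measure N (\<lambda>S. herm_quad (\<mu> S) v)"
    and herm_quad_integral: "bounded_measurable N f \<Longrightarrow>
      herm_quad (matrix_measure_integral N \<mu> f) v = signed_integral N (\<lambda>S. herm_quad (\<mu> S) v) f"
proof -
  have j: "jordan_measure N (\<lambda>S. Re (herm_mat (\<mu> S) $ i $ j))"
      "jordan_measure N (\<lambda>S. Im (herm_mat (\<mu> S) $ i $ j))" for i j
    using \<mu> by (auto simp: jordan_matrix_def)
  have js: "jordan_measure N (\<lambda>S. a * Re (herm_mat (\<mu> S) $ i $ j) + b * Im (herm_mat (\<mu> S) $ i $ j))"
    for a b i j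
    by (intro jordan_measure_add jordan_measure_scale j)
  show "jordan_measure N (\<lambda>S. herm_quad (\<mu> S) v)"
    unfolding herm_quad_expand by (intro jordan_measure_sum js finite)
  assume f: "bounded_measurable N f"
  have e: "signed_integral N (\<lambda>S. a * Re (herm_mat (\<mu> S) $ i $ j) + b * Im (herm_mat (\<mu> S) $ i $ j)) f =
      a * Re (herm_mat (matrix_measure_integral N \<mu> f) $ i $ j)
        + b * Im (herm_mat (matrix_measure_integral N \<mu> f) $ i $ j)" for a b i j
    unfolding herm_mat_integral complex.sel signed_integral_scale_measure[OF j(1) f, symmetric]
      signed_integral_scale_measure[OF j(2) f, symmetric]
    by (intro signed_integral_add_measure jordan_measure_scale j f)
  show "herm_quad (matrix_measure_integral N \<mu> f) v = signed_integral N (\<lambda>S. herm_quad (\<mu> S) v) f"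
    unfolding herm_quad_expand e[symmetric]
    by (subst signed_integral_sum_measure; intro jordan_measure_sum js finite f sum.cong refl)
      (subst signed_integral_sum_measure; intro jordan_measure_sum js finite f sum.cong refl)
qed

lemma signed_measure_sum:
  assumes "finite I" "\<And>i. i \<in> I \<Longrightarrow> signed_measure N (\<nu> i)"
  shows "signed_measure N (\<lambda>S. \<Sum>i\<in>I. \<nu> i S)"
  using assms
proof (induction I rule: finite_induct)
  case empty
  show ?case by (simp add: signed_measure_def)
next
  case (insert i I)
  then show ?case by (simp add: signed_measure_add)
qed

lemma complex_measure_iff:
  "complex_measure N \<rho> \<longleftrightarrow> signed_measure N (\<lambda>S. Re (\<rho> S)) \<and> signed_measure N (\<lambda>S. Im (\<rho> S))"
  by (simp only: complex_measure_def signed_measure_def sums_complex_iff imp_conjR all_conj_distrib)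

text \<open>Quadratic forms of a positive matrix measure are positive measures, and polarization
  writes the real and imaginary part of each entry as a combination of three of them. This supplies
  explicit decompositions of the signed entries.\<close>

lemma positive_matrix_measure_imp_jordan:
  assumes "positive_matrix_measure N \<mu>"
  shows "jordan_matrix N \<mu>"
proof -
  have s: "signed_measure N (\<lambda>S. Re (herm_mat (\<mu> S) $ i $ j))"
      "signed_measure N (\<lambda>S. Im (herm_mat (\<mu> S) $ i $ j))" for i j
    using assms by (auto simp: positive_matrix_measure_def matrix_measure_def complex_measure_iff)
  have "signed_measure N (\<lambda>S. herm_quad (\<mu> S) v)" for v
    unfolding herm_quad_expand
    by (intro signed_measure_sum signed_measure_add signed_measure_scale s finite)
  then have q: "jordan_measure N (\<lambda>S. herm_quad (\<mu> S) v)" for v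
    using assms by (intro jordan_measure_pos)
      (auto simp: pos_measure_def positive_matrix_measure_def herm_psd_iff)
  have "jordan_measure N (\<lambda>S. (1/2) * (herm_quad (\<mu> S) v + ((-1) * herm_quad (\<mu> S) v' + (-1) * herm_quad (\<mu> S) v'')))" for v v' v''
    by (intro jordan_measure_scale jordan_measure_add q)
  then show ?thesis
    unfolding jordan_matrix_def Re_herm_mat_eq Im_herm_mat_eq by simp
qed

section \<open>Integration against a positive operator-valued measure\<close>

locale positive_operator =
  fixes K :: "'a::topological_space set" and \<nu> :: "'a set \<Rightarrow> 'm::{finite,linorder} herm \<Rightarrow> 'm herm"
  assumes pom: "positive_operator_measure K \<nu>"
begin

abbreviation "N \<equiv> restrict_space borel K"

definition J :: "('a \<Rightarrow> real) \<Rightarrow> 'm herm \<Rightarrow> 'm herm" where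
  "J f M = matrix_measure_integral N (\<lambda>S. \<nu> S M) f"

lemma linear_nu: "S \<in> sets N \<Longrightarrow> linear (\<nu> S)"
  using pom by (simp add: positive_operator_measure_def)

lemma psd_nu: "S \<in> sets N \<Longrightarrow> herm_psd M \<Longrightarrow> herm_psd (\<nu> S M)"
  using pom by (simp add: positive_operator_measure_def positive_matrix_measure_def)

text \<open>For psd \<open>M\<close> positivity gives the decomposition; a general \<open>M\<close>
  is a difference of psd matrices. The resulting identity holds only on measurable sets, where
  \<open>\<nu> S\<close> is known to be linear.\<close>

lemma jordan_nu: "jordan_matrix N (\<lambda>S. \<nu> S M)"
proof -
  obtain B C where BC: "herm_psd B" "herm_psd C" "M = B - C" by (rule herm_diff_psd)
  then have j: "jordan_matrix N (\<lambda>S. \<nu> S B)" "jordan_matrix N (\<lambda>S. \<nu> S C)"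
    using pom by (auto simp: positive_operator_measure_def intro: positive_matrix_measure_imp_jordan)
  have eq: "\<nu> S M = \<nu> S B - \<nu> S C" if "S \<in> sets N" for S
    using linear_diff[OF linear_nu[OF that]] BC(3) by simp
  have diff: "jordan_measure N \<mu>" if "jordan_measure N a" "jordan_measure N b"
    "\<And>S. S \<in> sets N \<Longrightarrow> \<mu> S = a S + (-1) * b S" for a b \<mu>
    using jordan_measure_cong[OF jordan_measure_add[OF that(1) jordan_measure_scale[OF that(2)]] that(3)] .
  show ?thesis
    unfolding jordan_matrix_def
  proof (intro allI conjI)
    fix i j
    have e: "jordan_measure N (\<lambda>S. Re (herm_mat (\<nu> S B) $ i $ j))" "jordan_measure N (\<lambda>S. Im (herm_mat (\<nu> S B) $ i $ j))"
      "jordan_measure N (\<lambda>S. Re (herm_mat (\<nu> S C) $ i $ j))" "jordan_measure N (\<lambda>S. Im (herm_mat (\<nu> S C) $ i $ j))"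
      using j by (simp_all add: jordan_matrix_def)
    show "jordan_measure N (\<lambda>S. Re (herm_mat (\<nu> S M) $ i $ j))"
      by (rule diff[OF e(1,3)]) (simp add: eq minus_herm.rep_eq)
    show "jordan_measure N (\<lambda>S. Im (herm_mat (\<nu> S M) $ i $ j))"
      by (rule diff[OF e(2,4)]) (simp add: eq minus_herm.rep_eq)
  qed
qed

lemma linear_J:
  assumes f: "bounded_measurable N f"
  shows "linear (J f)"
proof (rule linearI; rule herm_eqI)
  fix M M' c i j
  have e: "jordan_measure N (\<lambda>S. Re (herm_mat (\<nu> S M) $ i $ j))"
    "jordan_measure N (\<lambda>S. Im (herm_mat (\<nu> S M) $ i $ j))" for M
    using jordan_nu[of M] by (auto simp: jordan_matrix_def)
  have "signed_integral N (\<lambda>S. Re (herm_mat (\<nu> S (M + M')) $ i $ j)) f =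
      signed_integral N (\<lambda>S. Re (herm_mat (\<nu> S M) $ i $ j) + Re (herm_mat (\<nu> S M') $ i $ j)) f"
    "signed_integral N (\<lambda>S. Im (herm_mat (\<nu> S (M + M')) $ i $ j)) f =
      signed_integral N (\<lambda>S. Im (herm_mat (\<nu> S M) $ i $ j) + Im (herm_mat (\<nu> S M') $ i $ j)) f"
    by (rule signed_integral_cong; simp add: linear_add[OF linear_nu] plus_herm.rep_eq)+
  then show "herm_mat (J f (M + M')) $ i $ j = herm_mat (J f M + J f M') $ i $ j"
    by (simp add: J_def herm_mat_integral plus_herm.rep_eq signed_integral_add_measure e f complex_eq_iff)
  have "signed_integral N (\<lambda>S. Re (herm_mat (\<nu> S (c *\<^sub>R M)) $ i $ j)) f =
      signed_integral N (\<lambda>S. c * Re (herm_mat (\<nu> S M) $ i $ j)) f"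
    "signed_integral N (\<lambda>S. Im (herm_mat (\<nu> S (c *\<^sub>R M)) $ i $ j)) f =
      signed_integral N (\<lambda>S. c * Im (herm_mat (\<nu> S M) $ i $ j)) f"
    by (rule signed_integral_cong; simp add: linear_scale[OF linear_nu] scaleR_herm.rep_eq)+
  then show "herm_mat (J f (c *\<^sub>R M)) $ i $ j = herm_mat (c *\<^sub>R J f M) $ i $ j"
    by (simp add: J_def herm_mat_integral scaleR_herm.rep_eq signed_integral_scale_measure e f complex_eq_iff)
qed

lemma J_scale:
  assumes f: "bounded_measurable N f"
  shows "J (\<lambda>x. c * f x) M = c *\<^sub>R J f M"
proof (rule herm_eqI)
  fix i j
  show "herm_mat (J (\<lambda>x. c * f x) M) $ i $ j = herm_mat (c *\<^sub>R J f M) $ i $ j"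
    using jordan_nu[of M] unfolding jordan_matrix_def
    by (simp add: J_def herm_mat_integral scaleR_herm.rep_eq signed_integral_scale f complex_eq_iff)
qed

lemma J_sum:
  assumes "finite I" "\<And>k. k \<in> I \<Longrightarrow> bounded_measurable N (f k)"
  shows "J (\<lambda>x. \<Sum>k\<in>I. f k x) M = (\<Sum>k\<in>I. J (f k) M)"
proof (rule herm_eqI)
  fix i j
  have e: "jordan_measure N (\<lambda>S. Re (herm_mat (\<nu> S M) $ i $ j))"
    "jordan_measure N (\<lambda>S. Im (herm_mat (\<nu> S M) $ i $ j))"
    using jordan_nu[of M] by (auto simp: jordan_matrix_def)
  show "herm_mat (J (\<lambda>x. \<Sum>k\<in>I. f k x) M) $ i $ j = herm_mat (\<Sum>k\<in>I. J (f k) M) $ i $ j"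
    using signed_integral_sum[OF assms e(1)] signed_integral_sum[OF assms e(2)]
    by (simp add: J_def herm_mat_integral herm_mat_sum complex_eq_iff)
qed

lemma J_psd:
  assumes "herm_psd M" "bounded_measurable N f" "\<And>x. x \<in> K \<Longrightarrow> 0 \<le> f x"
  shows "herm_psd (J f M)"
  unfolding herm_psd_iff
proof
  fix v
  have "herm_quad (J f M) v = signed_integral N (\<lambda>S. herm_quad (\<nu> S M) v) f"
    unfolding J_def by (rule herm_quad_integral[OF jordan_nu assms(2)])
  also have "0 \<le> \<dots>"
    using psd_nu[OF _ assms(1)] assms(2,3)
    by (intro signed_integral_nonneg jordan_measure_quad jordan_nu)
      (auto simp: herm_psd_iff space_restrict_space)
  finally show "0 \<le> herm_quad (J f M) v" .
qed

text \<open>Pulling the scalars through \<open>J\<close> reassembles \<open>M\<close> from its basis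
  expansion, so on products the basis-dependent integral is the basis-free
  \<open>J f M\<close>.\<close>

lemma operator_integral_scaleR:
  assumes f: "bounded_measurable N f"
  shows "operator_measure_integral K \<nu> (\<lambda>x. f x *\<^sub>R M) = J f M"
proof -
  have "operator_measure_integral K \<nu> (\<lambda>x. f x *\<^sub>R M) =
      (\<Sum>i\<in>UNIV. \<Sum>j\<in>UNIV. J (\<lambda>x. herm_inner M (herm_basis i j) * f x) (herm_basis i j))"
    by (simp add: operator_measure_integral_def J_def linear_scale[OF linear_herm_inner] mult.commute)
  also have "\<dots> = (\<Sum>i\<in>UNIV. \<Sum>j\<in>UNIV. J f (herm_inner M (herm_basis i j) *\<^sub>R herm_basis i j))"
    by (simp add: J_scale[OF f] linear_scale[OF linear_J[OF f]])
  also have "\<dots> = J f (\<Sum>i\<in>UNIV. \<Sum>j\<in>UNIV. herm_inner M (herm_basis i j) *\<^sub>R herm_basis i j)"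
    by (simp add: linear_sum[OF linear_J[OF f]])
  finally show ?thesis by (simp add: herm_basis_expand)
qed

lemma operator_integral_sum:
  assumes I: "finite I" and f: "\<And>i. i \<in> I \<Longrightarrow> bounded_measurable N (f i)"
  shows "operator_measure_integral K \<nu> (\<lambda>x. \<Sum>i\<in>I. f i x *\<^sub>R M i) = (\<Sum>i\<in>I. J (f i) (M i))"
proof -
  have "J (\<lambda>x. herm_inner (\<Sum>i\<in>I. f i x *\<^sub>R M i) H) H = (\<Sum>i\<in>I. J (\<lambda>x. herm_inner (f i x *\<^sub>R M i) H) H)" for H
    unfolding linear_sum[OF linear_herm_inner] linear_scale[OF linear_herm_inner] real_scaleR_def
    by (intro J_sum I bounded_measurable_mult bounded_measurable_const f)
  then have "operator_measure_integral K \<nu> (\<lambda>x. \<Sum>i\<in>I. f i x *\<^sub>R M i) =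
      (\<Sum>k\<in>UNIV. \<Sum>l\<in>UNIV. \<Sum>i\<in>I. J (\<lambda>x. herm_inner (f i x *\<^sub>R M i) (herm_basis k l)) (herm_basis k l))"
    unfolding operator_measure_integral_def J_def by (intro sum.cong refl)
  also have "\<dots> = (\<Sum>k\<in>UNIV. \<Sum>i\<in>I. \<Sum>l\<in>UNIV. J (\<lambda>x. herm_inner (f i x *\<^sub>R M i) (herm_basis k l)) (herm_basis k l))"
    by (intro sum.cong refl sum.swap)
  also have "\<dots> = (\<Sum>i\<in>I. \<Sum>k\<in>UNIV. \<Sum>l\<in>UNIV. J (\<lambda>x. herm_inner (f i x *\<^sub>R M i) (herm_basis k l)) (herm_basis k l))"
    by (rule sum.swap)
  also have "\<dots> = (\<Sum>i\<in>I. operator_measure_integral K \<nu> (\<lambda>x. f i x *\<^sub>R M i))"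
    by (simp add: operator_measure_integral_def J_def)
  finally show ?thesis using operator_integral_scaleR f by simp
qed

lemma herm_quad_operator_integral:
  assumes "\<And>k l. bounded_measurable N (\<lambda>x. herm_inner (g x) (herm_basis k l))"
  shows "herm_quad (operator_measure_integral K \<nu> g) v = (\<Sum>k\<in>UNIV. \<Sum>l\<in>UNIV.
    signed_integral N (\<lambda>S. herm_quad (\<nu> S (herm_basis k l)) v) (\<lambda>x. herm_inner (g x) (herm_basis k l)))"
proof -
  have "herm_quad (matrix_measure_integral N (\<lambda>S. \<nu> S (herm_basis k l)) (\<lambda>x. herm_inner (g x) (herm_basis k l))) v =
      signed_integral N (\<lambda>S. herm_quad (\<nu> S (herm_basis k l)) v) (\<lambda>x. herm_inner (g x) (herm_basis k l))" for k l
    by (rule herm_quad_integral[OF jordan_nu assms])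
  then show ?thesis
    unfolding operator_measure_integral_def linear_sum[OF linear_herm_quad] by (simp only:)
qed

end

text \<open>Tent functions of radius \<open>\<delta>\<close> around a finite net are divided by
  their sum, which is positive on \<open>K\<close> because the balls cover it.\<close>

lemma partition_of_unity_compact:
  fixes K :: "'a::metric_space set"
  assumes K: "compact K" and "0 < \<delta>"
  obtains D and f :: "'a \<Rightarrow> 'a \<Rightarrow> real" where "finite D" "D \<subseteq> K" "\<forall>d. continuous_on K (f d)"
    "\<forall>x\<in>K. \<forall>d. 0 \<le> f d x" "\<forall>x\<in>K. \<forall>d. \<delta> \<le> dist x d \<longrightarrow> f d x = 0"
    "\<forall>x\<in>K. (\<Sum>d\<in>D. f d x) = 1"
proof -
  have "seq_compact K" using K by (simp only: compact_eq_seq_compact_metric)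
  then have "\<exists>D. finite D \<and> D \<subseteq> K \<and> K \<subseteq> (\<Union>d\<in>D. ball d \<delta>)"
    using \<open>0 < \<delta>\<close> by (intro seq_compact_imp_totally_bounded[rule_format])
  then obtain D where D: "finite D" "D \<subseteq> K" "K \<subseteq> (\<Union>d\<in>D. ball d \<delta>)"
    by (elim exE conjE)
  define w where "w d x = max 0 (\<delta> - dist x d)" for d x :: 'a
  define W where "W x = (\<Sum>d\<in>D. w d x)" for x
  have w0: "0 \<le> w d x" for d x by (simp add: w_def)
  have pos: "0 < W x" if "x \<in> K" for x
  proof -
    have "x \<in> (\<Union>d\<in>D. ball d \<delta>)" using D(3) that by (rule subsetD)
    then obtain d where "d \<in> D" "dist d x < \<delta>" by auto
    then have "0 < w d x" by (simp add: w_def dist_commute)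
    then show ?thesis unfolding W_def using D(1) \<open>d \<in> D\<close> w0 by (intro sum_pos2[of D d])
  qed
  show ?thesis
  proof (rule that[of D "\<lambda>d x. w d x / W x"])
    show "finite D" "D \<subseteq> K" by fact+
    have cw: "continuous_on K (w d)" for d
      unfolding w_def by (intro continuous_intros)
    have cW: "continuous_on K W"
      unfolding W_def by (intro continuous_intros cw)
    show "\<forall>d. continuous_on K (\<lambda>x. w d x / W x)"
      using pos by (intro allI continuous_on_divide cw cW) fastforce
    show "\<forall>x\<in>K. \<forall>d. 0 \<le> w d x / W x"
      using w0 pos by (simp add: less_imp_le)
    show "\<forall>x\<in>K. \<forall>d. \<delta> \<le> dist x d \<longrightarrow> w d x / W x = 0"
      by (simp add: w_def)
    show "\<forall>x\<in>K. (\<Sum>d\<in>D. w d x / W x) = 1"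
    proof
      fix x assume "x \<in> K"
      from pos[OF this] show "(\<Sum>d\<in>D. w d x / W x) = 1"
        unfolding sum_divide_distrib[symmetric] W_def[symmetric] by simp
    qed
  qed
qed

text \<open>A partition of unity approximates a positive semidefinite function \<open>g\<close> uniformly by functions
  \<open>\<Sum>\<^sub>d f\<^sub>d g(d)\<close>, whose integrals \<open>\<Sum>\<^sub>d \<integral> f\<^sub>d d\<nu>[g(d)]\<close> are visibly positive semidefinite.\<close>

lemma operator_integral_psd:
  fixes K :: "'a::metric_space set" and \<nu> :: "'a set \<Rightarrow> 'm::{finite,linorder} herm \<Rightarrow> 'm herm"
  assumes pom: "positive_operator_measure K \<nu>" and K: "compact K"
    and cont: "\<And>k l. continuous_on K (\<lambda>x. herm_inner (g x) (herm_basis k l))"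
    and psd: "\<And>x. x \<in> K \<Longrightarrow> herm_psd (g x)"
  shows "herm_psd (operator_measure_integral K \<nu> g)"
  unfolding herm_psd_iff
proof
  fix v
  interpret positive_operator K \<nu> by standard (rule pom)
  define \<Phi> where "\<Phi> k l f = signed_integral N (\<lambda>S. herm_quad (\<nu> S (herm_basis k l)) v) f" for k l f
  have jm: "jordan_measure N (\<lambda>S. herm_quad (\<nu> S (herm_basis k l)) v)" for k l
    by (rule jordan_measure_quad[OF jordan_nu])
  have "\<exists>C. 0 \<le> C \<and> (\<forall>f e. bounded_measurable N f \<longrightarrow> (\<forall>x\<in>space N. \<bar>f x\<bar> \<le> e) \<longrightarrow> 0 \<le> e \<longrightarrow>
      \<bar>\<Phi> k l f\<bar> \<le> C * e)" for k l
    using signed_integral_bound[OF jm[of k l]] unfolding \<Phi>_def by metis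
  then obtain C where C0: "\<And>k l. 0 \<le> C k l"
    and C: "\<And>k l f e. bounded_measurable N f \<Longrightarrow> \<forall>x\<in>space N. \<bar>f x\<bar> \<le> e \<Longrightarrow> 0 \<le> e \<Longrightarrow> \<bar>\<Phi> k l f\<bar> \<le> C k l * e"
    by metis
  \<comment> \<open>One constant per basis pair, all independent of the approximation; letting
    \<open>e\<close> tend to \<open>0\<close> therefore removes the error.\<close>
  define c where "c = (\<Sum>k\<in>UNIV. \<Sum>l\<in>UNIV. C k l)"
  have "0 \<le> c" unfolding c_def by (intro sum_nonneg C0)
  let ?G = "\<lambda>x k l. herm_inner (g x) (herm_basis k l)"
  have bg: "bounded_measurable N (\<lambda>x. ?G x k l)" for k l
    by (rule bounded_measurable_continuous[OF K cont])
  have approx: "- (c * e) \<le> herm_quad (operator_measure_integral K \<nu> g) v" if "0 < e" for e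
  proof -
    \<comment> \<open>All coordinates are packed into one matrix, so uniform continuity yields a
      single \<open>\<delta>\<close> for them.\<close>
    have "continuous_on K (\<lambda>x. \<chi> k l. ?G x k l)"
      by (intro continuous_on_vec_lambda cont)
    then have "uniformly_continuous_on K (\<lambda>x. \<chi> k l. ?G x k l)"
      using K by (rule compact_uniformly_continuous)
    then obtain \<delta> where \<delta>: "0 < \<delta>" "\<And>x y. x \<in> K \<Longrightarrow> y \<in> K \<Longrightarrow> dist y x < \<delta> \<Longrightarrow>
        dist (\<chi> k l. ?G y k l) (\<chi> k l. ?G x k l) < e"
      using \<open>0 < e\<close> unfolding uniformly_continuous_on_def by metis
    have close: "\<bar>?G y k l - ?G x k l\<bar> \<le> e" if "x \<in> K" "y \<in> K" "dist y x < \<delta>" for x y k l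
    proof -
      have "\<bar>?G y k l - ?G x k l\<bar> \<le> dist ((\<chi> k l. ?G y k l) $ k) ((\<chi> k l. ?G x k l) $ k)"
        using dist_vec_nth_le[of "(\<chi> k l. ?G y k l) $ k" l "(\<chi> k l. ?G x k l) $ k"] by (simp add: dist_real_def)
      also have "\<dots> \<le> dist (\<chi> k l. ?G y k l) (\<chi> k l. ?G x k l)"
        by (rule dist_vec_nth_le)
      finally show ?thesis using \<delta>(2)[OF that] by linarith
    qed
    obtain D and f :: "'a \<Rightarrow> 'a \<Rightarrow> real" where D: "finite D" "D \<subseteq> K" and f: "\<forall>d. continuous_on K (f d)"
      "\<forall>x\<in>K. \<forall>d. 0 \<le> f d x" "\<forall>x\<in>K. \<forall>d. \<delta> \<le> dist x d \<longrightarrow> f d x = 0" "\<forall>x\<in>K. (\<Sum>d\<in>D. f d x) = 1"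
      by (rule partition_of_unity_compact[OF K \<delta>(1)])
    note f = f[rule_format]
    have bf: "bounded_measurable N (f d)" for d
      by (rule bounded_measurable_continuous[OF K f(1)])
    define h where "h x = (\<Sum>d\<in>D. f d x *\<^sub>R g d)" for x
    have H: "herm_inner (h x) (herm_basis k l) = (\<Sum>d\<in>D. f d x * ?G d k l)" for x k l
      by (simp add: h_def linear_sum[OF linear_herm_inner] linear_scale[OF linear_herm_inner])
    have bh: "bounded_measurable N (\<lambda>x. herm_inner (h x) (herm_basis k l))" for k l
      unfolding H using D(1) by (intro bounded_measurable_sum bounded_measurable_mult bounded_measurable_const bf)
    have "operator_measure_integral K \<nu> h = (\<Sum>d\<in>D. J (f d) (g d))"
      unfolding h_def by (rule operator_integral_sum[OF D(1) bf])
    then have "0 \<le> herm_quad (operator_measure_integral K \<nu> h) v"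
      using J_psd[OF psd bf f(2)] D(2)
      by (auto simp: linear_sum[OF linear_herm_quad] herm_psd_iff intro!: sum_nonneg)
    moreover have "\<bar>\<Phi> k l (\<lambda>x. ?G x k l) - \<Phi> k l (\<lambda>x. herm_inner (h x) (herm_basis k l))\<bar> \<le> C k l * e" for k l
    proof -
      let ?d = "\<lambda>x. ?G x k l + (-1) * herm_inner (h x) (herm_basis k l)"
      have bd: "bounded_measurable N ?d"
        by (intro bounded_measurable_add bounded_measurable_mult bounded_measurable_const bg bh)
      have "\<bar>?d x\<bar> \<le> e" if x: "x \<in> K" for x
      proof -
        \<comment> \<open>Since the weights sum to \<open>1\<close>, the error is a weighted average
          of \<open>?G x k l - ?G d k l\<close>, and only centres \<open>d\<close> within
          \<open>\<delta>\<close> of \<open>x\<close> carry weight.\<close>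
        have "?d x = (\<Sum>d\<in>D. f d x) * ?G x k l - (\<Sum>d\<in>D. f d x * ?G d k l)"
          using f(4)[OF x] by (simp add: H)
        also have "\<dots> = (\<Sum>d\<in>D. f d x * (?G x k l - ?G d k l))"
          by (simp add: sum_distrib_right right_diff_distrib sum_subtractf)
        also have "\<bar>\<dots>\<bar> \<le> (\<Sum>d\<in>D. \<bar>f d x * (?G x k l - ?G d k l)\<bar>)" by (rule sum_abs)
        also have "\<dots> \<le> (\<Sum>d\<in>D. f d x * e)"
        proof (rule sum_mono)
          fix d assume "d \<in> D"
          then show "\<bar>f d x * (?G x k l - ?G d k l)\<bar> \<le> f d x * e"
            using f(2,3)[OF x, of d] close[of d x k l] D(2) x
            by (cases "dist x d < \<delta>") (auto simp: abs_mult intro!: mult_left_mono)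
        qed
        also have "\<dots> = e" using f(4)[OF x] by (simp flip: sum_distrib_right)
        finally show ?thesis .
      qed
      then have "\<bar>\<Phi> k l ?d\<bar> \<le> C k l * e"
        using \<open>0 < e\<close> by (intro C bd) (auto simp: space_restrict_space)
      moreover have "\<Phi> k l ?d = \<Phi> k l (\<lambda>x. ?G x k l) + (-1) * \<Phi> k l (\<lambda>x. herm_inner (h x) (herm_basis k l))"
        unfolding \<Phi>_def signed_integral_scale[OF jm bh, symmetric]
        by (intro signed_integral_add jm bounded_measurable_mult bounded_measurable_const bg bh)
      ultimately show ?thesis by simp
    qed
    then have "(\<Sum>k\<in>UNIV. \<Sum>l\<in>UNIV. \<Phi> k l (\<lambda>x. herm_inner (h x) (herm_basis k l)) - C k l * e) \<le>
        (\<Sum>k\<in>UNIV. \<Sum>l\<in>UNIV. \<Phi> k l (\<lambda>x. ?G x k l))"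
      by (intro sum_mono) (simp add: abs_le_iff algebra_simps)
    then have "herm_quad (operator_measure_integral K \<nu> h) v - c * e \<le> herm_quad (operator_measure_integral K \<nu> g) v"
      unfolding herm_quad_operator_integral[OF bg] herm_quad_operator_integral[OF bh] \<Phi>_def[symmetric] c_def
      by (simp add: sum_subtractf sum_distrib_right)
    ultimately show ?thesis by linarith
  qed
  show "0 \<le> herm_quad (operator_measure_integral K \<nu> g) v"
  proof (rule field_le_epsilon)
    fix d :: real assume "0 < d"
    then have "- (c * (d / (c + 1))) \<le> herm_quad (operator_measure_integral K \<nu> g) v"
      using \<open>0 \<le> c\<close> by (intro approx) simp
    moreover have "c * (d / (c + 1)) \<le> d"
      using \<open>0 \<le> c\<close> \<open>0 < d\<close> by (simp add: field_simps)
    ultimately show "0 \<le> herm_quad (operator_measure_integral K \<nu> g) v + d" by linarith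
  qed
qed

section \<open>The two implications\<close>

lemma compact_translate: "compact K \<Longrightarrow> compact ((\<lambda>k. k - y) ` K)" for K :: "(real^'n::finite) set"
  by (intro compact_continuous_image continuous_intros)

text \<open>After exchanging the sums, the inner sum over \<open>\<alpha>\<close> is, for each
  monomial of \<open>p\<close>, the Taylor expansion of \<open>monom_eval \<beta> (x + t)\<close> in
  \<open>t\<close>, integrated term by term against the moments.\<close>

lemma op_at_eq_integral:
  fixes K :: "(real^'n::finite) set"
    and Q :: "'n multiindex \<Rightarrow> 'm::{finite,linorder} herm \<Rightarrow> ('m, 'n) herm_mpoly"
  assumes K: "compact K" and Q: "\<And>\<alpha>. linear (Q \<alpha>)" and \<nu>: "represents_at K Q y \<nu>"
  shows "mpoly_eval (op_at Q y p) x =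
    operator_measure_integral ((\<lambda>k. k - y) ` K) \<nu> (\<lambda>t. mpoly_eval p (x + t))"
proof -
  interpret positive_operator "(\<lambda>k. k - y) ` K" \<nu>
    using \<nu> by unfold_locales (simp add: represents_at_def)
  have W: "mpoly_eval (Q \<alpha> M) y = J (monom_eval \<alpha>) M" for \<alpha> M
    using \<nu> by (simp add: represents_at_def J_def)
  have bm: "bounded_measurable N (\<lambda>t. monom_eval \<alpha> (z + t))" for \<alpha> z
    by (intro bounded_measurable_continuous compact_translate K continuous_intros)
  have bm0: "bounded_measurable N (monom_eval \<alpha>)" for \<alpha>
    using bm[of \<alpha> 0] by simp
  let ?B = "Poly_Mapping.keys p" and ?D = "\<Union>\<beta>\<in>Poly_Mapping.keys p. {\<alpha>. \<forall>i. \<alpha> $ i \<le> \<beta> $ i}"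
  let ?c = "\<lambda>\<alpha> \<beta>. mpoly_eval (mderiv \<alpha> (Poly_Mapping.single \<beta> 1)) x / mfact \<alpha>"
  have D: "finite ?D" "\<And>\<beta>. \<beta> \<in> ?B \<Longrightarrow> {\<alpha>. \<forall>i. \<alpha> $ i \<le> \<beta> $ i} \<subseteq> ?D"
    by (auto simp: finite_multiindex_le)
  have "mpoly_eval (op_at Q y p) x =
      (\<Sum>\<alpha>\<in>?D. \<Sum>\<beta>\<in>?B. ?c \<alpha> \<beta> *\<^sub>R J (monom_eval \<alpha>) (Poly_Mapping.lookup p \<beta>))"
    unfolding W[symmetric] by (rule mpoly_eval_op_at[OF Q finite_keys order_refl D])
  also have "\<dots> = (\<Sum>\<beta>\<in>?B. \<Sum>\<alpha>\<in>?D. ?c \<alpha> \<beta> *\<^sub>R J (monom_eval \<alpha>) (Poly_Mapping.lookup p \<beta>))"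
    by (rule sum.swap)
  also have "\<dots> = (\<Sum>\<beta>\<in>?B. J (\<lambda>t. monom_eval \<beta> (x + t)) (Poly_Mapping.lookup p \<beta>))"
  proof (rule sum.cong[OF refl])
    fix \<beta> assume \<beta>: "\<beta> \<in> ?B"
    have "(\<lambda>t. monom_eval \<beta> (x + t)) = (\<lambda>t. \<Sum>\<alpha>\<in>?D. ?c \<alpha> \<beta> * monom_eval \<alpha> t)"
      by (rule ext) (rule monom_eval_taylor[OF D(1) D(2)[OF \<beta>]])
    moreover have "J (\<lambda>t. \<Sum>\<alpha>\<in>?D. ?c \<alpha> \<beta> * monom_eval \<alpha> t) M =
        (\<Sum>\<alpha>\<in>?D. J (\<lambda>t. ?c \<alpha> \<beta> * monom_eval \<alpha> t) M)" for M
      by (intro J_sum D(1) bounded_measurable_mult bounded_measurable_const bm0)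
    ultimately show "(\<Sum>\<alpha>\<in>?D. ?c \<alpha> \<beta> *\<^sub>R J (monom_eval \<alpha>) (Poly_Mapping.lookup p \<beta>)) =
        J (\<lambda>t. monom_eval \<beta> (x + t)) (Poly_Mapping.lookup p \<beta>)"
      by (simp only: J_scale[OF bm0])
  qed
  also have "\<dots> = operator_measure_integral ((\<lambda>k. k - y) ` K) \<nu>
      (\<lambda>t. \<Sum>\<beta>\<in>?B. monom_eval \<beta> (x + t) *\<^sub>R Poly_Mapping.lookup p \<beta>)"
    by (rule operator_integral_sum[symmetric]) (auto intro: bm)
  finally show ?thesis by (simp add: mpoly_eval_def)
qed

lemma preserver_if_represents:
  fixes K :: "(real^'n::finite) set"
    and Q :: "'n multiindex \<Rightarrow> 'm::{finite,linorder} herm \<Rightarrow> ('m, 'n) herm_mpoly"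
  assumes K: "compact K" and Q: "\<And>\<alpha>. linear (Q \<alpha>)" and \<nu>: "\<forall>y\<in>K. \<exists>\<nu>. represents_at K Q y \<nu>"
  shows "canonical_op Q ` Pos K \<subseteq> Pos K"
proof (clarsimp simp: Pos_def)
  fix p :: "('m, 'n) herm_mpoly" and y
  assume p: "\<forall>x\<in>K. herm_psd (mpoly_eval p x)" and y: "y \<in> K"
  obtain \<nu> where \<nu>: "represents_at K Q y \<nu>" using assms(3) y by auto
  have "continuous_on ((\<lambda>k. k - y) ` K) (\<lambda>t. herm_inner (mpoly_eval p (y + t)) (herm_basis k l))" for k l
    unfolding mpoly_eval_def linear_sum[OF linear_herm_inner] linear_scale[OF linear_herm_inner] real_scaleR_def
    by (intro continuous_intros)
  moreover have "herm_psd (mpoly_eval p (y + t))" if "t \<in> (\<lambda>k. k - y) ` K" for t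
    using that p by auto
  ultimately have "herm_psd (operator_measure_integral ((\<lambda>k. k - y) ` K) \<nu> (\<lambda>t. mpoly_eval p (y + t)))"
    using \<nu> by (intro operator_integral_psd compact_translate K) (auto simp: represents_at_def)
  then show "herm_psd (mpoly_eval (canonical_op Q p) y)"
    by (simp add: canonical_op_eq_op_at[OF Q] op_at_eq_integral[OF K Q \<nu>])
qed

text \<open>The functional \<open>q \<mapsto> (T (q(x - y) M))(y)\<close> on real polynomials, whose representing measure on
  \<open>K - y\<close> is \<open>\<nu>\<^sub>y[M]\<close>.\<close>

definition moment_functional ::
  "('n::finite multiindex \<Rightarrow> 'm::finite herm \<Rightarrow> ('m, 'n) herm_mpoly) \<Rightarrow> real^'n \<Rightarrow>
   'n real_mpoly \<Rightarrow> 'm herm \<Rightarrow> 'm herm" where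
  "moment_functional Q y q M =
     (\<Sum>\<alpha>\<in>Poly_Mapping.keys q. Poly_Mapping.lookup q \<alpha> *\<^sub>R mpoly_eval (Q \<alpha> M) y)"

lemma moment_functional_superset:
  assumes "finite A" "Poly_Mapping.keys q \<subseteq> A"
  shows "moment_functional Q y q M = (\<Sum>\<alpha>\<in>A. Poly_Mapping.lookup q \<alpha> *\<^sub>R mpoly_eval (Q \<alpha> M) y)"
  unfolding moment_functional_def using assms
  by (intro sum.mono_neutral_left) (auto simp: in_keys_iff)

lemma linear_moment_functional_left:
  fixes Q :: "'n::finite multiindex \<Rightarrow> 'm::finite herm \<Rightarrow> ('m, 'n) herm_mpoly"
  shows "linear (\<lambda>q. moment_functional Q y q M)"
proof (rule linearI)
  fix p q :: "'n real_mpoly" and c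
  let ?A = "Poly_Mapping.keys p \<union> Poly_Mapping.keys q"
  have "moment_functional Q y r M = (\<Sum>\<alpha>\<in>?A. Poly_Mapping.lookup r \<alpha> *\<^sub>R mpoly_eval (Q \<alpha> M) y)"
    if "r \<in> {p, q, p + q}" for r
    using that Poly_Mapping.keys_add[of p q] by (intro moment_functional_superset) auto
  then show "moment_functional Q y (p + q) M = moment_functional Q y p M + moment_functional Q y q M"
    by (simp add: lookup_add scaleR_add_left sum.distrib)
  have "Poly_Mapping.keys (c *\<^sub>R p) \<subseteq> Poly_Mapping.keys p"
    by (auto simp: in_keys_iff scaleR_poly_mapping.rep_eq)
  then show "moment_functional Q y (c *\<^sub>R p) M = c *\<^sub>R moment_functional Q y p M"
    by (subst moment_functional_superset[of "Poly_Mapping.keys p"])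
      (auto simp: moment_functional_def scaleR_poly_mapping.rep_eq scaleR_sum_right)
qed

lemma linear_moment_functional_right:
  assumes "\<And>\<alpha>. linear (Q \<alpha>)"
  shows "linear (moment_functional Q y q)"
  by (rule linearI) (simp_all add: moment_functional_def linear_add[OF assms] linear_scale[OF assms]
      mpoly_eval_add mpoly_eval_scaleR scaleR_add_right sum.distrib scaleR_sum_right mult.commute)

lemma moment_functional_single:
  "moment_functional Q y (Poly_Mapping.single \<beta> 1) M = mpoly_eval (Q \<beta> M) y"
  by (simp add: moment_functional_def)

lemma moment_functional_psd:
  assumes Q: "\<And>\<alpha>. linear (Q \<alpha>)" and T: "canonical_op Q ` Pos K \<subseteq> Pos K" and y: "y \<in> K"
    and q: "\<And>t. t \<in> (\<lambda>k. k - y) ` K \<Longrightarrow> 0 \<le> mpoly_eval q t" and M: "herm_psd M"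
  shows "herm_psd (moment_functional Q y q M)"
proof -
  obtain f where f: "\<And>x. mpoly_eval q (x + (- y)) = mpoly_eval f x"
    using polynomial_fun_translate[of q "- y"] unfolding polynomial_fun_def by blast
  then have f': "mpoly_eval f x = mpoly_eval q (x - y)" for x
    using f[of x] by simp
  have "scalar_times f M \<in> Pos K"
    using q by (auto simp: Pos_def mpoly_eval_scalar_times f' intro!: herm_psd_scaleR M)
  then have "herm_psd (mpoly_eval (canonical_op Q (scalar_times f M)) y)"
    using T y by (auto simp: Pos_def)
  then show ?thesis
    unfolding mpoly_eval_canonical_op_translate[OF Q f'] moment_functional_def .
qed

lemma represents_if_preserver:
  fixes K :: "(real^'n::finite) set"
    and Q :: "'n multiindex \<Rightarrow> 'm::finite herm \<Rightarrow> ('m, 'n) herm_mpoly"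
  assumes K: "compact K" and Q: "\<And>\<alpha>. linear (Q \<alpha>)" and T: "canonical_op Q ` Pos K \<subseteq> Pos K"
    and y: "y \<in> K"
  shows "\<exists>\<nu>. represents_at K Q y \<nu>"
proof -
  interpret dense_functions "(\<lambda>k. k - y) ` K" "mpoly_eval :: 'n real_mpoly \<Rightarrow> real^'n \<Rightarrow> real"
    "Poly_Mapping.single 0 1"
  proof
    show "compact ((\<lambda>k. k - y) ` K)" using K by (rule compact_translate)
    show "continuous_on ((\<lambda>k. k - y) ` K) (mpoly_eval p)" for p :: "'n real_mpoly"
    proof -
      have "continuous_on ((\<lambda>k. k - y) ` K) (\<lambda>x. mpoly_eval p x)"
        unfolding mpoly_eval_def by (intro continuous_intros)
      then show ?thesis .
    qed
    show "mpoly_eval (Poly_Mapping.single 0 1) x = (1::real)" for x :: "real^'n"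
      by (simp only: mpoly_eval_single monom_eval_0 real_scaleR_def mult_1)
    show "\<exists>p. \<forall>x\<in>(\<lambda>k. k - y) ` K. \<bar>f x - mpoly_eval p x\<bar> < \<epsilon>"
      if "continuous_on ((\<lambda>k. k - y) ` K) f" "0 < \<epsilon>" for f :: "real^'n \<Rightarrow> real" and \<epsilon>
      using compact_translate[OF K, of y] that by (rule mpoly_dense)
  qed (simp_all add: mpoly_eval_add mpoly_eval_scaleR)
  let ?L = "moment_functional Q y"
  have linQ: "linear (\<lambda>q. herm_quad (?L q M) v)" for M v
    using linear_compose[OF linear_moment_functional_left linear_herm_quad] by (simp add: o_def)
  have pos: "\<exists>\<sigma>. represents (\<lambda>q. herm_quad (?L q M) v) \<sigma> \<and> (\<forall>S\<in>sets N. 0 \<le> \<sigma> S)"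
    if "herm_psd M" for M v
    using represents_positive[OF linQ[of M v]] moment_functional_psd[OF Q T y _ that]
    unfolding herm_psd_iff by metis
  \<comment> \<open>For \<open>M\<close> that is not psd the representing set function is only a
    difference of positive measures.\<close>
  have rep: "\<exists>\<sigma>. represents (\<lambda>q. herm_quad (?L q M) v) \<sigma>" for M v
  proof -
    obtain B C where BC: "herm_psd B" "herm_psd C" "M = B - C" by (rule herm_diff_psd)
    obtain \<sigma> \<tau> where "represents (\<lambda>q. herm_quad (?L q B) v) \<sigma>" "represents (\<lambda>q. herm_quad (?L q C) v) \<tau>"
      using pos BC(1,2) by blast
    then have "represents (\<lambda>q. herm_quad (?L q B) v + (-1) * herm_quad (?L q C) v) (\<lambda>S. \<sigma> S + (-1) * \<tau> S)"
      by (intro represents_add represents_scale)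
    moreover have "herm_quad (?L q B) v + (-1) * herm_quad (?L q C) v = herm_quad (?L q M) v" for q
      by (simp add: BC(3) linear_diff[OF linear_moment_functional_right[OF Q]] linear_diff[OF linear_herm_quad])
    ultimately show ?thesis by auto
  qed
  \<comment> \<open>The representatives are chosen separately for each entry and each
    \<open>M\<close>. Hermitian symmetry, linearity in \<open>M\<close> and positivity all follow
    afterwards from uniqueness.\<close>
  define re where "re i j M = representing (\<lambda>q. Re (herm_mat (?L q M) $ i $ j))" for i j M
  define im where "im i j M = representing (\<lambda>q. Im (herm_mat (?L q M) $ i $ j))" for i j M
  have polar: "\<exists>\<sigma>. represents (\<lambda>q. (herm_quad (?L q M) u + (- herm_quad (?L q M) v - herm_quad (?L q M) w)) / 2) \<sigma>"
    for M u v w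
  proof -
    obtain \<sigma>1 \<sigma>2 \<sigma>3 where "represents (\<lambda>q. herm_quad (?L q M) u) \<sigma>1"
      "represents (\<lambda>q. herm_quad (?L q M) v) \<sigma>2" "represents (\<lambda>q. herm_quad (?L q M) w) \<sigma>3"
      using rep by metis
    then have "represents (\<lambda>q. (1/2) * (herm_quad (?L q M) u + ((-1) * herm_quad (?L q M) v + (-1) * herm_quad (?L q M) w)))
        (\<lambda>S. (1/2) * (\<sigma>1 S + ((-1) * \<sigma>2 S + (-1) * \<sigma>3 S)))"
      by (intro represents_scale represents_add)
    then show ?thesis by auto
  qed
  have re: "represents (\<lambda>q. Re (herm_mat (?L q M) $ i $ j)) (re i j M)" for i j M
    using polar represents_representing unfolding re_def Re_herm_mat_eq by blast
  have im: "represents (\<lambda>q. Im (herm_mat (?L q M) $ i $ j)) (im i j M)" for i j M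
    using polar represents_representing unfolding im_def Im_herm_mat_eq by blast
  \<comment> \<open>Off the measurable sets the chosen values need not form a Hermitian matrix, and
    \<open>Abs_herm\<close> is then unspecified; \<open>entry\<close> is accordingly restricted to
    \<open>S \<in> sets N\<close>.\<close>
  define \<nu> where "\<nu> S M = Abs_herm (\<chi> i j. Complex (re i j M S) (im i j M S))" for S M
  have entry: "herm_mat (\<nu> S M) $ i $ j = Complex (re i j M S) (im i j M S)" if S: "S \<in> sets N" for S M i j
  proof -
    have sre: "re j i M S = re i j M S" for i j
      using re[of M i j] re[of M j i] S by (intro represents_unique) (simp_all add: Re_herm_mat_sym[of _ j i])
    have sim: "im j i M S = - im i j M S" for i j
    proof -
      have "represents (\<lambda>q. (-1) * Im (herm_mat (?L q M) $ i $ j)) (\<lambda>S. (-1) * im i j M S)"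
        by (intro represents_scale im)
      then have "represents (\<lambda>q. Im (herm_mat (?L q M) $ j $ i)) (\<lambda>S. (-1) * im i j M S)"
        by (simp add: Im_herm_mat_sym[of _ j i])
      from represents_unique[OF im this S] show ?thesis by simp
    qed
    have "hermitian (\<chi> i j. Complex (re i j M S) (im i j M S))"
      unfolding hermitian_def
    proof (intro allI)
      fix i j
      show "cnj ((\<chi> i j. Complex (re i j M S) (im i j M S)) $ i $ j) =
          (\<chi> i j. Complex (re i j M S) (im i j M S)) $ j $ i"
        by (simp add: complex_eq_iff sre[where i = i and j = j] sim[where i = i and j = j])
    qed
    then show ?thesis by (simp add: \<nu>_def Abs_herm_inverse)
  qed
  have lin: "linear (\<nu> S)" if S: "S \<in> sets N" for S
  proof (rule linearI; rule herm_eqI)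
    fix M M' c i j
    have "re i j (M + M') S = re i j M S + re i j M' S"
      using represents_unique[OF re _ S] represents_add[OF re[of M i j] re[of M' i j]]
      by (simp add: linear_add[OF linear_moment_functional_right[OF Q]] plus_herm.rep_eq)
    moreover have "im i j (M + M') S = im i j M S + im i j M' S"
      using represents_unique[OF im _ S] represents_add[OF im[of M i j] im[of M' i j]]
      by (simp add: linear_add[OF linear_moment_functional_right[OF Q]] plus_herm.rep_eq)
    ultimately show "herm_mat (\<nu> S (M + M')) $ i $ j = herm_mat (\<nu> S M + \<nu> S M') $ i $ j"
      by (simp add: entry[OF S] plus_herm.rep_eq complex_eq_iff)
    have "re i j (c *\<^sub>R M) S = c * re i j M S"
      using represents_unique[OF re _ S] represents_scale[OF re[of M i j], of c]
      by (simp add: linear_scale[OF linear_moment_functional_right[OF Q]] scaleR_herm.rep_eq)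
    moreover have "im i j (c *\<^sub>R M) S = c * im i j M S"
      using represents_unique[OF im _ S] represents_scale[OF im[of M i j], of c]
      by (simp add: linear_scale[OF linear_moment_functional_right[OF Q]] scaleR_herm.rep_eq)
    ultimately show "herm_mat (\<nu> S (c *\<^sub>R M)) $ i $ j = herm_mat (c *\<^sub>R \<nu> S M) $ i $ j"
      by (simp add: entry[OF S] scaleR_herm.rep_eq complex_eq_iff)
  qed
  have reN: "represents (\<lambda>q. Re (herm_mat (?L q M) $ i $ j)) (\<lambda>S. Re (herm_mat (\<nu> S M) $ i $ j))"
    and imN: "represents (\<lambda>q. Im (herm_mat (?L q M) $ i $ j)) (\<lambda>S. Im (herm_mat (\<nu> S M) $ i $ j))" for i j M
    by (rule represents_cong[OF re]; simp add: entry) (rule represents_cong[OF im]; simp add: entry)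
  have "herm_psd (\<nu> S M)" if S: "S \<in> sets N" and M: "herm_psd M" for S M
    unfolding herm_psd_iff
  proof
    fix v
    have "represents (\<lambda>q. herm_quad (?L q M) v) (\<lambda>S. herm_quad (\<nu> S M) v)"
      unfolding herm_quad_expand by (intro represents_sum finite represents_add represents_scale reN imN)
    \<comment> \<open>The quadratic form of \<open>\<nu>\<close> and the nonnegative set function
      supplied by \<open>pos\<close> represent the same functional, so they agree at
      \<open>S\<close>.\<close>
    with pos[OF M, of v] show "0 \<le> herm_quad (\<nu> S M) v"
      using represents_unique[OF _ _ S] S by metis
  qed
  moreover have "matrix_measure N (\<lambda>S. \<nu> S M)" for M
    using reN imN jordan_measure_signed
    unfolding matrix_measure_def complex_measure_iff represents_def by blast
  moreover have "mpoly_eval (Q \<beta> M) y = matrix_measure_integral N (\<lambda>S. \<nu> S M) (monom_eval \<beta>)" for \<beta> M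
  proof (rule herm_eqI)
    fix i j
    have e: "mpoly_eval (Poly_Mapping.single \<beta> 1) = (monom_eval \<beta> :: real^'n \<Rightarrow> real)"
      by (rule ext) (simp add: mpoly_eval_single)
    have "Re (herm_mat (mpoly_eval (Q \<beta> M) y) $ i $ j) =
        signed_integral N (\<lambda>S. Re (herm_mat (\<nu> S M) $ i $ j)) (monom_eval \<beta>)"
      using reN[where M = M and i = i and j = j] unfolding represents_def e[symmetric]
      by (simp flip: moment_functional_single)
    moreover have "Im (herm_mat (mpoly_eval (Q \<beta> M) y) $ i $ j) =
        signed_integral N (\<lambda>S. Im (herm_mat (\<nu> S M) $ i $ j)) (monom_eval \<beta>)"
      using imN[where M = M and i = i and j = j] unfolding represents_def e[symmetric]
      by (simp flip: moment_functional_single)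
    ultimately show "herm_mat (mpoly_eval (Q \<beta> M) y) $ i $ j =
        herm_mat (matrix_measure_integral N (\<lambda>S. \<nu> S M) (monom_eval \<beta>)) $ i $ j"
      by (simp add: herm_mat_integral complex_eq_iff)
  qed
  ultimately have "represents_at K Q y \<nu>"
    using lin by (auto simp: represents_at_def positive_operator_measure_def positive_matrix_measure_def)
  then show ?thesis by blast
qed

theorem theorem5p4:
  fixes K :: "(real^'n::finite) set"
    and T :: "('m::{finite,linorder}, 'n) herm_mpoly \<Rightarrow> ('m, 'n) herm_mpoly"
    and Q :: "'n multiindex \<Rightarrow> 'm herm \<Rightarrow> ('m, 'n) herm_mpoly"
  assumes "compact K"
    and "linear T"
    and "canonical_rep T Q"
  shows "(T ` Pos K \<subseteq> Pos K \<longleftrightarrow> (\<forall>y\<in>K. \<exists>\<nu>. represents_at K Q y \<nu>)) \<and>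
    (\<forall>\<nu>. (\<forall>y\<in>K. represents_at K Q y (\<nu> y)) \<longrightarrow>
      (\<forall>y\<in>K. \<forall>x\<in>K. \<forall>p. mpoly_eval (op_at Q y p) x =
        operator_measure_integral ((\<lambda>k. k - y) ` K) (\<nu> y) (\<lambda>t. mpoly_eval p (x + t))))"
proof -
  have Q: "\<And>\<alpha>. linear (Q \<alpha>)" and T: "T = canonical_op Q"
    using assms(3) by (auto simp: canonical_rep_def)
  have "T ` Pos K \<subseteq> Pos K \<longleftrightarrow> (\<forall>y\<in>K. \<exists>\<nu>. represents_at K Q y \<nu>)"
    unfolding T
  proof
    assume "canonical_op Q ` Pos K \<subseteq> Pos K"
    then show "\<forall>y\<in>K. \<exists>\<nu>. represents_at K Q y \<nu>"
      by (intro ballI represents_if_preserver[OF assms(1) Q])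
  next
    assume "\<forall>y\<in>K. \<exists>\<nu>. represents_at K Q y \<nu>"
    then show "canonical_op Q ` Pos K \<subseteq> Pos K"
      by (rule preserver_if_represents[OF assms(1) Q])
  qed
  then show ?thesis
  proof (intro conjI allI impI ballI)
    fix \<nu> y x p assume "\<forall>y\<in>K. represents_at K Q y (\<nu> y)" and "y \<in> K"
    then have "represents_at K Q y (\<nu> y)" by (rule bspec)
    then show "mpoly_eval (op_at Q y p) x =
        operator_measure_integral ((\<lambda>k. k - y) ` K) (\<nu> y) (\<lambda>t. mpoly_eval p (x + t))"
      by (rule op_at_eq_integral[OF assms(1) Q])
  qed
qed

end
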